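(* Let $A\subset\mathbb R^n$ be arbitrary, let $(U_k)_{k\in\mathbb N}$ be an increasing sequence of universally measurable subsets of $\mathbb R^n$ with $\bigcup_k U_k=\mathbb R^n$, and set $A_k:=A\cap U_k$. Then for every $\mu\in\mathfrak M^+$: $\mu^{A_k}\to\mu^A$ vaguely, and $\kappa_\alpha\mu^{A_k}\uparrow\kappa_\alpha\mu^A$ pointwise on $\mathbb R^n$ as $k\to\infty$. If moreover $\mu$ has finite energy, then also $\lim_{k\to\infty}\|\mu^{A_k}-\mu^A\|_\alpha=0$.
   Context: Standing assumptions: $n\ge3$, $\alpha\in(0,2]$, and $\kappa_\alpha(x,y)=|x-y|^{\alpha-n}$ is the Riesz kernel on $\mathbb R^n$. $\mathfrak M^+$ denotes the cone of positive Radon measures $\mu$ on $\mathbb R^n$ whose potential $\kappa_\alpha\mu(x)=\int|x-z|^{\alpha-n}d\mu(z)$ is not identically $+\infty$. The vague topology is that of pointwise convergence on continuous compactly supported functions. $\mathcal E_\alpha$ is the pre-Hilbert space of signed Radon measures of finite energy with inner product $\kappa_\alpha(\mu,\nu)=\iint\kappa_\alpha\,d\mu\,d\nu$ and norm $\|\mu\|_\alpha$; $\mathcal E^+_\alpha(A)$ is the set of positive measures of finite energy concentrated on $A$. The inner capacity of $A\subset\mathbb R^n$ is defined by $1/c_\alpha(A)=\inf\{\|\mu\|_\alpha^2:\ \mu\in\mathcal E^+_\alpha(A),\ \mu(\mathbb R^n)=1\}$. "n.e. on $A$" means: for all points of $A$ except a subset of inner capacity zero. Inner balayage: for $\mu\in\mathfrak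 M^+$ and arbitrary $A$, $\mu^A$ is the unique measure in $\mathfrak M^+$ with $\kappa_\alpha\mu^A=\inf\{\kappa_\alpha\nu:\ \nu\in\mathfrak M^+,\ \kappa_\alpha\nu\ge\kappa_\alpha\mu \text{ n.e. on }A\}$ pointwise. *)

theory Defs
  imports "HOL-Analysis.Analysis"
begin

definition riesz_kernel :: "real \<Rightarrow> 'a::euclidean_space \<Rightarrow> 'a \<Rightarrow> ennreal" where
  "riesz_kernel \<alpha> x y =
     (if x = y then \<infinity> else ennreal (dist x y powr (\<alpha> - real DIM('a))))"

definition radon_pos :: "'a::euclidean_space measure \<Rightarrow> bool" where
  "radon_pos \<mu> \<longleftrightarrow> sets \<mu> = sets borel \<and> (\<forall>K. compact K \<longrightarrow> emeasure \<mu> K < \<infinity>)"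

definition potential :: "real \<Rightarrow> 'a::euclidean_space measure \<Rightarrow> 'a \<Rightarrow> ennreal" where
  "potential \<alpha> \<mu> x = (\<integral>\<^sup>+ z. riesz_kernel \<alpha> x z \<partial>\<mu>)"

definition Mplus :: "real \<Rightarrow> 'a::euclidean_space measure set" where
  "Mplus \<alpha> = {\<mu>. radon_pos \<mu> \<and> \<not> (\<forall>x. potential \<alpha> \<mu> x = \<infinity>)}"

definition mutual_energy :: "real \<Rightarrow> 'a::euclidean_space measure \<Rightarrow> 'a measure \<Rightarrow> ennreal" where
  "mutual_energy \<alpha> \<mu> \<nu> = (\<integral>\<^sup>+ x. (\<integral>\<^sup>+ y. riesz_kernel \<alpha> x y \<partial>\<nu>) \<partial>\<mu>)"

definition energy :: "real \<Rightarrow> 'a::euclidean_space measure \<Rightarrow> ennreal" where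
  "energy \<alpha> \<mu> = mutual_energy \<alpha> \<mu> \<mu>"

text \<open>Energy norm of the signed measure mu - nu for positive mu, nu of finite energy:
  ||mu - nu||^2 = kappa(mu,mu) + kappa(nu,nu) - 2 kappa(mu,nu).\<close>
definition energy_dist :: "real \<Rightarrow> 'a::euclidean_space measure \<Rightarrow> 'a measure \<Rightarrow> real" where
  "energy_dist \<alpha> \<mu> \<nu> =
     sqrt (enn2real (energy \<alpha> \<mu>) + enn2real (energy \<alpha> \<nu>) - 2 * enn2real (mutual_energy \<alpha> \<mu> \<nu>))"

definition concentrated_on :: "'a::euclidean_space measure \<Rightarrow> 'a set \<Rightarrow> bool" where
  "concentrated_on \<mu> A \<longleftrightarrow> (\<exists>N \<in> null_sets \<mu>. UNIV - A \<subseteq> N)"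

definition inner_cap :: "real \<Rightarrow> 'a::euclidean_space set \<Rightarrow> ennreal" where
  "inner_cap \<alpha> A = inverse (INF \<mu> \<in> {\<mu>. radon_pos \<mu> \<and> energy \<alpha> \<mu> < \<infinity> \<and> concentrated_on \<mu> A
                                           \<and> emeasure \<mu> UNIV = 1}. energy \<alpha> \<mu>)"

definition nearly_everywhere_on :: "real \<Rightarrow> 'a::euclidean_space set \<Rightarrow> ('a \<Rightarrow> bool) \<Rightarrow> bool" where
  "nearly_everywhere_on \<alpha> A P \<longleftrightarrow> (\<exists>N. N \<subseteq> A \<and> inner_cap \<alpha> N = 0 \<and> (\<forall>x \<in> A - N. P x))"

definition is_balayage :: "real \<Rightarrow> 'a::euclidean_space measure \<Rightarrow> 'a set \<Rightarrow> 'a measure \<Rightarrow> bool" where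
  "is_balayage \<alpha> \<mu> A \<nu> \<longleftrightarrow> \<nu> \<in> Mplus \<alpha> \<and>
     (\<forall>x. potential \<alpha> \<nu> x =
        (INF \<eta> \<in> {\<eta> \<in> Mplus \<alpha>. nearly_everywhere_on \<alpha> A (\<lambda>y. potential \<alpha> \<eta> y \<ge> potential \<alpha> \<mu> y)}.
           potential \<alpha> \<eta> x))"

definition vague_conv :: "(nat \<Rightarrow> 'a::euclidean_space measure) \<Rightarrow> 'a measure \<Rightarrow> bool" where
  "vague_conv \<mu>s \<mu> \<longleftrightarrow> (\<forall>f :: 'a \<Rightarrow> real. continuous_on UNIV f \<and> compact (closure {x. f x \<noteq> 0}) \<longrightarrow>
       (\<lambda>k. integral\<^sup>L (\<mu>s k) f) \<longlonglongrightarrow> integral\<^sup>L \<mu> f)"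

definition universally_measurable :: "'a::euclidean_space set \<Rightarrow> bool" where
  "universally_measurable U \<longleftrightarrow> (\<forall>\<mu>. radon_pos \<mu> \<longrightarrow> U \<in> sets (completion \<mu>))"

end

theory Submission
  imports Defs "HOL-Probability.Probability"
begin

text \<open>
  Write \<open>K\<close> for the Riesz kernel and \<open>U \<eta> = K * \<eta>\<close>. Since \<open>\<alpha> \<le> 2\<close>, subordinating the heat kernel
  produces a probability density \<open>\<rho>\<close> with \<open>K * \<rho> \<le> K\<close>, \<open>K * \<rho>\<close> bounded and \<open>K - K * \<rho>\<close> integrable;
  its dilations \<open>\<rho>\<^sub>r\<close> replace the spherical means of classical potential theory, because
  \<open>\<rho>\<^sub>r * U \<eta> \<le> U \<eta>\<close>, with convergence as \<open>r \<rightarrow> 0\<close>.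

  By Choquet's lemma the potential of a balayage is the regularization of a countable infimum of
  potentials. For a measure \<open>\<nu>\<close> of finite energy, the positive definiteness of \<open>K\<close> bounds
  \<open>\<integral>(v - \<rho>\<^sub>r * v) d\<nu>\<close> by the energy norm of \<open>\<nu> - \<rho>\<^sub>r * \<nu>\<close>, uniformly over minima \<open>v\<close> of finitely many
  potentials, so that infimum and regularization agree \<open>\<nu>\<close>-almost everywhere; hence the
  potential of the balayage on \<open>A\<close> dominates \<open>U \<mu>\<close> nearly everywhere on \<open>A\<close>.

  The potentials of the balayages on \<open>A \<inter> U k\<close> increase, and by vague compactness their
  supremum is the potential of a measure. It dominates \<open>U \<mu>\<close> nearly everywhere on \<open>A\<close>, because sets of
  inner capacity zero can be glued along universally measurable sets; so it is not smaller than the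
  potential of the balayage on \<open>A\<close>. Vague convergence follows from the duality
  \<open>\<integral> f * (K - K * \<rho>\<^sub>r) d\<eta> = \<integral> (f - f * \<rho>\<^sub>r) U \<eta>\<close>, in which \<open>K - K * \<rho>\<^sub>r\<close>
  is an approximate identity up to normalization, and strong convergence from monotone convergence
  of the mutual energies.
\<close>

section \<open>Convolution of functions and measures\<close>

text \<open>The heat semigroup pays twice. Writing a heat kernel as the square of the kernel at half
  the time makes the energy a superposition of squares, hence positive; cutting the time integral at
  the passage of level 1 yields the weight \<open>\<rho>\<close>, and the subordinator of index
  \<open>\<alpha>/2\<close> behind this cut exists only for \<open>\<alpha> \<le> 2\<close>. The
  scale \<open>r\<close> works at both ends: as it tends to 0, lower semicontinuous functions are
  recovered; as it tends to infinity, \<open>K * \<rho>\<^sub>r\<close> vanishes uniformly, which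
  supplies the estimates at infinity. The main obstacle is that potentials may be infinite and
  measures may have infinite mass, so differences are undefined. Identities therefore keep every
  term on the side where it is positive, and a term is cancelled only once it is known to be finite.
  A set \<open>A\<close> without any regularity is visible only through finite energy measures
  concentrated on it; this is why infimum and regularization are compared almost everywhere for each
  such measure. Vague compactness is reduced to the selection theorem for laws on the line by means
  of a space-filling curve.\<close>

definition conv :: "('a::euclidean_space \<Rightarrow> ennreal) \<Rightarrow> ('a \<Rightarrow> ennreal) \<Rightarrow> 'a \<Rightarrow> ennreal" where
  "conv f h x = (\<integral>\<^sup>+ y. f (x - y) * h y \<partial>lborel)"

definition conv_measure :: "('a::euclidean_space \<Rightarrow> ennreal) \<Rightarrow> 'a measure \<Rightarrow> 'a \<Rightarrow> ennreal" where
  "conv_measure f \<eta> x = (\<integral>\<^sup>+ y. f (x - y) \<partial>\<eta>)"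

lemma nn_integral_lborel_shift:
  fixes f :: "'a::euclidean_space \<Rightarrow> ennreal"
  assumes [measurable]: "f \<in> borel_measurable borel"
  shows "(\<integral>\<^sup>+ y. f (y + z) \<partial>lborel) = (\<integral>\<^sup>+ y. f y \<partial>lborel)"
proof -
  have "(\<integral>\<^sup>+ y. f y \<partial>lborel) = (\<integral>\<^sup>+ y. f y \<partial>(distr lborel borel ((+) z)))"
    by (simp add: lborel_distr_plus)
  also have "\<dots> = (\<integral>\<^sup>+ y. f (z + y) \<partial>lborel)"
    by (subst nn_integral_distr) auto
  finally show ?thesis by (simp add: add.commute)
qed

lemma nn_integral_lborel_scale:
  fixes f :: "'a::euclidean_space \<Rightarrow> ennreal"
  assumes [measurable]: "f \<in> borel_measurable borel" and c: "c \<noteq> 0"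
  shows "(\<integral>\<^sup>+ y. f y \<partial>lborel) = ennreal (\<bar>c\<bar> ^ DIM('a)) * (\<integral>\<^sup>+ y. f (c *\<^sub>R y) \<partial>lborel)"
proof -
  have "(\<integral>\<^sup>+ y. f y \<partial>lborel) =
    (\<integral>\<^sup>+ y. f y \<partial>(density (distr lborel borel (\<lambda>x. 0 + c *\<^sub>R x)) (\<lambda>_. \<bar>c\<bar>^DIM('a))))"
    using lborel_affine[OF c, of "0::'a"] by simp
  also have "\<dots> = ennreal (\<bar>c\<bar> ^ DIM('a)) * (\<integral>\<^sup>+ y. f (c *\<^sub>R y) \<partial>lborel)"
    by (subst nn_integral_density) (auto simp: nn_integral_cmult nn_integral_distr)
  finally show ?thesis .
qed

lemma nn_integral_lborel_minus:
  fixes f :: "'a::euclidean_space \<Rightarrow> ennreal"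
  assumes [measurable]: "f \<in> borel_measurable borel"
  shows "(\<integral>\<^sup>+ y. f (x - y) \<partial>lborel) = (\<integral>\<^sup>+ y. f y \<partial>lborel)"
proof -
  have "(\<integral>\<^sup>+ y. f y \<partial>lborel) = (\<integral>\<^sup>+ y. f (- y) \<partial>lborel)"
    using nn_integral_lborel_scale[of f "-1"] by simp
  also have "\<dots> = (\<integral>\<^sup>+ y. f (- (y + (- x))) \<partial>lborel)"
    by (rule nn_integral_lborel_shift[symmetric]) simp
  finally show ?thesis by simp
qed

lemma conv_commute:
  assumes [measurable]: "f \<in> borel_measurable borel" "h \<in> borel_measurable borel"
  shows "conv f h = conv h f"
proof
  fix x
  have "conv f h x = (\<integral>\<^sup>+ y. f (x - y) * h (x - (x - y)) \<partial>lborel)"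
    by (simp add: conv_def)
  also have "\<dots> = (\<integral>\<^sup>+ y. f y * h (x - y) \<partial>lborel)"
    by (rule nn_integral_lborel_minus) simp
  finally show "conv f h x = conv h f x" by (simp add: conv_def mult.commute)
qed

lemma conv_eq_conv_measure:
  assumes [measurable]: "f \<in> borel_measurable borel" "h \<in> borel_measurable borel"
  shows "conv f h = conv_measure f (density lborel h)"
  by (auto simp: conv_def conv_measure_def nn_integral_density mult.commute fun_eq_iff)

lemma measurable_conv_measure [measurable]:
  fixes f :: "'a::euclidean_space \<Rightarrow> ennreal"
  assumes [measurable]: "f \<in> borel_measurable borel" and "sigma_finite_measure \<eta>"
    and s[measurable_cong]: "sets \<eta> = sets borel"
  shows "conv_measure f \<eta> \<in> borel_measurable borel"
proof -
  interpret sigma_finite_measure \<eta> by fact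
  have "(\<lambda>x. \<integral>\<^sup>+ y. f (x - y) \<partial>\<eta>) \<in> borel_measurable borel"
    by measurable
  then show ?thesis by (simp add: conv_measure_def[abs_def])
qed

lemma measurable_conv [measurable]:
  fixes f :: "'a::euclidean_space \<Rightarrow> ennreal"
  assumes [measurable]: "f \<in> borel_measurable borel" "h \<in> borel_measurable borel"
  shows "conv f h \<in> borel_measurable borel"
  unfolding conv_def[abs_def] by measurable

lemma conv_conv_measure:
  fixes f :: "'a::euclidean_space \<Rightarrow> ennreal"
  assumes [measurable]: "f \<in> borel_measurable borel" "h \<in> borel_measurable borel"
    and "sigma_finite_measure \<eta>" and s[measurable_cong]: "sets \<eta> = sets borel"
  shows "conv f (conv_measure h \<eta>) = conv_measure (conv f h) \<eta>"
proof
  fix x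
  interpret sigma_finite_measure \<eta> by fact
  interpret P: pair_sigma_finite lborel \<eta> ..
  have "conv f (conv_measure h \<eta>) x = (\<integral>\<^sup>+ y. (\<integral>\<^sup>+ z. f (x - y) * h (y - z) \<partial>\<eta>) \<partial>lborel)"
    by (simp add: conv_def conv_measure_def nn_integral_cmult)
  also have "\<dots> = (\<integral>\<^sup>+ z. (\<integral>\<^sup>+ y. f (x - y) * h (y - z) \<partial>lborel) \<partial>\<eta>)"
    by (rule P.Fubini'[symmetric]) measurable
  also have "\<dots> = (\<integral>\<^sup>+ z. (\<integral>\<^sup>+ y. f (x - (y + z)) * h ((y + z) - z) \<partial>lborel) \<partial>\<eta>)"
    by (intro nn_integral_cong nn_integral_lborel_shift[symmetric]) simp
  also have "\<dots> = conv_measure (conv f h) \<eta> x"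
    by (simp add: conv_def conv_measure_def algebra_simps)
  finally show "conv f (conv_measure h \<eta>) x = conv_measure (conv f h) \<eta> x" .
qed

lemma conv_assoc:
  assumes [measurable]: "f \<in> borel_measurable borel" "h \<in> borel_measurable borel" "k \<in> borel_measurable borel"
  shows "conv f (conv h k) = conv (conv f h) k"
proof
  fix x
  have "conv f (conv h k) x = (\<integral>\<^sup>+ y. (\<integral>\<^sup>+ z. f (x - y) * (h (y - z) * k z) \<partial>lborel) \<partial>lborel)"
    by (simp add: conv_def nn_integral_cmult)
  also have "\<dots> = (\<integral>\<^sup>+ z. (\<integral>\<^sup>+ y. f (x - y) * (h (y - z) * k z) \<partial>lborel) \<partial>lborel)"
    by (rule lborel_pair.Fubini'[symmetric]) measurable
  also have "\<dots> = (\<integral>\<^sup>+ z. (\<integral>\<^sup>+ y. f (x - (y + z)) * (h ((y + z) - z) * k z) \<partial>lborel) \<partial>lborel)"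
    by (intro nn_integral_cong nn_integral_lborel_shift[symmetric]) simp
  also have "\<dots> = conv (conv f h) k x"
    by (simp add: conv_def algebra_simps nn_integral_cmult[symmetric])
  finally show "conv f (conv h k) x = conv (conv f h) k x" .
qed

lemma nn_integral_conv:
  fixes f :: "'a::euclidean_space \<Rightarrow> ennreal"
  assumes [measurable]: "f \<in> borel_measurable borel" "h \<in> borel_measurable borel"
  shows "(\<integral>\<^sup>+ x. conv f h x \<partial>lborel) = (\<integral>\<^sup>+ x. f x \<partial>lborel) * (\<integral>\<^sup>+ x. h x \<partial>lborel)"
proof -
  have "(\<integral>\<^sup>+ x. conv f h x \<partial>lborel) = (\<integral>\<^sup>+ y. (\<integral>\<^sup>+ x. f (x - y) * h y \<partial>lborel) \<partial>lborel)"
    unfolding conv_def by (rule lborel_pair.Fubini'[symmetric]) measurable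
  also have "\<dots> = (\<integral>\<^sup>+ y. (\<integral>\<^sup>+ x. f x \<partial>lborel) * h y \<partial>lborel)"
    using nn_integral_lborel_shift[of f "- y" for y] by (simp add: nn_integral_multc)
  finally show ?thesis by (simp add: nn_integral_cmult)
qed

lemma nn_integral_conv_measure_commute:
  fixes f :: "'a::euclidean_space \<Rightarrow> ennreal"
  assumes [measurable]: "f \<in> borel_measurable borel" and even: "\<And>x. f (- x) = f x"
    and "sigma_finite_measure \<eta>" and s1[measurable_cong]: "sets \<eta> = sets borel"
    and "sigma_finite_measure \<nu>" and s2[measurable_cong]: "sets \<nu> = sets borel"
  shows "(\<integral>\<^sup>+ x. conv_measure f \<eta> x \<partial>\<nu>) = (\<integral>\<^sup>+ x. conv_measure f \<nu> x \<partial>\<eta>)"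
proof -
  interpret E: sigma_finite_measure \<eta> by fact
  interpret N: sigma_finite_measure \<nu> by fact
  interpret P: pair_sigma_finite \<nu> \<eta> ..
  have e: "f (x - y) = f (y - x)" for x y using even[of "x - y"] by simp
  show ?thesis unfolding conv_measure_def
    by (subst P.Fubini'[symmetric]) (auto simp: e cong: nn_integral_cong)
qed

text \<open>Convolution with an even function is self-adjoint, so smoothing can be moved from the
  integrand to the measure. This is how the swept measure \<open>\<rho>\<^sub>r * \<nu>\<close>
  enters the energy estimate.\<close>

lemma nn_integral_conv_dual:
  fixes f :: "'a::euclidean_space \<Rightarrow> ennreal"
  assumes [measurable]: "f \<in> borel_measurable borel" "v \<in> borel_measurable borel" and even: "\<And>x. f (- x) = f x"
    and "sigma_finite_measure \<nu>" and s2[measurable_cong]: "sets \<nu> = sets borel"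
  shows "(\<integral>\<^sup>+ x. conv f v x \<partial>\<nu>) = (\<integral>\<^sup>+ x. conv_measure f \<nu> x * v x \<partial>lborel)"
proof -
  interpret N: sigma_finite_measure \<nu> by fact
  interpret P: pair_sigma_finite \<nu> lborel ..
  have e: "f (x - y) = f (y - x)" for x y using even[of "x - y"] by simp
  have "(\<integral>\<^sup>+ x. conv f v x \<partial>\<nu>) = (\<integral>\<^sup>+ y. (\<integral>\<^sup>+ x. f (x - y) * v y \<partial>\<nu>) \<partial>lborel)"
    unfolding conv_def by (subst P.Fubini'[symmetric]) auto
  also have "\<dots> = (\<integral>\<^sup>+ x. conv_measure f \<nu> x * v x \<partial>lborel)"
    by (intro nn_integral_cong) (simp add: nn_integral_multc conv_measure_def, subst e, simp)
  finally show ?thesis .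
qed

lemma conv_add_left:
  assumes [measurable]: "f \<in> borel_measurable borel" "f' \<in> borel_measurable borel" "h \<in> borel_measurable borel"
  shows "conv (\<lambda>x. f x + f' x) h x = conv f h x + conv f' h x"
  by (simp add: conv_def distrib_right nn_integral_add)

lemma conv_add_right:
  assumes [measurable]: "f \<in> borel_measurable borel" "h \<in> borel_measurable borel" "h' \<in> borel_measurable borel"
  shows "conv f (\<lambda>x. h x + h' x) x = conv f h x + conv f h' x"
  by (simp add: conv_def distrib_left nn_integral_add)

lemma conv_cmult_right:
  assumes [measurable]: "f \<in> borel_measurable borel" "h \<in> borel_measurable borel"
  shows "conv f (\<lambda>x. c * h x) x = c * conv f h x"
  by (simp add: conv_def mult.left_commute nn_integral_cmult)

lemma conv_cmult_left:
  assumes [measurable]: "f \<in> borel_measurable borel" "h \<in> borel_measurable borel"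
  shows "conv (\<lambda>x. c * f x) h x = c * conv f h x"
  by (simp add: conv_def mult.assoc nn_integral_cmult)

lemma conv_left_commute:
  assumes [measurable]: "f \<in> borel_measurable borel" "h \<in> borel_measurable borel" "k \<in> borel_measurable borel"
  shows "conv f (conv h k) = conv h (conv f k)"
  by (simp add: conv_assoc conv_commute[of f h])

lemma conv_mono: "(\<And>x. f x \<le> f' x) \<Longrightarrow> (\<And>x. h x \<le> h' x) \<Longrightarrow> conv f h x \<le> conv f' h' x"
  unfolding conv_def by (intro nn_integral_mono mult_mono) auto

lemma conv_le_const:
  fixes f :: "'a::euclidean_space \<Rightarrow> ennreal"
  assumes [measurable]: "f \<in> borel_measurable borel" and "\<And>x. h x \<le> M"
  shows "conv f h x \<le> (\<integral>\<^sup>+ y. f y \<partial>lborel) * M"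
proof -
  have "conv f h x \<le> (\<integral>\<^sup>+ y. f (x - y) * M \<partial>lborel)"
    unfolding conv_def using assms by (intro nn_integral_mono mult_left_mono) auto
  also have "\<dots> = (\<integral>\<^sup>+ y. f y \<partial>lborel) * M"
    by (simp add: nn_integral_multc nn_integral_lborel_minus)
  finally show ?thesis .
qed

section \<open>The heat kernel and subordination\<close>

text \<open>Equals (4 pi)^(n/2); it stays an integral because normalizing \<open>heat\<close> uses
  only that it is finite and positive.\<close>

definition gauss_mass :: "'a::euclidean_space itself \<Rightarrow> real" where
  "gauss_mass _ = enn2real (\<integral>\<^sup>+ x. ennreal (exp (- (norm (x::'a))\<^sup>2 / 4)) \<partial>lborel)"

text \<open>The value zero for \<open>t \<le> 0\<close> lets time integrals range over the whole
  line.\<close>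

definition heat :: "real \<Rightarrow> 'a::euclidean_space \<Rightarrow> real" where
  "heat t x = (if t \<le> 0 then 0 else
     t powr (- (real DIM('a) / 2)) * exp (- (norm x)\<^sup>2 / (4 * t)) / gauss_mass TYPE('a))"

text \<open>The integrand factors over the coordinates, and each factor is a multiple of the normal
  density with variance \<open>1 / (2 * c)\<close>.\<close>

lemma nn_integral_gauss_finite:
  assumes c: "c > 0"
  shows "(\<integral>\<^sup>+ x. ennreal (exp (- c * (norm (x::'a::euclidean_space))\<^sup>2)) \<partial>lborel) < \<infinity>"
proof -
  define \<sigma> where "\<sigma> = sqrt (1 / (2 * c))"
  have \<sigma>: "\<sigma> > 0" "\<sigma>\<^sup>2 = 1 / (2 * c)" using c by (auto simp: \<sigma>_def)
  interpret prob_space "density lborel (normal_density 0 \<sigma>)"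
    using \<sigma> by (intro prob_space_normal_density)
  have n: "(\<integral>\<^sup>+ x. ennreal (normal_density 0 \<sigma> x) \<partial>lborel) = 1"
    using emeasure_space_1 by (simp add: emeasure_density)
  have "exp (- c * x\<^sup>2) = sqrt (2 * pi * \<sigma>\<^sup>2) * normal_density 0 \<sigma> x" for x
    using \<sigma> c by (simp add: normal_density_def)
  then have one: "(\<integral>\<^sup>+ x. ennreal (exp (- c * (x::real)\<^sup>2)) \<partial>lborel) = ennreal (sqrt (2 * pi * \<sigma>\<^sup>2))"
    by (simp add: ennreal_mult nn_integral_cmult n)
  have "(\<integral>\<^sup>+ x. ennreal (exp (- c * (norm (x::'a))\<^sup>2)) \<partial>lborel)
      = (\<integral>\<^sup>+ x. (\<Prod>b\<in>Basis. ennreal (exp (- c * ((x::'a) \<bullet> b)\<^sup>2))) \<partial>lborel)"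
    by (intro nn_integral_cong)
       (simp add: prod_ennreal exp_sum[symmetric] power2_norm_eq_inner sum_negf sum_distrib_left
          euclidean_inner[of x x for x::'a], simp add: power2_eq_square)
  also have "\<dots> = (\<Prod>b\<in>(Basis::'a set). (\<integral>\<^sup>+ x. ennreal (exp (- c * x\<^sup>2)) \<partial>lborel))"
    by (rule nn_integral_lborel_prod) auto
  also have "\<dots> < \<infinity>" unfolding one by (simp add: power_less_top_ennreal)
  finally show ?thesis .
qed

lemma nn_integral_gauss_mass:
  "(\<integral>\<^sup>+ x. ennreal (exp (- (norm (x::'a::euclidean_space))\<^sup>2 / 4)) \<partial>lborel) = ennreal (gauss_mass TYPE('a))"
  using nn_integral_gauss_finite[of "1/4", where 'a='a] by (simp add: gauss_mass_def less_top[symmetric])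

lemma gauss_mass_pos: "gauss_mass TYPE('a::euclidean_space) > 0"
proof -
  have "(\<integral>\<^sup>+ x. ennreal (exp (- (norm (x::'a))\<^sup>2 / 4)) \<partial>lborel) \<noteq> 0"
  proof
    assume "(\<integral>\<^sup>+ x. ennreal (exp (- (norm (x::'a))\<^sup>2 / 4)) \<partial>lborel) = 0"
    then have "AE x::'a in lborel. False" by (subst (asm) nn_integral_0_iff_AE) auto
    then have "emeasure lborel (UNIV::'a set) = 0" by (subst (asm) AE_iff_measurable[where N=UNIV]) auto
    then show False by simp
  qed
  then show ?thesis unfolding nn_integral_gauss_mass by (metis ennreal_eq_0_iff not_le)
qed

lemma heat_nonneg [simp]: "heat t x \<ge> 0"
  using gauss_mass_pos[where 'a='a] by (simp add: heat_def)

lemma heat_even: "heat t (- x) = heat t x" by (simp add: heat_def)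

lemma measurable_heat [measurable (raw)]:
  assumes [measurable]: "f \<in> borel_measurable M" "g \<in> borel_measurable M"
  shows "(\<lambda>w. heat (f w) (g w :: 'a::euclidean_space)) \<in> borel_measurable M"
  unfolding heat_def by measurable

lemma nn_integral_heat_scale:
  fixes f :: "'a::euclidean_space \<Rightarrow> ennreal"
  assumes [measurable]: "f \<in> borel_measurable borel" and t: "t > 0"
  shows "(\<integral>\<^sup>+ y. f y * ennreal (heat t y) \<partial>lborel) = (\<integral>\<^sup>+ y. f (sqrt t *\<^sub>R y) * ennreal (heat 1 y) \<partial>lborel)"
proof -
  have "t powr - (real DIM('a) / 2) * (sqrt t) ^ DIM('a) = 1"
    using t by (simp add: powr_minus powr_half_sqrt[symmetric] powr_realpow[symmetric] powr_powr)
  then have h: "(sqrt t) ^ DIM('a) * heat t (sqrt t *\<^sub>R y) = heat 1 y" for y :: 'a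
    using t by (simp add: heat_def power_mult_distrib field_simps)
  have "(\<integral>\<^sup>+ y. f y * ennreal (heat t y) \<partial>lborel) =
      ennreal (\<bar>sqrt t\<bar> ^ DIM('a)) * (\<integral>\<^sup>+ y. f (sqrt t *\<^sub>R y) * ennreal (heat t (sqrt t *\<^sub>R y)) \<partial>lborel)"
    using t by (intro nn_integral_lborel_scale) auto
  also have "\<dots> = (\<integral>\<^sup>+ y. f (sqrt t *\<^sub>R y) * ennreal (heat 1 y) \<partial>lborel)"
    using t by (simp add: nn_integral_cmult[symmetric] h[symmetric] ennreal_mult mult_ac)
  finally show ?thesis .
qed

lemma nn_integral_heat:
  assumes "t > 0"
  shows "(\<integral>\<^sup>+ y. ennreal (heat t (y::'a::euclidean_space)) \<partial>lborel) = 1"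
proof -
  have "(\<integral>\<^sup>+ y. ennreal (heat t (y::'a)) \<partial>lborel) = (\<integral>\<^sup>+ y. ennreal (heat 1 (y::'a)) \<partial>lborel)"
    using nn_integral_heat_scale[of "\<lambda>_::'a. 1" t] assms by simp
  also have "\<dots> = (\<integral>\<^sup>+ y. ennreal (exp (- (norm (y::'a))\<^sup>2 / 4)) / ennreal (gauss_mass TYPE('a)) \<partial>lborel)"
    by (intro nn_integral_cong) (simp add: heat_def divide_ennreal gauss_mass_pos)
  also have "\<dots> = 1"
    using gauss_mass_pos[where 'a='a]
    by (subst nn_integral_divide) (auto simp: nn_integral_gauss_mass[simplified] divide_ennreal nn_integral_gauss_mass)
  finally show ?thesis .
qed

text \<open>Completing the square in \<open>y\<close>: the product is again Gaussian in
  \<open>y\<close>, the Brownian bridge from 0 to \<open>x\<close> at time \<open>t\<close> out of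
  \<open>s + t\<close>. Integrating \<open>y\<close> out leaves the semigroup law.\<close>

lemma heat_mult_shift:
  fixes x y :: "'a::euclidean_space"
  assumes s: "s > 0" and t: "t > 0"
  shows "heat s (x - y) * heat t y = heat (s + t) x * heat (s * t / (s + t)) (y + - ((t / (s + t)) *\<^sub>R x))"
proof -
  have e: "(norm (x - y))\<^sup>2 / (4 * s) + (norm y)\<^sup>2 / (4 * t) =
     (norm x)\<^sup>2 / (4 * (s + t)) + (norm (y + - ((t / (s + t)) *\<^sub>R x)))\<^sup>2 / (4 * (s * t / (s + t)))"
  proof -
    define X Y Z where "X = x \<bullet> x" "Y = y \<bullet> y" "Z = x \<bullet> y"
    have 1: "(norm (x - y))\<^sup>2 = X - 2 * Z + Y" "(norm x)\<^sup>2 = X" "(norm y)\<^sup>2 = Y"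
      by (simp_all add: X_Y_Z_def power2_norm_eq_inner inner_diff inner_commute)
    have 2: "(norm (y + - ((t / (s + t)) *\<^sub>R x)))\<^sup>2 = Y - 2 * (t / (s + t)) * Z + (t / (s + t))\<^sup>2 * X"
      by (simp only: X_Y_Z_def power2_norm_eq_inner) (simp add: inner_add inner_diff inner_commute power2_eq_square algebra_simps)
    show ?thesis unfolding 1 2 using s t
      by (simp add: divide_simps) (simp add: power2_eq_square algebra_simps)
  qed
  have "exp (- (norm (x - y))\<^sup>2 / (4 * s)) * exp (- (norm y)\<^sup>2 / (4 * t)) =
     exp (- (norm x)\<^sup>2 / (4 * (s + t))) * exp (- (norm (y + - ((t / (s + t)) *\<^sub>R x)))\<^sup>2 / (4 * (s * t / (s + t))))"
    using e by (simp add: exp_add[symmetric])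
  moreover have "s powr p * t powr p = (s + t) powr p * (s * t / (s + t)) powr p" for p
    using s t by (simp add: powr_mult[symmetric])
  moreover have "s + t > 0" "s * t / (s + t) > 0" using s t by auto
  moreover have "(a * e) / J * (b * f / J) = (a * b) * (e * f) / (J * J)" for a b e f J :: real by simp
  ultimately show ?thesis using s t by (simp only: heat_def not_le[symmetric] if_False)
qed

lemma heat_conv:
  fixes x :: "'a::euclidean_space"
  assumes s: "s > 0" and t: "t > 0"
  shows "conv (\<lambda>x. ennreal (heat s x)) (\<lambda>x. ennreal (heat t x)) x = ennreal (heat (s + t) x)"
proof -
  have p: "s * t / (s + t) > 0" using s t by auto
  have "conv (\<lambda>x. ennreal (heat s x)) (\<lambda>x. ennreal (heat t x)) x =
     (\<integral>\<^sup>+ y. ennreal (heat (s + t) x) * ennreal (heat (s * t / (s + t)) (y + - ((t / (s + t)) *\<^sub>R x))) \<partial>lborel)"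
    unfolding conv_def by (simp only: ennreal_mult[symmetric] heat_nonneg heat_mult_shift[OF s t])
  also have "\<dots> = ennreal (heat (s + t) x) * (\<integral>\<^sup>+ y. ennreal (heat (s * t / (s + t)) (y::'a)) \<partial>lborel)"
    by (subst nn_integral_cmult, simp, subst nn_integral_lborel_shift, simp_all)
  finally show ?thesis by (simp add: nn_integral_heat[OF p])
qed

section \<open>Riesz kernels as time integrals of the heat kernel\<close>

definition time_kernel :: "real \<Rightarrow> 'a::euclidean_space \<Rightarrow> ennreal" where
  "time_kernel b x = (\<integral>\<^sup>+ t. ennreal (t powr (b - 1)) * ennreal (heat t x) \<partial>lborel)"

lemma power_div_fact_le_exp:
  fixes z :: real assumes "z \<ge> 0" shows "z ^ k / fact k \<le> exp z"
proof -
  have "(\<Sum>n\<in>{k}. z ^ n /\<^sub>R fact n) \<le> (\<Sum>n. z ^ n /\<^sub>R fact n)"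
    using assms summable_exp_generic[of z] by (intro sum_le_suminf) auto
  then show ?thesis by (simp add: exp_def divide_inverse mult.commute)
qed

text \<open>Near 0 one term of the exponential series, of order \<open>k \<ge> e\<close>, already
  beats the power; near infinity the power alone is integrable because \<open>e > 1\<close>.\<close>

lemma nn_integral_powr_exp_finite:
  fixes e :: real assumes e: "e > 1"
  shows "(\<integral>\<^sup>+ s. ennreal (s powr (- e) * exp (- 1 / (4 * s))) * indicator {0<..} s \<partial>lborel) < \<infinity>"
proof -
  define k where "k = nat \<lceil>e\<rceil>"
  have k: "e \<le> real k" by (simp add: k_def) linarith
  define M :: real where "M = fact k * 4 ^ k"
  have b: "s powr (- e) * exp (- 1 / (4 * s)) \<le> M" if s: "0 < s" "s \<le> 1" for s
  proof -
    have "(1 / (4 * s)) ^ k / fact k \<le> exp (1 / (4 * s))"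
      using s by (intro power_div_fact_le_exp) auto
    then have "exp (- 1 / (4 * s)) \<le> fact k * (4 * s) ^ k"
      using s by (simp add: exp_minus field_simps power_mult_distrib)
    then have "s powr (- e) * exp (- 1 / (4 * s)) \<le> s powr (- e) * (fact k * (4 * s) ^ k)"
      by (intro mult_left_mono) auto
    also have "\<dots> = M * s powr (real k - e)"
      using s by (simp add: M_def power_mult_distrib powr_realpow[symmetric] powr_add[symmetric])
    also have "\<dots> \<le> M * 1" using s k
      by (intro mult_left_mono powr_le1) (auto simp: M_def)
    finally show ?thesis by simp
  qed
  have "(\<integral>\<^sup>+ s. ennreal (s powr (- e) * exp (- 1 / (4 * s))) * indicator {0<..} s \<partial>lborel)
    \<le> (\<integral>\<^sup>+ s. ennreal M * indicator {0..1} s + ennreal (s powr (- e)) * indicator {1..} s \<partial>lborel)"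
  proof (rule nn_integral_mono)
    fix s :: real
    consider "s \<le> 0" | "0 < s" "s \<le> 1" | "1 < s" by linarith
    then show "ennreal (s powr (- e) * exp (- 1 / (4 * s))) * indicator {0<..} s
      \<le> ennreal M * indicator {0..1} s + ennreal (s powr (- e)) * indicator {1..} s"
    proof cases
      case 2 then show ?thesis using b[of s] by (auto intro: add_increasing2 ennreal_leI)
    next
      case 3
      then have "s powr (- e) * exp (- 1 / (4 * s)) \<le> s powr (- e) * 1" by (intro mult_left_mono) auto
      then show ?thesis using 3 by (auto intro!: ennreal_leI)
    qed auto
  qed
  also have "\<dots> = ennreal M + ennreal (- (1 powr (- e + 1)) / (- e + 1))"
    using e nn_integral_has_integral_lebesgue'[OF _ has_integral_powr_to_inf[of "- e" 1]]
    by (subst nn_integral_add) (auto simp: nn_integral_cmult)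
  also have "\<dots> < \<infinity>" by simp
  finally show ?thesis .
qed

text \<open>The substitution of \<open>2 * s\<close> for \<open>s\<close> reproduces the integral
  with the factor \<open>2 powr (1 - e) < 1\<close>. A finite value would have to be 0, which a
  positive integrand excludes; the divergence at 0 needs no separate estimate.\<close>

lemma nn_integral_powr_infinite:
  fixes e :: real assumes e: "e > 1"
  shows "(\<integral>\<^sup>+ s. ennreal (s powr (- e)) * indicator {0<..} s \<partial>lborel) = \<infinity>" (is "?I = _")
proof (rule ccontr)
  assume fin: "?I \<noteq> \<infinity>"
  have "?I = ennreal \<bar>2\<bar> * (\<integral>\<^sup>+ s. ennreal ((0 + 2 * s) powr (- e)) * indicator {0<..} (0 + 2 * s) \<partial>lborel)"
    by (rule nn_integral_real_affine) auto
  also have "(\<integral>\<^sup>+ s. ennreal ((0 + 2 * s) powr (- e)) * indicator {0<..} (0 + 2 * s) \<partial>lborel)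
     = (\<integral>\<^sup>+ s. ennreal (2 powr (- e)) * (ennreal (s powr (- e)) * indicator {0<..} s) \<partial>lborel)"
    by (intro nn_integral_cong) (auto simp: powr_mult ennreal_mult split: split_indicator)
  also have "ennreal \<bar>2\<bar> * \<dots> = ennreal (2 powr (1 - e)) * ?I"
    by (subst nn_integral_cmult)
      (auto simp: mult.assoc[symmetric] ennreal_mult[symmetric] powr_diff powr_minus field_simps
       simp del: ennreal_numeral)
  finally have eq: "?I = ennreal (2 powr (1 - e)) * ?I" .
  have lt: "2 powr (1 - e) < 1" using e by (simp add: powr_less_one)
  obtain i where i: "?I = ennreal i" "i \<ge> 0" using fin by (cases ?I) auto
  with eq have "i = 2 powr (1 - e) * i" by (simp add: ennreal_mult[symmetric])
  with lt have "i = 0" by (metis less_irrefl mult_cancel_right2)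
  with i have "?I = 0" by simp
  then have "AE s in lborel. ennreal (s powr (- e)) * indicator {0<..} s = 0"
    by (subst (asm) nn_integral_0_iff_AE) auto
  then have "AE s::real in lborel. s \<notin> {0<..<1}" by eventually_elim (auto split: split_indicator_asm)
  then have "emeasure lborel {0<..<1::real} = 0"
    by (subst (asm) AE_iff_measurable[where N="{0<..<1::real}"]) auto
  then show False by simp
qed

text \<open>The substitution \<open>t = (norm x)\<^sup>2 * s\<close> extracts the power of the norm
  and leaves the constant integral \<open>Q\<close>. The exponent \<open>e\<close> collects
  \<open>t powr (b - 1)\<close> and the heat factor \<open>t powr (- n / 2)\<close>; since
  \<open>e > 1\<close>, the integral diverges at the origin.\<close>

lemma time_kernel_eq:
  assumes b: "0 < b" "b < real DIM('a) / 2"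
  obtains A where "A > 0" "\<And>x::'a::euclidean_space. time_kernel b x =
     (if x = 0 then \<infinity> else ennreal (A * norm x powr (2 * b - real DIM('a))))"
proof -
  define n where "n = real DIM('a)"
  define J where "J = gauss_mass TYPE('a)"
  have J: "J > 0" by (simp add: J_def gauss_mass_pos)
  define e where "e = 1 + n / 2 - b"
  have e: "e > 1" using b by (simp add: e_def n_def)
  define q where "q = (\<lambda>s. ennreal (s powr (- e) * exp (- 1 / (4 * s))) * indicator {0<..} s)"
  have qm[measurable]: "q \<in> borel_measurable borel" by (simp add: q_def)
  define Q where "Q = enn2real (integral\<^sup>N lborel q)"
  have Q: "integral\<^sup>N lborel q = ennreal Q"
    using nn_integral_powr_exp_finite[OF e] by (simp add: Q_def q_def less_top[symmetric])
  have "integral\<^sup>N lborel q \<noteq> 0"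
  proof
    assume "integral\<^sup>N lborel q = 0"
    then have "AE s in lborel. q s = 0"
      by (subst (asm) nn_integral_0_iff_AE) auto
    then have "AE s::real in lborel. s \<notin> {0<..<1}" by eventually_elim (auto simp: q_def split: split_indicator_asm)
    then have "emeasure lborel {0<..<1::real} = 0"
      by (subst (asm) AE_iff_measurable[where N="{0<..<1::real}"]) auto
    then show False by simp
  qed
  then have Qp: "Q > 0" unfolding Q by (metis ennreal_eq_0_iff not_le)
  have "time_kernel b x = (if x = 0 then \<infinity> else ennreal (Q / J * norm x powr (2 * b - n)))" for x :: 'a
  proof (cases "x = 0")
    case True
    have "time_kernel b x = (\<integral>\<^sup>+ t. ennreal (1 / J) * (ennreal (t powr (- e)) * indicator {0<..} t) \<partial>lborel)"
      unfolding time_kernel_def True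
      by (intro nn_integral_cong)
        (auto simp: heat_def e_def n_def J_def ennreal_mult[symmetric] powr_add[symmetric] gauss_mass_pos less_imp_le
          algebra_simps split: split_indicator intro!: arg_cong[where f=ennreal])
    also have "\<dots> = \<infinity>" using J by (subst nn_integral_cmult) (auto simp: nn_integral_powr_infinite[OF e] ennreal_mult_top)
    finally show ?thesis using True by simp
  next
    case False
    define z where "z = norm x"
    have z: "z > 0" using False by (simp add: z_def)
    have "time_kernel b x = ennreal \<bar>z\<^sup>2\<bar> * (\<integral>\<^sup>+ s. ennreal ((0 + z\<^sup>2 * s) powr (b - 1)) * ennreal (heat (0 + z\<^sup>2 * s) x) \<partial>lborel)"
      unfolding time_kernel_def using z by (intro nn_integral_real_affine) auto
    also have "(\<integral>\<^sup>+ s. ennreal ((0 + z\<^sup>2 * s) powr (b - 1)) * ennreal (heat (0 + z\<^sup>2 * s) x) \<partial>lborel)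
       = (\<integral>\<^sup>+ s. ennreal (z powr (- 2 * e) / J) * q s \<partial>lborel)"
    proof (intro nn_integral_cong)
      fix s :: real
      show "ennreal ((0 + z\<^sup>2 * s) powr (b - 1)) * ennreal (heat (0 + z\<^sup>2 * s) x) = ennreal (z powr (- 2 * e) / J) * q s"
      proof (cases "s > 0")
        case True
        have "(z\<^sup>2 * s) powr (b - 1) * (z\<^sup>2 * s) powr (- (n / 2)) = (z\<^sup>2 * s) powr (- e)"
          by (simp add: powr_add[symmetric] e_def algebra_simps)
        also have "\<dots> = z powr (- 2 * e) * s powr (- e)"
        proof -
          have "z\<^sup>2 = z powr 2" using z by simp
          then show ?thesis using z True by (simp only: powr_mult powr_powr) simp
        qed
        finally have p: "(z\<^sup>2 * s) powr (b - 1) * (z\<^sup>2 * s) powr (- (n / 2)) = z powr (- 2 * e) * s powr (- e)" .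
        have h: "heat (z\<^sup>2 * s) x = (z\<^sup>2 * s) powr (- (n / 2)) * exp (- 1 / (4 * s)) / J"
        proof -
          have "\<not> z\<^sup>2 * s \<le> 0" using True z by (simp add: not_le)
          then show ?thesis using z by (simp add: heat_def z_def[symmetric] n_def J_def)
        qed
        have "(z\<^sup>2 * s) powr (b - 1) * heat (z\<^sup>2 * s) x = z powr (- 2 * e) / J * (s powr (- e) * exp (- 1 / (4 * s)))"
        proof -
          have "u * (v * w / J) = (u * v) * w / J" for u v w by simp
          then show ?thesis unfolding h by (simp only: p) simp
        qed
        then show ?thesis using True J by (simp add: q_def ennreal_mult[symmetric])
      next
        case False
        then have "z\<^sup>2 * s \<le> 0" by (simp add: mult_nonneg_nonpos)
        then show ?thesis using False by (simp add: heat_def q_def)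
      qed
    qed
    also have "ennreal \<bar>z\<^sup>2\<bar> * \<dots> = ennreal (z\<^sup>2 * (z powr (- 2 * e) / J) * Q)"
      using J Qp by (subst nn_integral_cmult) (auto simp: Q ennreal_mult[symmetric] mult.assoc)
    also have "z\<^sup>2 * (z powr (- 2 * e) / J) * Q = Q / J * (z powr 2 * z powr (- 2 * e))"
      using z by simp
    also have "z powr 2 * z powr (- 2 * e) = z powr (2 * b - n)"
      unfolding powr_add[symmetric] by (simp add: e_def algebra_simps)
    finally show ?thesis using False by (simp add: z_def)
  qed
  then show ?thesis using that[of "Q / J"] Qp J by (simp add: n_def)
qed

section \<open>The sweeping weight\<close>

text \<open>\<open>M\<close> is the law of \<open>1 / T\<close>, where \<open>T\<close> is the
  position of the \<open>b\<close>-stable subordinator just after it passes level 1. Up to a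
  constant, \<open>t powr (b - 1)\<close> is its renewal density, so the identity is the strong
  Markov property: beyond level 1 the renewal density is that of the process restarted at
  \<open>T\<close>.\<close>

lemma passage_measure_exists:
  fixes b :: real assumes b: "0 < b" "b \<le> 1"
  obtains M :: "real measure" where "prob_space M" "sets M = sets borel" "AE y in M. 0 < y \<and> y \<le> 1"
    "\<And>t. t > 0 \<Longrightarrow> (\<integral>\<^sup>+ y. ennreal ((t - 1 / y) powr (b - 1)) * indicator {y. 1 < t * y} y \<partial>M)
        = ennreal (t powr (b - 1)) * indicator {1<..} t"
proof (cases "b = 1")
  case True
  show ?thesis
  \<comment> \<open>For \<open>b = 1\<close> the subordinator is pure drift and hits level 1
    exactly.\<close>
  proof (rule that[of "return borel 1"])
    show "prob_space (return borel (1::real))" by (intro prob_space_return) auto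
    show "sets (return borel (1::real)) = sets borel" by simp
    show "AE y in return borel (1::real). 0 < y \<and> y \<le> 1" by (subst AE_return) auto
    fix t :: real assume t: "t > 0"
    show "(\<integral>\<^sup>+ y. ennreal ((t - 1 / y) powr (b - 1)) * indicator {y. 1 < t * y} y \<partial>return borel 1)
        = ennreal (t powr (b - 1)) * indicator {1<..} t"
      by (subst nn_integral_return) (auto simp: True split: split_indicator)
  qed
next
  case False
  with b have b1: "b < 1" by simp
  define B where "B = Beta b (1 - b)"
  have B: "B > 0" unfolding B_def Beta_def using b b1 by (intro divide_pos_pos mult_pos_pos Gamma_real_pos) auto
  \<comment> \<open>The generalized arcsine law: the reciprocal of the passage position is Beta
    distributed with parameters \<open>b\<close> and \<open>1 - b\<close>.\<close>
  define h where "h = (\<lambda>y::real. ennreal (y powr (b - 1) * (1 - y) powr (- b)) * indicator {0<..<1} y)"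
  have hm[measurable]: "h \<in> borel_measurable borel" by (simp add: h_def)
  have H: "(\<integral>\<^sup>+ y. h y \<partial>lborel) = ennreal B"
  proof -
    have "(\<integral>\<^sup>+ y. h y \<partial>lborel) = (\<integral>\<^sup>+ y. ennreal (y powr (b - 1) * (1 - y) powr (1 - b - 1)) * indicator {0..1} y \<partial>lborel)"
      by (intro nn_integral_cong) (auto simp: h_def split: split_indicator)
    also have "\<dots> = ennreal B" unfolding B_def
      using b b1 has_integral_Beta_real[of b "1 - b"] by (intro nn_integral_has_integral_lebesgue') auto
    finally show ?thesis .
  qed
  define M where "M = density lborel (\<lambda>y. h y / ennreal B)"
  show ?thesis
  proof (rule that[of M])
    show "prob_space M" unfolding M_def
      by (rule prob_spaceI) (use B in \<open>simp add: emeasure_density nn_integral_divide H divide_ennreal\<close>)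
    show "sets M = sets borel" by (simp add: M_def)
    show "AE y in M. 0 < y \<and> y \<le> 1"
      unfolding M_def by (subst AE_density) (auto simp: h_def split: split_indicator)
    fix t :: real assume t: "t > 0"
    show "(\<integral>\<^sup>+ y. ennreal ((t - 1 / y) powr (b - 1)) * indicator {y. 1 < t * y} y \<partial>M)
        = ennreal (t powr (b - 1)) * indicator {1<..} t"
    proof (cases "t > 1")
      case False
      have "h y * (ennreal ((t - 1 / y) powr (b - 1)) * indicator {y. 1 < t * y} y) = 0" for y
      proof (cases "0 < y \<and> y < 1")
        case True
        then have "t * y \<le> 1 * 1" using False by (intro mult_mono) auto
        then show ?thesis by simp
      qed (auto simp: h_def)
      then have z: "h y / ennreal B * (ennreal ((t - 1 / y) powr (b - 1)) * indicator {y. 1 < t * y} y) = 0" for y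
        by (metis ennreal_zero_divide mult_eq_0_iff)
      show ?thesis using False
        by (simp add: M_def nn_integral_density z)
    next
      case True
      \<comment> \<open>Length of the interval from \<open>1 / t\<close> to 1 to which the indicator
        restricts \<open>y\<close>. Mapping it affinely to the unit interval restores the Beta
        integral, and the powers of \<open>u\<close> cancel against the Jacobian.\<close>
      define u where "u = 1 - 1 / t"
      have u: "u > 0" using True by (simp add: u_def)
      have "(\<integral>\<^sup>+ y. ennreal ((t - 1 / y) powr (b - 1)) * indicator {y. 1 < t * y} y \<partial>M)
         = (\<integral>\<^sup>+ y. h y * (ennreal ((t - 1 / y) powr (b - 1)) * indicator {y. 1 < t * y} y) \<partial>lborel) / ennreal B"
        unfolding M_def
        by (subst nn_integral_density) (auto simp: divide_ennreal_def nn_integral_multc[symmetric] nn_integral_cmult[symmetric] mult_ac)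
      also have "(\<integral>\<^sup>+ y. h y * (ennreal ((t - 1 / y) powr (b - 1)) * indicator {y. 1 < t * y} y) \<partial>lborel)
        = (\<integral>\<^sup>+ y. ennreal ((t * y - 1) powr (b - 1) * (1 - y) powr (- b)) * indicator {1/t<..<1} y \<partial>lborel)"
      proof (intro nn_integral_cong)
        fix y :: real
        show "h y * (ennreal ((t - 1 / y) powr (b - 1)) * indicator {y. 1 < t * y} y) =
          ennreal ((t * y - 1) powr (b - 1) * (1 - y) powr (- b)) * indicator {1/t<..<1} y"
        proof (cases "1 / t < y \<and> y < 1")
          case True
          have "0 < 1 / t" using t by simp
          then have y: "0 < y" "y < 1" using True by linarith+
          have ty: "1 < t * y" using True t by (simp add: field_simps)
          have "y powr (b - 1) * (t - 1 / y) powr (b - 1) = (y * (t - 1 / y)) powr (b - 1)"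
            by (rule powr_mult[symmetric])
          also have "y * (t - 1 / y) = t * y - 1" using y by (simp add: field_simps)
          finally have "y powr (b - 1) * (1 - y) powr (- b) * (t - 1 / y) powr (b - 1) =
             (t * y - 1) powr (b - 1) * (1 - y) powr (- b)" by (simp add: mult_ac)
          then show ?thesis using y ty True by (simp add: h_def ennreal_mult[symmetric])
        next
          case False
          have "\<not> (1 < t * y \<and> 0 < y \<and> y < 1)" using False t by (auto simp: field_simps)
          then show ?thesis using False by (auto simp: h_def split: split_indicator)
        qed
      qed
      also have "\<dots> = ennreal \<bar>u\<bar> * (\<integral>\<^sup>+ z. ennreal ((t * (1/t + u * z) - 1) powr (b - 1) * (1 - (1/t + u * z)) powr (- b))
           * indicator {1/t<..<1} (1/t + u * z) \<partial>lborel)"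
        using u by (intro nn_integral_real_affine) auto
      also have "(\<integral>\<^sup>+ z. ennreal ((t * (1/t + u * z) - 1) powr (b - 1) * (1 - (1/t + u * z)) powr (- b))
           * indicator {1/t<..<1} (1/t + u * z) \<partial>lborel) = (\<integral>\<^sup>+ z. ennreal (t powr (b - 1) / u) * h z \<partial>lborel)"
      proof (intro nn_integral_cong)
        fix z :: real
        have "(1/t + u * z \<in> {1/t<..<1}) = (z \<in> {0<..<1})"
        proof -
          have "1/t + u * z < 1 \<longleftrightarrow> u * z < u * 1" using u_def by linarith
          then have "1/t + u * z < 1 \<longleftrightarrow> z < 1" using u by simp
          moreover have "1/t < 1/t + u * z \<longleftrightarrow> 0 < z" using u by (simp add: zero_less_mult_iff)
          ultimately show ?thesis by simp
        qed
        moreover have "(t * (1/t + u * z) - 1) powr (b - 1) * (1 - (1/t + u * z)) powr (- b) =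
            t powr (b - 1) / u * (z powr (b - 1) * (1 - z) powr (- b))" if "z \<in> {0<..<1}"
        proof -
          have "t * (1/t + u * z) - 1 = t * u * z" using t by (simp add: field_simps)
          moreover have "1 - (1/t + u * z) = u * (1 - z)" using u_def by (simp add: right_diff_distrib)
          ultimately have "(t * (1/t + u * z) - 1) powr (b - 1) * (1 - (1/t + u * z)) powr (- b)
             = (t powr (b - 1) * u powr (b - 1) * z powr (b - 1)) * (u powr (- b) * (1 - z) powr (- b))"
            using t u that by (simp add: powr_mult)
          also have "\<dots> = t powr (b - 1) * (u powr (b - 1) * u powr (- b)) * (z powr (b - 1) * (1 - z) powr (- b))"
            by simp
          also have "u powr (b - 1) * u powr (- b) = 1 / u"
            unfolding powr_add[symmetric] using u by (simp add: powr_minus_divide)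
          finally show ?thesis by simp
        qed
        ultimately show "ennreal ((t * (1/t + u * z) - 1) powr (b - 1) * (1 - (1/t + u * z)) powr (- b))
           * indicator {1/t<..<1} (1/t + u * z) = ennreal (t powr (b - 1) / u) * h z"
          using u by (auto simp: h_def indicator_def ennreal_mult[symmetric])
      qed
      also have "ennreal \<bar>u\<bar> * \<dots> = ennreal (t powr (b - 1)) * ennreal B"
        using u by (subst nn_integral_cmult) (auto simp: H mult.assoc[symmetric] ennreal_mult[symmetric])
      finally show ?thesis using True B by (simp add: ennreal_mult_divide_eq)
    qed
  qed
qed

section \<open>The Riesz kernel and positive definiteness of its energy\<close>

definition riesz :: "real \<Rightarrow> 'a::euclidean_space \<Rightarrow> ennreal" where
  "riesz \<alpha> x = riesz_kernel \<alpha> x 0"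

lemma riesz_eq: "riesz \<alpha> x = (if x = 0 then \<infinity> else ennreal (norm x powr (\<alpha> - real DIM('a))))"
  for x :: "'a::euclidean_space"
  by (simp add: riesz_def riesz_kernel_def)

lemma riesz_kernel_eq_riesz: "riesz_kernel \<alpha> x y = riesz \<alpha> (x - y)"
  by (simp add: riesz_eq riesz_kernel_def dist_norm)

lemma riesz_even: "riesz \<alpha> (- x) = riesz \<alpha> x" by (simp add: riesz_eq)

lemma measurable_riesz [measurable]: "riesz \<alpha> \<in> borel_measurable borel"
  unfolding riesz_eq[abs_def] by measurable

text \<open>The inequality \<open>0 \<le> (s * a - (b - b'))\<^sup>2 / s\<close> with the negative
  terms moved to the left. Integrated, it is Cauchy-Schwarz for \<open>l\<close> against
  \<open>\<nu> - \<nu>'\<close> without mentioning a signed measure; \<open>s\<close> is the free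
  parameter of the weighted mean inequality.\<close>

lemma quadratic_form_ineq_ennreal:
  fixes a b b' :: ennreal assumes s: "s > (0::real)"
  shows "2 * (a * b) + ennreal (2 / s) * (b * b') \<le>
     2 * (a * b') + ennreal s * (a * a) + ennreal (1 / s) * (b * b + b' * b')"
proof (cases "a = \<top> \<or> b = \<top> \<or> b' = \<top>")
  case True
  then have "2 * (a * b') + ennreal s * (a * a) + ennreal (1 / s) * (b * b + b' * b') = \<top>"
    using s by (auto simp: ennreal_mult_top ennreal_top_mult ennreal_mult_eq_top_iff)
  then show ?thesis by (simp only: top_greatest)
next
  case False
  then obtain x y z where *: "a = ennreal x" "b = ennreal y" "b' = ennreal z" "x \<ge> 0" "y \<ge> 0" "z \<ge> 0"
    by (metis ennreal_cases)
  have "0 \<le> (s * x - (y - z))\<^sup>2 / s" using s by simp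
  also have "\<dots> = s * (x * x) + (1 / s) * (y * y + z * z) + 2 * (x * z) - 2 * (x * y) - (2 / s) * (y * z)"
    using s by (simp add: field_simps power2_eq_square)
  finally have "2 * (x * y) + (2 / s) * (y * z) \<le> 2 * (x * z) + s * (x * x) + (1 / s) * (y * y + z * z)"
    by simp
  moreover have "2 * ennreal u = ennreal (2 * u)" if "u \<ge> 0" for u using that by (simp add: ennreal_mult)
  ultimately show ?thesis using s *
    by (simp add: ennreal_mult[symmetric] ennreal_plus[symmetric] del: ennreal_plus ennreal_numeral)
qed

text \<open>The weight \<open>\<rho>\<close> is the law of the subordinated Brownian motion at the first passage of the
  \<open>\<alpha>/2\<close>-stable subordinator above level 1, hence convolution with \<open>\<rho>\<close> only removes
  the part \<open>g\<close> of the kernel that is accumulated before the passage.\<close>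

locale sweeping =
  fixes \<alpha> :: real and \<rho> g :: "'a::euclidean_space \<Rightarrow> ennreal" and B :: real
  assumes alpha: "0 < \<alpha>" "\<alpha> \<le> 2" and dim: "DIM('a) \<ge> 3"
    and rho_meas [measurable]: "\<rho> \<in> borel_measurable borel"
    and g_meas [measurable]: "g \<in> borel_measurable borel"
    and rho_even: "\<And>x. \<rho> (- x) = \<rho> x" and g_even: "\<And>x. g (- x) = g x"
    and rho_mass: "(\<integral>\<^sup>+ x. \<rho> x \<partial>lborel) = 1"
    and riesz_split: "\<And>x. riesz \<alpha> x = g x + conv (riesz \<alpha>) \<rho> x"
    and conv_bound: "\<And>x. conv (riesz \<alpha>) \<rho> x \<le> ennreal B"
    and B_nonneg: "B \<ge> 0"
    and g_mass: "(\<integral>\<^sup>+ x. g x \<partial>lborel) \<noteq> 0" "(\<integral>\<^sup>+ x. g x \<partial>lborel) < \<infinity>"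
    and g_moment: "(\<integral>\<^sup>+ x. ennreal (norm x powr (real DIM('a) - \<alpha>)) * g x \<partial>lborel) < \<infinity>"
    and conv_tendsto: "\<And>x X. X \<longlonglongrightarrow> x \<Longrightarrow> (\<lambda>k. conv (riesz \<alpha>) \<rho> (X k)) \<longlonglongrightarrow> conv (riesz \<alpha>) \<rho> x"
    and rho_lsc: "\<And>x X. X \<longlonglongrightarrow> x \<Longrightarrow> \<rho> x \<le> liminf (\<lambda>k. \<rho> (X k))"
    and rho_pos: "\<And>R. \<exists>e>0. \<forall>x. norm x \<le> R \<longrightarrow> ennreal e \<le> \<rho> x"
    and posdef: "\<And>(l :: 'a measure) \<nu> \<nu>' s. s > 0 \<Longrightarrow> sigma_finite_measure l \<Longrightarrow> sets l = sets borel
      \<Longrightarrow> sigma_finite_measure \<nu> \<Longrightarrow> sets \<nu> = sets borel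
      \<Longrightarrow> sigma_finite_measure \<nu>' \<Longrightarrow> sets \<nu>' = sets borel \<Longrightarrow>
      2 * (\<integral>\<^sup>+ x. conv_measure (riesz \<alpha>) l x \<partial>\<nu>) + ennreal (2 / s) * (\<integral>\<^sup>+ x. conv_measure (riesz \<alpha>) \<nu> x \<partial>\<nu>')
       \<le> 2 * (\<integral>\<^sup>+ x. conv_measure (riesz \<alpha>) l x \<partial>\<nu>') + ennreal s * (\<integral>\<^sup>+ x. conv_measure (riesz \<alpha>) l x \<partial>l)
        + ennreal (1 / s) * ((\<integral>\<^sup>+ x. conv_measure (riesz \<alpha>) \<nu> x \<partial>\<nu>) + (\<integral>\<^sup>+ x. conv_measure (riesz \<alpha>) \<nu>' x \<partial>\<nu>'))"

text \<open>Half of the Gaussian exponent pays for the power: with \<open>z\<close> equal to one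
  eighth of the squared norm, \<open>heat 1\<close> is \<open>exp (- 2 * z)\<close> up to a constant
  and the power is at most a multiple of \<open>exp z\<close>.\<close>

lemma nn_integral_heat_moment_finite:
  fixes p :: real assumes p: "0 \<le> p" "p \<le> 2 * real k"
  shows "(\<integral>\<^sup>+ y. ennreal (norm y powr p) * ennreal (heat 1 (y::'a::euclidean_space)) \<partial>lborel) < \<infinity>"
proof -
  define J where "J = gauss_mass TYPE('a)"
  have J: "J > 0" by (simp add: J_def gauss_mass_pos)
  define D :: real where "D = (1 + fact k * 8 ^ k) / J"
  have D: "D \<ge> 0" using J by (simp add: D_def)
  have *: "norm y powr p * heat 1 y \<le> D * exp (- (1 / 8) * (norm y)\<^sup>2)" for y :: 'a
  proof -
    define z where "z = (norm y)\<^sup>2 / 8"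
    have z: "z \<ge> 0" by (simp add: z_def)
    have "norm y powr p \<le> 1 + (norm y) ^ (2 * k)"
    proof (cases "norm y \<le> 1")
      case True then have "norm y powr p \<le> 1" using p by (intro powr_le1) auto
      then show ?thesis by (simp add: add_increasing2)
    next
      case False
      then have "norm y powr p \<le> norm y powr (real (2 * k))" using p by (intro powr_mono) auto
      also have "\<dots> = norm y ^ (2 * k)" using False by (intro powr_realpow) auto
      finally show ?thesis by simp
    qed
    also have "norm y ^ (2 * k) = 8 ^ k * z ^ k" by (simp add: z_def power_mult power_divide)
    also have "\<dots> \<le> 8 ^ k * (fact k * exp z)"
      using power_div_fact_le_exp[OF z, of k] by (intro mult_left_mono) (auto simp: field_simps)
    also have "1 + \<dots> \<le> (1 + fact k * 8 ^ k) * exp z" using z by (simp add: algebra_simps)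
    finally have "norm y powr p \<le> (1 + fact k * 8 ^ k) * exp z" by simp
    moreover have "heat 1 y = exp (- 2 * z) / J" by (simp add: heat_def z_def J_def)
    ultimately have "norm y powr p * heat 1 y \<le> (1 + fact k * 8 ^ k) * exp z * (exp (- 2 * z) / J)"
      using J by (simp only:) (rule mult_right_mono, auto)
    also have "\<dots> = D * (exp z * exp (- 2 * z))" by (simp add: D_def)
    also have "exp z * exp (- 2 * z) = exp (- (1 / 8) * (norm y)\<^sup>2)" unfolding exp_add[symmetric] by (simp add: z_def)
    finally show ?thesis .
  qed
  have "(\<integral>\<^sup>+ y. ennreal (norm y powr p) * ennreal (heat 1 (y::'a)) \<partial>lborel)
     \<le> (\<integral>\<^sup>+ y. ennreal D * ennreal (exp (- (1 / 8) * (norm (y::'a))\<^sup>2)) \<partial>lborel)"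
    using * D by (intro nn_integral_mono) (simp add: ennreal_mult[symmetric] ennreal_leI)
  also have "\<dots> < \<infinity>" using nn_integral_gauss_finite[of "1 / 8", where 'a='a]
    by (subst nn_integral_cmult) (auto simp: ennreal_mult_less_top)
  finally show ?thesis .
qed

text \<open>Splitting the heat kernel at time \<open>t\<close> into two factors at time
  \<open>t/2\<close> and giving one to each measure turns the mutual energy into a superposition of
  products. Any pointwise quadratic inequality then passes to energies.\<close>

lemma mutual_time_kernel_eq:
  fixes l \<nu> :: "'a::euclidean_space measure"
  assumes l: "sigma_finite_measure l" and sl[measurable_cong]: "sets l = sets borel"
    and nu: "sigma_finite_measure \<nu>" and sn[measurable_cong]: "sets \<nu> = sets borel"
  shows "(\<integral>\<^sup>+ x. conv_measure (time_kernel b) l x \<partial>\<nu>) =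
    (\<integral>\<^sup>+ t. ennreal (t powr (b - 1)) *
      (\<integral>\<^sup>+ z. conv_measure (\<lambda>x. ennreal (heat (t/2) x)) l z * conv_measure (\<lambda>x. ennreal (heat (t/2) x)) \<nu> z \<partial>lborel) \<partial>lborel)"
proof -
  interpret L: sigma_finite_measure l by fact
  interpret N: sigma_finite_measure \<nu> by fact
  interpret PL: pair_sigma_finite lborel l ..
  interpret PN: pair_sigma_finite lborel \<nu> ..
  have "conv_measure (time_kernel b) l x = (\<integral>\<^sup>+ t. (\<integral>\<^sup>+ y. ennreal (t powr (b - 1)) * ennreal (heat t (x - y)) \<partial>l) \<partial>lborel)" for x :: 'a
    unfolding conv_measure_def time_kernel_def by (rule PL.Fubini') measurable
  then have "(\<integral>\<^sup>+ x. conv_measure (time_kernel b) l x \<partial>\<nu>) =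
     (\<integral>\<^sup>+ x. (\<integral>\<^sup>+ t. (\<integral>\<^sup>+ y. ennreal (t powr (b - 1)) * ennreal (heat t (x - y)) \<partial>l) \<partial>lborel) \<partial>\<nu>)"
    by simp
  also have "\<dots> = (\<integral>\<^sup>+ t. (\<integral>\<^sup>+ x. (\<integral>\<^sup>+ y. ennreal (t powr (b - 1)) * ennreal (heat t (x - y)) \<partial>l) \<partial>\<nu>) \<partial>lborel)"
    by (rule PN.Fubini') measurable
  also have "\<dots> = (\<integral>\<^sup>+ t. ennreal (t powr (b - 1)) * (\<integral>\<^sup>+ x. conv_measure (\<lambda>x. ennreal (heat t x)) l x \<partial>\<nu>) \<partial>lborel)"
    unfolding conv_measure_def by (simp add: nn_integral_cmult)
  also have "\<dots> = (\<integral>\<^sup>+ t. ennreal (t powr (b - 1)) *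
      (\<integral>\<^sup>+ z. conv_measure (\<lambda>x. ennreal (heat (t/2) x)) l z * conv_measure (\<lambda>x. ennreal (heat (t/2) x)) \<nu> z \<partial>lborel) \<partial>lborel)"
  proof (intro nn_integral_cong arg_cong2[where f="(*)"] refl)
    fix t :: real
    let ?h = "\<lambda>x::'a. ennreal (heat (t/2) x)"
    show "(\<integral>\<^sup>+ x. conv_measure (\<lambda>x. ennreal (heat t x)) l x \<partial>\<nu>) =
       (\<integral>\<^sup>+ z. conv_measure ?h l z * conv_measure ?h \<nu> z \<partial>lborel)"
    proof (cases "t > 0")
      case True
      have "(\<lambda>x::'a. ennreal (heat t x)) = conv ?h ?h"
        using True by (auto simp: fun_eq_iff heat_conv)
      then have "conv_measure (\<lambda>x. ennreal (heat t x)) l = conv ?h (conv_measure ?h l)"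
        using l sl by (simp add: conv_conv_measure)
      then have "(\<integral>\<^sup>+ x. conv_measure (\<lambda>x. ennreal (heat t x)) l x \<partial>\<nu>) =
          (\<integral>\<^sup>+ z. conv_measure ?h \<nu> z * conv_measure ?h l z \<partial>lborel)"
        using l sl nu sn by (simp, subst nn_integral_conv_dual) (auto simp: heat_even)
      then show ?thesis by (simp add: mult.commute)
    next
      case False
      then show ?thesis by (simp add: conv_measure_def heat_def)
    qed
  qed
  finally show ?thesis .
qed

text \<open>Formally, twice the energy of \<open>l\<close> against \<open>\<nu> - \<nu>'\<close> is
  at most \<open>s\<close> times the energy of \<open>l\<close> plus \<open>1 / s\<close> times the
  energy of \<open>\<nu> - \<nu>'\<close>. The cross terms are transposed so that the statement
  survives infinite energies.\<close>

lemma time_kernel_posdef: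
  fixes l \<nu> \<nu>' :: "'a::euclidean_space measure"
  assumes s: "s > 0" and l: "sigma_finite_measure l" and sl[measurable_cong]: "sets l = sets borel"
    and nu: "sigma_finite_measure \<nu>" and sn[measurable_cong]: "sets \<nu> = sets borel"
    and nu': "sigma_finite_measure \<nu>'" and sn'[measurable_cong]: "sets \<nu>' = sets borel"
  shows "2 * (\<integral>\<^sup>+ x. conv_measure (time_kernel b) l x \<partial>\<nu>) + ennreal (2 / s) * (\<integral>\<^sup>+ x. conv_measure (time_kernel b) \<nu> x \<partial>\<nu>')
       \<le> 2 * (\<integral>\<^sup>+ x. conv_measure (time_kernel b) l x \<partial>\<nu>') + ennreal s * (\<integral>\<^sup>+ x. conv_measure (time_kernel b) l x \<partial>l)
        + ennreal (1 / s) * ((\<integral>\<^sup>+ x. conv_measure (time_kernel b) \<nu> x \<partial>\<nu>) + (\<integral>\<^sup>+ x. conv_measure (time_kernel b) \<nu>' x \<partial>\<nu>'))"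
proof -
  interpret L: sigma_finite_measure l by fact
  interpret N: sigma_finite_measure \<nu> by fact
  interpret N': sigma_finite_measure \<nu>' by fact
  define w where "w = (\<lambda>t::real. ennreal (t powr (b - 1)))"
  define F where "F = (\<lambda>m t (z::'a). \<integral>\<^sup>+ y. ennreal (heat (t/2) (z - y)) \<partial>m)"
  have [measurable]: "w \<in> borel_measurable borel" by (simp add: w_def)
  have [measurable]: "case_prod (F l) \<in> borel_measurable (borel \<Otimes>\<^sub>M borel)"
     "case_prod (F \<nu>) \<in> borel_measurable (borel \<Otimes>\<^sub>M borel)"
     "case_prod (F \<nu>') \<in> borel_measurable (borel \<Otimes>\<^sub>M borel)"
    unfolding F_def case_prod_unfold by measurable
  have E: "(\<integral>\<^sup>+ x. conv_measure (time_kernel b) m x \<partial>m') = (\<integral>\<^sup>+ t. w t * (\<integral>\<^sup>+ z. F m t z * F m' t z \<partial>lborel) \<partial>lborel)"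
    if "m \<in> {l, \<nu>, \<nu>'}" "m' \<in> {l, \<nu>, \<nu>'}" for m m'
    using that assms by (subst mutual_time_kernel_eq) (auto simp: F_def w_def conv_measure_def)
  define G where "G = (\<lambda>m m' t. \<integral>\<^sup>+ z. F m t z * F m' t z \<partial>lborel)"
  have [measurable]: "G m m' \<in> borel_measurable borel" if "m \<in> {l, \<nu>, \<nu>'}" "m' \<in> {l, \<nu>, \<nu>'}" for m m'
    using that unfolding G_def by auto
  have 1: "(\<integral>\<^sup>+ z. 2 * (F l t z * F \<nu> t z) + ennreal (2 / s) * (F \<nu> t z * F \<nu>' t z) \<partial>lborel)
      = 2 * G l \<nu> t + ennreal (2 / s) * G \<nu> \<nu>' t" for t
    unfolding G_def by (simp add: nn_integral_add nn_integral_cmult)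
  have 2: "(\<integral>\<^sup>+ z. 2 * (F l t z * F \<nu>' t z) + ennreal s * (F l t z * F l t z)
      + ennreal (1 / s) * (F \<nu> t z * F \<nu> t z + F \<nu>' t z * F \<nu>' t z) \<partial>lborel)
      = 2 * G l \<nu>' t + ennreal s * G l l t + ennreal (1 / s) * (G \<nu> \<nu> t + G \<nu>' \<nu>' t)" for t
    unfolding G_def by (simp add: nn_integral_add nn_integral_cmult)
  have "2 * (\<integral>\<^sup>+ t. w t * G l \<nu> t \<partial>lborel) + ennreal (2 / s) * (\<integral>\<^sup>+ t. w t * G \<nu> \<nu>' t \<partial>lborel)
     = (\<integral>\<^sup>+ t. w t * (2 * G l \<nu> t + ennreal (2 / s) * G \<nu> \<nu>' t) \<partial>lborel)"
    by (simp add: nn_integral_add nn_integral_cmult distrib_left mult.left_commute[of "w _"])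
  also have "\<dots> \<le> (\<integral>\<^sup>+ t. w t * (2 * G l \<nu>' t + ennreal s * G l l t + ennreal (1 / s) * (G \<nu> \<nu> t + G \<nu>' \<nu>' t)) \<partial>lborel)"
    unfolding 1[symmetric] 2[symmetric]
    using quadratic_form_ineq_ennreal[OF s] by (intro nn_integral_mono mult_left_mono) auto
  also have "\<dots> = 2 * (\<integral>\<^sup>+ t. w t * G l \<nu>' t \<partial>lborel) + ennreal s * (\<integral>\<^sup>+ t. w t * G l l t \<partial>lborel)
      + ennreal (1 / s) * ((\<integral>\<^sup>+ t. w t * G \<nu> \<nu> t \<partial>lborel) + (\<integral>\<^sup>+ t. w t * G \<nu>' \<nu>' t \<partial>lborel))"
    by (simp add: nn_integral_add nn_integral_cmult distrib_left mult.left_commute[of "w _"])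
  finally show ?thesis by (simp add: E G_def)
qed

text \<open>The density integrated over \<open>M\<close> is that of Brownian motion at the random
  time \<open>1 / y\<close>. By the semigroup law times add, \<open>t + 1 / y\<close>; after
  shifting \<open>t\<close>, the passage identity leaves exactly the times beyond 1.\<close>

lemma conv_time_kernel_passage:
  fixes M :: "real measure" and x :: "'a::euclidean_space"
  assumes "prob_space M" and sM[measurable_cong]: "sets M = sets borel" and AE: "AE y in M. 0 < y \<and> y \<le> 1"
    and M: "\<And>t. t > 0 \<Longrightarrow> (\<integral>\<^sup>+ y. ennreal ((t - 1 / y) powr (b - 1)) * indicator {y. 1 < t * y} y \<partial>M)
        = ennreal (t powr (b - 1)) * indicator {1<..} t"
  shows "conv (time_kernel b) (\<lambda>x. \<integral>\<^sup>+ y. ennreal (heat (1 / y) x) \<partial>M) x =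
     (\<integral>\<^sup>+ t. ennreal (t powr (b - 1)) * ennreal (heat t x) * indicator {1<..} t \<partial>lborel)"
proof -
  interpret prob_space M by fact
  interpret P: pair_sigma_finite M "lborel :: real measure" ..
  interpret Pa: pair_sigma_finite M "lborel :: 'a measure" ..
  define w where "w = (\<lambda>t::real. ennreal (t powr (b - 1)))"
  have [measurable]: "w \<in> borel_measurable borel" by (simp add: w_def)
  have tk: "time_kernel b = (\<lambda>x::'a. \<integral>\<^sup>+ t. w t * ennreal (heat t x) \<partial>lborel)"
    by (simp add: time_kernel_def w_def fun_eq_iff)
  have "conv (time_kernel b) (\<lambda>x. \<integral>\<^sup>+ y. ennreal (heat (1 / y) x) \<partial>M) x =
    (\<integral>\<^sup>+ z. (\<integral>\<^sup>+ y. (\<integral>\<^sup>+ t. w t * ennreal (heat t (x - z)) * ennreal (heat (1 / y) z) \<partial>lborel) \<partial>M) \<partial>lborel)"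
    unfolding conv_def tk by (simp add: nn_integral_cmult nn_integral_multc)
  also have "\<dots> = (\<integral>\<^sup>+ y. (\<integral>\<^sup>+ z. (\<integral>\<^sup>+ t. w t * ennreal (heat t (x - z)) * ennreal (heat (1 / y) z) \<partial>lborel) \<partial>lborel) \<partial>M)"
    by (rule Pa.Fubini') measurable
  also have "\<dots> = (\<integral>\<^sup>+ y. (\<integral>\<^sup>+ t. (\<integral>\<^sup>+ z. w t * ennreal (heat t (x - z)) * ennreal (heat (1 / y) z) \<partial>lborel) \<partial>lborel) \<partial>M)"
    by (intro nn_integral_cong lborel_pair.Fubini') measurable
  also have "\<dots> = (\<integral>\<^sup>+ y. (\<integral>\<^sup>+ t. w (t - 1 / y) * indicator {y. 1 < t * y} y * ennreal (heat t x) \<partial>lborel) \<partial>M)"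
  proof (rule nn_integral_cong_AE, use AE in eventually_elim)
    fix y :: real assume y: "0 < y \<and> y \<le> 1"
    have "(\<integral>\<^sup>+ z. w t * ennreal (heat t (x - z)) * ennreal (heat (1 / y) z) \<partial>lborel)
      = w t * indicator {0<..} t * ennreal (heat (t + 1 / y) x)" for t
    proof (cases "t > 0")
      case True
      have "(\<integral>\<^sup>+ z. w t * ennreal (heat t (x - z)) * ennreal (heat (1 / y) z) \<partial>lborel)
        = w t * conv (\<lambda>x. ennreal (heat t x)) (\<lambda>x. ennreal (heat (1 / y) x)) x"
        unfolding conv_def by (subst nn_integral_cmult[symmetric]) (auto simp: mult.assoc)
      also have "\<dots> = w t * ennreal (heat (t + 1 / y) x)" using True y by (subst heat_conv) auto
      finally show ?thesis using True by simp
    qed (simp add: heat_def)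
    then have "(\<integral>\<^sup>+ t. (\<integral>\<^sup>+ z. w t * ennreal (heat t (x - z)) * ennreal (heat (1 / y) z) \<partial>lborel) \<partial>lborel)
      = (\<integral>\<^sup>+ t. w t * indicator {0<..} t * ennreal (heat (t + 1 / y) x) \<partial>lborel)" by simp
    also have "\<dots> = (\<integral>\<^sup>+ t. w (t - 1 / y) * indicator {0<..} (t - 1 / y) * ennreal (heat t x) \<partial>lborel)"
      using nn_integral_lborel_shift[of "\<lambda>t. w (t - 1 / y) * indicator {0<..} (t - 1 / y) * ennreal (heat t x)" "1 / y"]
      by simp
    also have "\<dots> = (\<integral>\<^sup>+ t. w (t - 1 / y) * indicator {y. 1 < t * y} y * ennreal (heat t x) \<partial>lborel)"
      using y by (intro nn_integral_cong) (auto simp: field_simps split: split_indicator)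
    finally show "(\<integral>\<^sup>+ t. (\<integral>\<^sup>+ z. w t * ennreal (heat t (x - z)) * ennreal (heat (1 / y) z) \<partial>lborel) \<partial>lborel) =
       (\<integral>\<^sup>+ t. w (t - 1 / y) * indicator {y. 1 < t * y} y * ennreal (heat t x) \<partial>lborel)" .
  qed
  also have "\<dots> = (\<integral>\<^sup>+ t. (\<integral>\<^sup>+ y. w (t - 1 / y) * indicator {y. 1 < t * y} y * ennreal (heat t x) \<partial>M) \<partial>lborel)"
    by (rule P.Fubini'[symmetric]) measurable
  also have "\<dots> = (\<integral>\<^sup>+ t. ennreal (t powr (b - 1)) * ennreal (heat t x) * indicator {1<..} t \<partial>lborel)"
  proof (intro nn_integral_cong)
    fix t :: real
    show "(\<integral>\<^sup>+ y. w (t - 1 / y) * indicator {y. 1 < t * y} y * ennreal (heat t x) \<partial>M) =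
       ennreal (t powr (b - 1)) * ennreal (heat t x) * indicator {1<..} t"
    proof (cases "t > 0")
      case True then show ?thesis using M[of t] by (subst nn_integral_multc) (auto simp: w_def mult_ac)
    qed (simp add: heat_def)
  qed
  finally show ?thesis .
qed

lemma tendsto_heat:
  fixes x :: "'a::euclidean_space"
  assumes X: "X \<longlonglongrightarrow> x" shows "(\<lambda>k. heat t (X k)) \<longlonglongrightarrow> heat t x"
proof (cases "t \<le> 0")
  case False
  have "(\<lambda>k. t powr (- (real DIM('a) / 2)) * exp (- (norm (X k))\<^sup>2 / (4 * t)) / gauss_mass TYPE('a)) \<longlonglongrightarrow>
    t powr (- (real DIM('a) / 2)) * exp (- (norm x)\<^sup>2 / (4 * t)) / gauss_mass TYPE('a)"
    using False gauss_mass_pos[where 'a='a] X by (intro tendsto_intros) auto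
  then show ?thesis using False by (simp only: heat_def if_False)
qed (simp add: heat_def)

lemma nn_integral_powr_unit:
  fixes b :: real assumes "b > 0"
  shows "(\<integral>\<^sup>+ t. ennreal (t powr (b - 1)) * indicator {0<..1} t \<partial>lborel) = ennreal (1 / b)"
proof -
  have "(\<integral>\<^sup>+ t. ennreal (t powr (b - 1)) * indicator {0<..1} t \<partial>lborel)
    = (\<integral>\<^sup>+ t. ennreal (t powr (b - 1)) * indicator {0..1} t \<partial>lborel)"
    by (intro nn_integral_cong) (auto split: split_indicator)
  also have "\<dots> = ennreal (1 powr (b - 1 + 1) / (b - 1 + 1))"
    using assms has_integral_powr_from_0[of "b - 1" 1] by (intro nn_integral_has_integral_lebesgue') auto
  finally show ?thesis by simp
qed

text \<open>With \<open>b = \<alpha> / 2\<close>, the part of the time integral up to time 1 becomes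
  \<open>g\<close> and the rest is \<open>K * \<rho>\<close>. Small times carry the singularity and
  large times the slow decay, so \<open>g\<close> is integrable with moments while
  \<open>K * \<rho>\<close> is bounded and continuous.\<close>

lemma sweeping_exists:
  fixes \<alpha> :: real
  assumes dim: "DIM('a::euclidean_space) \<ge> 3" and alpha: "0 < \<alpha>" "\<alpha> \<le> 2"
  obtains \<rho> g :: "'a::euclidean_space \<Rightarrow> ennreal" and B where "sweeping \<alpha> \<rho> g B"
proof -
  define b where "b = \<alpha> / 2"
  define n where "n = real DIM('a)"
  have n: "n \<ge> 3" using dim by (simp add: n_def)
  have b: "0 < b" "b \<le> 1" "b < n / 2" using alpha n by (auto simp: b_def)
  define J where "J = gauss_mass TYPE('a)"
  have J: "J > 0" by (simp add: J_def gauss_mass_pos)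
  obtain A where A: "A > 0" "\<And>x::'a. time_kernel b x = (if x = 0 then \<infinity> else ennreal (A * norm x powr (2 * b - n)))"
    using time_kernel_eq[of b, where 'a='a] b unfolding n_def by metis
  have b2: "2 * b = \<alpha>" by (simp add: b_def)
  define C where "C = ennreal (1 / A)"
  have C0: "C \<noteq> 0" "C < \<infinity>" using A by (auto simp: C_def)
  have K: "riesz \<alpha> x = C * time_kernel b x" for x :: 'a
    using A(1) by (auto simp: A(2) riesz_eq C_def ennreal_mult_top b_def[symmetric] n_def ennreal_mult[symmetric] b2)
  have tkm[measurable]: "time_kernel b \<in> borel_measurable (borel :: 'a measure)"
    unfolding time_kernel_def[abs_def] by measurable
  obtain M where M: "prob_space M" "sets M = sets borel" "AE y in M. 0 < y \<and> y \<le> 1"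
    "\<And>t. t > 0 \<Longrightarrow> (\<integral>\<^sup>+ y. ennreal ((t - 1 / y) powr (b - 1)) * indicator {y. 1 < t * y} y \<partial>M)
        = ennreal (t powr (b - 1)) * indicator {1<..} t"
    by (rule passage_measure_exists[OF b(1,2)]) (rule that)
  interpret M: prob_space M by fact
  note M(2)[measurable_cong]
  define \<rho> where "\<rho> = (\<lambda>x::'a. \<integral>\<^sup>+ y. ennreal (heat (1 / y) x) \<partial>M)"
  define w where "w = (\<lambda>t. ennreal (t powr (b - 1)))"
  have wm[measurable]: "w \<in> borel_measurable borel" by (simp add: w_def)
  define g where "g = (\<lambda>x::'a. C * (\<integral>\<^sup>+ t. w t * ennreal (heat t x) * indicator {0<..1} t \<partial>lborel))"
  have \<rho>m[measurable]: "\<rho> \<in> borel_measurable borel" unfolding \<rho>_def by measurable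
  have gm[measurable]: "g \<in> borel_measurable borel" unfolding g_def by measurable
  interpret Pa: pair_sigma_finite M "lborel :: 'a measure" ..
  have conv_eq: "conv (riesz \<alpha>) \<rho> x = C * (\<integral>\<^sup>+ t. w t * ennreal (heat t x) * indicator {1<..} t \<partial>lborel)" for x
  proof -
    have "riesz \<alpha> = (\<lambda>x::'a. C * time_kernel b x)" by (simp add: K fun_eq_iff)
    then have "conv (riesz \<alpha>) \<rho> x = C * conv (time_kernel b) \<rho> x"
      by (simp add: conv_def mult.assoc nn_integral_cmult)
    then show ?thesis unfolding \<rho>_def w_def using conv_time_kernel_passage[OF M, of x] by simp
  qed
  \<comment> \<open>For \<open>t > 1\<close> the heat kernel is at most
    \<open>t powr (- (n / 2)) / J\<close> uniformly in space, and the resulting power is integrable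
    at infinity because \<open>b < n / 2\<close>. The same majorant justifies dominated convergence
    for the continuity of \<open>K * \<rho>\<close>.\<close>
  define B where "B = enn2real (C * (\<integral>\<^sup>+ t. ennreal (1 / J) * (ennreal (t powr (b - 1 - n / 2)) * indicator {1..} t) \<partial>lborel))"
  have Bfin: "C * (\<integral>\<^sup>+ t. ennreal (1 / J) * (ennreal (t powr (b - 1 - n / 2)) * indicator {1..} t) \<partial>lborel) < \<infinity>"
    using b C0 nn_integral_has_integral_lebesgue'[OF _ has_integral_powr_to_inf[of "b - 1 - n / 2" 1]]
    by (subst nn_integral_cmult) (auto simp: ennreal_mult_less_top)
  have dom: "w t * ennreal (heat t x) * indicator {1<..} t \<le> ennreal (1 / J) * (ennreal (t powr (b - 1 - n / 2)) * indicator {1..} t)" for t and x :: 'a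
  proof (cases "t > 1")
      case True
      have "heat t x \<le> t powr (- (n / 2)) * 1 / J" using True J
        unfolding heat_def by (auto simp: J_def[symmetric] n_def[symmetric] intro!: divide_right_mono mult_left_le)
      then have "t powr (b - 1) * heat t x \<le> t powr (b - 1) * (t powr (- (n / 2)) * 1 / J)"
        by (intro mult_left_mono) auto
      also have "\<dots> = 1 / J * t powr (b - 1 - n / 2)"
        by (simp add: powr_add[symmetric])
      finally show ?thesis using True J by (simp add: w_def ennreal_mult[symmetric] ennreal_leI)
    qed simp
  have g_int: "(\<integral>\<^sup>+ x. f x * g x \<partial>lborel) =
      C * (\<integral>\<^sup>+ t. w t * indicator {0<..1} t * (\<integral>\<^sup>+ x. f x * ennreal (heat t x) \<partial>lborel) \<partial>lborel)"
    if [measurable]: "f \<in> borel_measurable borel" for f :: "'a \<Rightarrow> ennreal"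
  proof -
    have "(\<integral>\<^sup>+ x. f x * g x \<partial>lborel) = C * (\<integral>\<^sup>+ x. (\<integral>\<^sup>+ t. w t * indicator {0<..1} t * (f x * ennreal (heat t x)) \<partial>lborel) \<partial>lborel)"
      unfolding g_def by (simp add: nn_integral_cmult[symmetric] mult_ac)
    also have "(\<integral>\<^sup>+ x. (\<integral>\<^sup>+ t. w t * indicator {0<..1} t * (f x * ennreal (heat t x)) \<partial>lborel) \<partial>lborel) =
       (\<integral>\<^sup>+ t. (\<integral>\<^sup>+ x. w t * indicator {0<..1} t * (f x * ennreal (heat t x)) \<partial>lborel) \<partial>lborel)"
      by (rule lborel_pair.Fubini') measurable
    finally show ?thesis by (simp add: nn_integral_cmult)
  qed
  have "sweeping \<alpha> \<rho> g B"
  proof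
    show "0 < \<alpha>" "\<alpha> \<le> 2" "3 \<le> DIM('a)" by fact+
    show "\<rho> \<in> borel_measurable borel" "g \<in> borel_measurable borel" by measurable
    show "\<rho> (- x) = \<rho> x" "g (- x) = g x" for x by (simp_all add: \<rho>_def g_def heat_even)
    have "(\<integral>\<^sup>+ x. \<rho> x \<partial>lborel) = (\<integral>\<^sup>+ y. (\<integral>\<^sup>+ x. ennreal (heat (1 / y) (x::'a)) \<partial>lborel) \<partial>M)"
      unfolding \<rho>_def by (rule Pa.Fubini') measurable
    also have "\<dots> = (\<integral>\<^sup>+ y. 1 \<partial>M)"
      by (rule nn_integral_cong_AE, use M(3) in eventually_elim) (simp add: nn_integral_heat)
    finally show "(\<integral>\<^sup>+ x. \<rho> x \<partial>lborel) = 1" by (simp add: M.emeasure_space_1)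
    show "riesz \<alpha> x = g x + conv (riesz \<alpha>) \<rho> x" for x
    proof -
      have "time_kernel b x = (\<integral>\<^sup>+ t. w t * ennreal (heat t x) * indicator {0<..1} t + w t * ennreal (heat t x) * indicator {1<..} t \<partial>lborel)"
        unfolding time_kernel_def w_def by (intro nn_integral_cong) (auto simp: heat_def split: split_indicator)
      then show ?thesis unfolding K conv_eq g_def by (simp add: nn_integral_add distrib_left)
    qed
    show "conv (riesz \<alpha>) \<rho> x \<le> ennreal B" for x
    proof -
      have "conv (riesz \<alpha>) \<rho> x \<le> C * (\<integral>\<^sup>+ t. ennreal (1 / J) * (ennreal (t powr (b - 1 - n / 2)) * indicator {1..} t) \<partial>lborel)"
        unfolding conv_eq by (intro mult_left_mono nn_integral_mono dom) simp
      then show ?thesis using Bfin by (simp add: B_def less_top)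
    qed
    show "(\<lambda>k. conv (riesz \<alpha>) \<rho> (X k)) \<longlonglongrightarrow> conv (riesz \<alpha>) \<rho> x" if X: "X \<longlonglongrightarrow> x" for X x
      unfolding conv_eq
    proof (intro ennreal_tendsto_cmult nn_integral_dominated_convergence)
      show "C < \<top>" using C0 by simp
      show "(\<integral>\<^sup>+ t. ennreal (1 / J) * (ennreal (t powr (b - 1 - n / 2)) * indicator {1..} t) \<partial>lborel) < \<infinity>"
        using Bfin C0 by (auto simp: ennreal_mult_less_top)
      show "AE t in lborel. (\<lambda>k. w t * ennreal (heat t (X k)) * indicator {1<..} t) \<longlonglongrightarrow> w t * ennreal (heat t x) * indicator {1<..} t"
      proof (intro AE_I2)
        fix t :: real
        show "(\<lambda>k. w t * ennreal (heat t (X k)) * indicator {1<..} t) \<longlonglongrightarrow> w t * ennreal (heat t x) * indicator {1<..} t"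
        proof (cases "t > 1")
          case True
          have "(\<lambda>k. heat t (X k)) \<longlonglongrightarrow> heat t x" using X by (rule tendsto_heat)
          then have "(\<lambda>k. w t * ennreal (heat t (X k))) \<longlonglongrightarrow> w t * ennreal (heat t x)"
            by (intro ennreal_tendsto_cmult tendsto_ennrealI) (auto simp: w_def)
          then show ?thesis using True by simp
        qed simp
      qed
    qed (use dom in auto)
    show "B \<ge> 0" by (simp add: B_def)
    have "(\<integral>\<^sup>+ x. g x \<partial>lborel) = (\<integral>\<^sup>+ x. 1 * g x \<partial>lborel)" by simp
    also have "\<dots> = C * (\<integral>\<^sup>+ t. w t * indicator {0<..1} t \<partial>lborel)"
    proof (subst g_int, simp, rule arg_cong[where f="\<lambda>x. C * x"], rule nn_integral_cong)
      fix t :: real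
      show "w t * indicator {0<..1} t * (\<integral>\<^sup>+ x. 1 * ennreal (heat t (x::'a)) \<partial>lborel) = w t * indicator {0<..1} t"
        by (cases "0 < t \<and> t \<le> 1") (auto simp: nn_integral_heat)
    qed
    also have "\<dots> = C * ennreal (1 / b)" using nn_integral_powr_unit[OF b(1)] by (simp add: w_def)
    finally have gi: "(\<integral>\<^sup>+ x. g x \<partial>lborel) = C * ennreal (1 / b)" .
    show "(\<integral>\<^sup>+ x. g x \<partial>lborel) \<noteq> 0" "(\<integral>\<^sup>+ x. g x \<partial>lborel) < \<infinity>"
      unfolding gi using C0 b by (auto simp: ennreal_mult_less_top)
    show "(\<integral>\<^sup>+ x. ennreal (norm x powr (real DIM('a) - \<alpha>)) * g x \<partial>lborel) < \<infinity>"
    proof -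
      \<comment> \<open>By parabolic scaling the moment at time \<open>t\<close> is that at time 1
        with the argument multiplied by \<open>sqrt t\<close>; only times up to 1 enter
        \<open>g\<close>, so the moment at time 1 is an upper bound.\<close>
      define p where "p = n - \<alpha>"
      have p: "0 \<le> p" "p \<le> 2 * real DIM('a)" using n alpha by (auto simp: p_def n_def)
      define Mo where "Mo = (\<integral>\<^sup>+ x. ennreal (norm x powr p) * ennreal (heat 1 (x::'a)) \<partial>lborel)"
      have Mo: "Mo < \<infinity>" unfolding Mo_def by (rule nn_integral_heat_moment_finite[OF p])
      have "(\<integral>\<^sup>+ x. ennreal (norm x powr p) * g x \<partial>lborel) =
        C * (\<integral>\<^sup>+ t. w t * indicator {0<..1} t * (\<integral>\<^sup>+ x. ennreal (norm x powr p) * ennreal (heat t (x::'a)) \<partial>lborel) \<partial>lborel)"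
        by (rule g_int) simp
      also have "\<dots> \<le> C * (\<integral>\<^sup>+ t. w t * indicator {0<..1} t * Mo \<partial>lborel)"
      proof (rule mult_left_mono, rule nn_integral_mono)
        fix t :: real
        show "w t * indicator {0<..1} t * (\<integral>\<^sup>+ x. ennreal (norm x powr p) * ennreal (heat t (x::'a)) \<partial>lborel) \<le> w t * indicator {0<..1} t * Mo"
        proof (cases "0 < t \<and> t \<le> 1")
          case True
          then have "(\<integral>\<^sup>+ x. ennreal (norm x powr p) * ennreal (heat t (x::'a)) \<partial>lborel) =
              (\<integral>\<^sup>+ x. ennreal (norm (sqrt t *\<^sub>R x) powr p) * ennreal (heat 1 (x::'a)) \<partial>lborel)"
            by (intro nn_integral_heat_scale) auto
          also have "\<dots> \<le> Mo" unfolding Mo_def using True p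
            by (intro nn_integral_mono mult_right_mono ennreal_leI powr_mono2) (auto intro!: mult_left_le_one_le)
          finally show ?thesis by (intro mult_left_mono) auto
        qed auto
      qed simp
      also have "\<dots> = C * (ennreal (1 / b) * Mo)"
        using nn_integral_powr_unit[OF b(1)] by (subst nn_integral_multc) (auto simp: w_def)
      also have "\<dots> < \<infinity>" using C0 Mo by (auto simp: ennreal_mult_less_top)
      finally show ?thesis by (simp add: p_def n_def)
    qed
    show "\<rho> x \<le> liminf (\<lambda>k. \<rho> (X k))" if X: "X \<longlonglongrightarrow> x" for X x
    proof -
      have "\<rho> x = (\<integral>\<^sup>+ y. liminf (\<lambda>k. ennreal (heat (1 / y) (X k))) \<partial>M)"
        unfolding \<rho>_def
      proof (intro nn_integral_cong)
        fix y
        have "(\<lambda>k. heat (1 / y) (X k)) \<longlonglongrightarrow> heat (1 / y) x" using X by (rule tendsto_heat)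
        then show "ennreal (heat (1 / y) x) = liminf (\<lambda>k. ennreal (heat (1 / y) (X k)))"
          by (intro lim_imp_Liminf[symmetric] tendsto_ennrealI) auto
      qed
      also have "\<dots> \<le> liminf (\<lambda>k. \<rho> (X k))" unfolding \<rho>_def by (rule nn_integral_liminf) measurable
      finally show ?thesis .
    qed
    show "\<exists>e>0. \<forall>x. norm x \<le> R \<longrightarrow> ennreal e \<le> \<rho> x" for R
    proof -
      \<comment> \<open>The value of the heat kernel at time \<open>1 / y\<close> on the sphere of
        radius \<open>R\<close>, which is its minimum over the ball. Its integral over
        \<open>M\<close> is positive, but possibly infinite as far as is known here, hence the two
        cases below.\<close>
      define h where "h = (\<lambda>y::real. ennreal ((1 / y) powr (- (n / 2)) * exp (- R\<^sup>2 / (4 * (1 / y))) / J))"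
      have hm[measurable]: "h \<in> borel_measurable borel" unfolding h_def by measurable
      have I0: "integral\<^sup>N M h \<noteq> 0"
      proof
        assume "integral\<^sup>N M h = 0"
        then have "AE y in M. h y = 0" by (subst (asm) nn_integral_0_iff_AE) auto
        then have "AE y in M. False" using M(3)
        proof eventually_elim
          case (elim y)
          then have "(1 / y) powr (- (n / 2)) * exp (- R\<^sup>2 / (4 * (1 / y))) / J > 0" using J
            by (intro divide_pos_pos mult_pos_pos) auto
          then show ?case using elim by (simp add: h_def ennreal_eq_0_iff)
        qed
        then show False by (simp add: M.AE_False)
      qed
      have le: "integral\<^sup>N M h \<le> \<rho> x" if x: "norm x \<le> R" for x
        unfolding \<rho>_def
      proof (rule nn_integral_mono_AE, use M(3) in eventually_elim)
        fix y :: real assume y: "0 < y \<and> y \<le> 1"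
        have "(norm x)\<^sup>2 \<le> R\<^sup>2" using x by (intro power_mono) auto
        then have "exp (- R\<^sup>2 / (4 * (1 / y))) \<le> exp (- (norm x)\<^sup>2 / (4 * (1 / y)))"
          using y by (simp add: mult_right_mono)
        then show "h y \<le> ennreal (heat (1 / y) x)" unfolding h_def heat_def using y J
          by (auto simp: n_def[symmetric] J_def[symmetric] not_le intro!: ennreal_leI divide_right_mono mult_left_mono)
      qed
      show ?thesis
      proof (cases "integral\<^sup>N M h")
        case (real r)
        then have "r > 0" using I0 by (metis ennreal_eq_0_iff not_le)
        then show ?thesis using real le by auto
      next
        case top
        then show ?thesis using le by (intro exI[of _ 1]) (auto simp: top_unique)
      qed
    qed
  next
    fix l \<nu> \<nu>' :: "'a measure" and s :: real
    assume as: "0 < s" "sigma_finite_measure l" "sets l = sets borel" "sigma_finite_measure \<nu>" "sets \<nu> = sets borel"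
      "sigma_finite_measure \<nu>'" "sets \<nu>' = sets borel"
    note [measurable_cong] = as(3,5,7)
    have E: "(\<integral>\<^sup>+ x. conv_measure (riesz \<alpha>) m x \<partial>m') = C * (\<integral>\<^sup>+ x. conv_measure (time_kernel b) m x \<partial>m')"
      if "m \<in> {l, \<nu>, \<nu>'}" "m' \<in> {l, \<nu>, \<nu>'}" for m m'
    proof -
      have m: "sets m = sets borel" "sets m' = sets borel" "sigma_finite_measure m" using that as by auto
      note m(1,2)[measurable_cong]
      have "conv_measure (riesz \<alpha>) m x = C * conv_measure (time_kernel b) m x" for x
        unfolding conv_measure_def K by (rule nn_integral_cmult) measurable
      moreover have "conv_measure (time_kernel b) m \<in> borel_measurable m'"
        using m by (subst measurable_cong_sets[OF m(2) refl]) (rule measurable_conv_measure, auto)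
      ultimately show ?thesis by (simp add: nn_integral_cmult)
    qed
    from mult_left_mono[OF time_kernel_posdef[OF as, of b], of C]
    show "2 * (\<integral>\<^sup>+ x. conv_measure (riesz \<alpha>) l x \<partial>\<nu>) + ennreal (2 / s) * (\<integral>\<^sup>+ x. conv_measure (riesz \<alpha>) \<nu> x \<partial>\<nu>')
       \<le> 2 * (\<integral>\<^sup>+ x. conv_measure (riesz \<alpha>) l x \<partial>\<nu>') + ennreal s * (\<integral>\<^sup>+ x. conv_measure (riesz \<alpha>) l x \<partial>l)
        + ennreal (1 / s) * ((\<integral>\<^sup>+ x. conv_measure (riesz \<alpha>) \<nu> x \<partial>\<nu>) + (\<integral>\<^sup>+ x. conv_measure (riesz \<alpha>) \<nu>' x \<partial>\<nu>'))"
      by (simp add: E distrib_left mult.left_commute[of C])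
  qed
  then show ?thesis by (rule that)
qed

section \<open>Lower semicontinuity and dilations\<close>

lemma liminf_add_ennreal:
  fixes A B :: "nat \<Rightarrow> ennreal"
  shows "liminf A + liminf B \<le> liminf (\<lambda>k. A k + B k)"
proof -
  have "liminf A + liminf B = (SUP n. (INF m\<in>{n..}. A m) + (INF m\<in>{n..}. B m))"
    unfolding liminf_SUP_INF
    by (rule ennreal_SUP_add[symmetric]) (auto simp: incseq_def intro!: INF_superset_mono)
  also have "\<dots> \<le> (SUP n. INF m\<in>{n..}. A m + B m)"
    by (intro SUP_mono' INF_greatest add_mono INF_lower) auto
  finally show ?thesis by (simp add: liminf_SUP_INF)
qed

lemma liminf_cmult_ennreal:
  fixes A :: "nat \<Rightarrow> ennreal"
  shows "c * liminf A \<le> liminf (\<lambda>k. c * A k)"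
proof -
  have "c * liminf A = (SUP n. c * (INF m\<in>{n..}. A m))"
    unfolding liminf_SUP_INF by (rule SUP_mult_left_ennreal)
  also have "\<dots> \<le> (SUP n. INF m\<in>{n..}. c * A m)"
    by (intro SUP_mono' INF_greatest mult_left_mono INF_lower) auto
  finally show ?thesis by (simp add: liminf_SUP_INF)
qed

lemma le_liminf_of_le_add:
  fixes a :: ennreal
  assumes le: "\<And>k. a \<le> b k + e k" and e: "e \<longlonglongrightarrow> 0"
  shows "a \<le> liminf b"
proof (rule dense_le)
  fix c assume c: "c < a"
  then have "0 < a - c" by (simp add: diff_gr0_ennreal)
  then have "eventually (\<lambda>k. e k < a - c) sequentially" using e by (auto dest: order_tendstoD)
  then have "eventually (\<lambda>k. c \<le> b k) sequentially"
  proof eventually_elim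
    case (elim k)
    show ?case
    proof (rule ccontr)
      assume "\<not> c \<le> b k"
      then have "b k < c" by simp
      then have "b k + e k < c + (a - c)"
        using elim by (intro add_strict_mono)
      also have "c + (a - c) = a" using c by (simp add: add_diff_inverse_ennreal less_imp_le)
      finally show False using le[of k] by simp
    qed
  qed
  then show "c \<le> liminf b" by (rule Liminf_bounded)
qed

text \<open>The sequential form, equivalent to the topological one in euclidean space, combines
  directly with Fatou's lemma.\<close>

definition lsc :: "('a::euclidean_space \<Rightarrow> ennreal) \<Rightarrow> bool" where
  "lsc v \<longleftrightarrow> (\<forall>x X. X \<longlonglongrightarrow> x \<longrightarrow> v x \<le> liminf (\<lambda>k. v (X k)))"

lemma lscD: "lsc v \<Longrightarrow> X \<longlonglongrightarrow> x \<Longrightarrow> v x \<le> liminf (\<lambda>k. v (X k))"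
  by (auto simp: lsc_def)

lemma lsc_add: "lsc u \<Longrightarrow> lsc v \<Longrightarrow> lsc (\<lambda>x. u x + v x)"
  unfolding lsc_def by (auto intro!: order_trans[OF add_mono liminf_add_ennreal])

lemma lsc_cmult: "lsc v \<Longrightarrow> lsc (\<lambda>x. c * v x)"
  unfolding lsc_def by (auto intro!: order_trans[OF mult_left_mono liminf_cmult_ennreal])

lemma lsc_min:
  fixes u v :: "'a::euclidean_space \<Rightarrow> ennreal"
  assumes "lsc u" "lsc v" shows "lsc (\<lambda>x. min (u x) (v x))"
  unfolding lsc_def
proof safe
  fix x :: 'a and X assume X: "X \<longlonglongrightarrow> x"
  show "min (u x) (v x) \<le> liminf (\<lambda>k. min (u (X k)) (v (X k)))"
  proof (rule dense_le)
    fix c assume "c < min (u x) (v x)"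
    then have "c < liminf (\<lambda>k. u (X k))" "c < liminf (\<lambda>k. v (X k))"
      using lscD[OF assms(1) X] lscD[OF assms(2) X] by auto
    then have "eventually (\<lambda>k. c < u (X k)) sequentially" "eventually (\<lambda>k. c < v (X k)) sequentially"
      by (auto dest: less_LiminfD)
    then have "eventually (\<lambda>k. c \<le> min (u (X k)) (v (X k))) sequentially" by eventually_elim auto
    then show "c \<le> liminf (\<lambda>k. min (u (X k)) (v (X k)))" by (rule Liminf_bounded)
  qed
qed

lemma lsc_SUP:
  fixes v :: "'i \<Rightarrow> 'a::euclidean_space \<Rightarrow> ennreal"
  assumes "\<And>i. i \<in> I \<Longrightarrow> lsc (v i)" shows "lsc (\<lambda>x. SUP i\<in>I. v i x)"
  unfolding lsc_def
proof (intro allI impI SUP_least)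
  fix x :: 'a and X i assume X: "X \<longlonglongrightarrow> x" and i: "i \<in> I"
  have "v i x \<le> liminf (\<lambda>k. v i (X k))" using assms[OF i] X by (rule lscD)
  also have "\<dots> \<le> liminf (\<lambda>k. SUP i\<in>I. v i (X k))"
    using i by (intro Liminf_mono always_eventually allI SUP_upper)
  finally show "v i x \<le> liminf (\<lambda>k. SUP i\<in>I. v i (X k))" .
qed

lemma lsc_conv_measure:
  fixes f :: "'a::euclidean_space \<Rightarrow> ennreal"
  assumes "lsc f" and [measurable]: "f \<in> borel_measurable borel" and s[measurable_cong]: "sets \<eta> = sets borel"
  shows "lsc (conv_measure f \<eta>)"
  unfolding lsc_def
proof safe
  fix x :: 'a and X assume X: "X \<longlonglongrightarrow> x"
  have "conv_measure f \<eta> x \<le> (\<integral>\<^sup>+ y. liminf (\<lambda>k. f (X k - y)) \<partial>\<eta>)"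
    unfolding conv_measure_def using X by (intro nn_integral_mono lscD[OF assms(1)] tendsto_intros)
  also have "\<dots> \<le> liminf (\<lambda>k. conv_measure f \<eta> (X k))"
    unfolding conv_measure_def by (rule nn_integral_liminf) measurable
  finally show "conv_measure f \<eta> x \<le> liminf (\<lambda>k. conv_measure f \<eta> (X k))" .
qed

lemma lsc_conv:
  assumes "lsc f" and [measurable]: "f \<in> borel_measurable borel" "h \<in> borel_measurable borel"
  shows "lsc (conv f h)"
  using lsc_conv_measure[OF assms(1,2), of "density lborel h"] by (simp add: conv_eq_conv_measure)

lemma tendsto_riesz:
  fixes x :: "'a::euclidean_space"
  assumes X: "X \<longlonglongrightarrow> x" and a: "\<alpha> < real DIM('a)"
  shows "(\<lambda>k. riesz \<alpha> (X k)) \<longlonglongrightarrow> riesz \<alpha> x"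
proof (cases "x = 0")
  case False
  have ev: "eventually (\<lambda>k. X k \<noteq> 0) sequentially"
    using X False by (metis tendsto_imp_eventually_ne)
  have "(\<lambda>k. ennreal (norm (X k) powr (\<alpha> - real DIM('a)))) \<longlonglongrightarrow> ennreal (norm x powr (\<alpha> - real DIM('a)))"
    using X False by (intro tendsto_ennrealI tendsto_intros) auto
  moreover have "eventually (\<lambda>k. ennreal (norm (X k) powr (\<alpha> - real DIM('a))) = riesz \<alpha> (X k)) sequentially"
    using ev by eventually_elim (simp add: riesz_eq)
  ultimately have "(\<lambda>k. riesz \<alpha> (X k)) \<longlonglongrightarrow> ennreal (norm x powr (\<alpha> - real DIM('a)))"
    by (rule Lim_transform_eventually)
  then show ?thesis using False by (simp add: riesz_eq)
next
  case True
  show ?thesis unfolding True riesz_eq[of \<alpha> 0] if_P[OF refl] infinity_ennreal_def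
  proof (rule tendsto_top_iff_ennreal[THEN iffD2], intro allI impI)
    fix l :: real assume l: "l \<ge> 0"
    define p where "p = real DIM('a) - \<alpha>"
    have p: "p > 0" using a by (simp add: p_def)
    \<comment> \<open>Chosen so that \<open>d powr (- p) = l + 1\<close>: inside this radius the
      kernel exceeds \<open>l\<close>.\<close>
    define d where "d = (l + 1) powr (- 1 / p)"
    have d: "d > 0" using l by (simp add: d_def)
    have "eventually (\<lambda>k. norm (X k) < d) sequentially"
      using X True d by (auto simp: tendsto_iff dist_norm)
    then show "eventually (\<lambda>k. ennreal l < riesz \<alpha> (X k)) sequentially"
    proof eventually_elim
      case (elim k)
      show ?case
      proof (cases "X k = 0")
        case False
        have "l + 1 = d powr (- p)" using l p by (simp add: d_def powr_powr)
        also have "\<dots> \<le> norm (X k) powr (- p)" using elim False p by (intro powr_mono2') auto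
        finally have "l < norm (X k) powr (\<alpha> - real DIM('a))" by (simp add: p_def)
        then show ?thesis using False l by (simp add: riesz_eq ennreal_lessI)
      qed (simp add: riesz_eq)
    qed
  qed
qed

lemma lsc_riesz: "\<alpha> < real DIM('a) \<Longrightarrow> lsc (riesz \<alpha> :: 'a::euclidean_space \<Rightarrow> ennreal)"
  unfolding lsc_def by (auto intro!: eq_refl lim_imp_Liminf[symmetric] tendsto_riesz)

lemma riesz_scale:
  fixes x :: "'a::euclidean_space"
  assumes "r > 0" shows "riesz \<alpha> (r *\<^sub>R x) = ennreal (r powr (\<alpha> - real DIM('a))) * riesz \<alpha> x"
  using assms by (auto simp: riesz_eq powr_mult ennreal_mult ennreal_mult_top)

section \<open>Mass preserving dilations and approximate identities\<close>

definition dilate :: "real \<Rightarrow> ('a::euclidean_space \<Rightarrow> ennreal) \<Rightarrow> 'a \<Rightarrow> ennreal" where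
  "dilate r h x = ennreal (r powr (- real DIM('a))) * h (x /\<^sub>R r)"

lemma measurable_dilate [measurable]:
  assumes [measurable]: "h \<in> borel_measurable borel"
  shows "dilate r h \<in> borel_measurable borel"
  unfolding dilate_def[abs_def] by measurable

lemma nn_integral_dilate_mult:
  fixes h :: "'a::euclidean_space \<Rightarrow> ennreal"
  assumes [measurable]: "h \<in> borel_measurable borel" "f \<in> borel_measurable borel" and r: "r > 0"
  shows "(\<integral>\<^sup>+ y. f y * dilate r h y \<partial>lborel) = (\<integral>\<^sup>+ y. f (r *\<^sub>R y) * h y \<partial>lborel)"
proof -
  have "(\<integral>\<^sup>+ y. f y * dilate r h y \<partial>lborel) =
      ennreal (\<bar>r\<bar> ^ DIM('a)) * (\<integral>\<^sup>+ y. f (r *\<^sub>R y) * dilate r h (r *\<^sub>R y) \<partial>lborel)"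
    using r by (intro nn_integral_lborel_scale) auto
  also have "\<dots> = (\<integral>\<^sup>+ y. ennreal (r ^ DIM('a) * r powr (- real DIM('a))) * (f (r *\<^sub>R y) * h y) \<partial>lborel)"
    using r by (subst nn_integral_cmult[symmetric]) (auto simp: dilate_def ennreal_mult mult_ac)
  also have "r ^ DIM('a) * r powr (- real DIM('a)) = 1"
    using r by (simp add: powr_minus powr_realpow)
  finally show ?thesis by simp
qed

lemma nn_integral_dilate:
  fixes h :: "'a::euclidean_space \<Rightarrow> ennreal"
  assumes [measurable]: "h \<in> borel_measurable borel" and r: "r > 0"
  shows "(\<integral>\<^sup>+ y. dilate r h y \<partial>lborel) = (\<integral>\<^sup>+ y. h y \<partial>lborel)"
  using nn_integral_dilate_mult[of h "\<lambda>_. 1" r] r by simp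

lemma conv_dilate:
  fixes h :: "'a::euclidean_space \<Rightarrow> ennreal"
  assumes [measurable]: "h \<in> borel_measurable borel" "v \<in> borel_measurable borel" and r: "r > 0"
  shows "conv (dilate r h) v x = (\<integral>\<^sup>+ y. v (x - r *\<^sub>R y) * h y \<partial>lborel)"
proof -
  have "conv (dilate r h) v x = conv v (dilate r h) x" by (subst conv_commute) auto
  also have "\<dots> = (\<integral>\<^sup>+ y. v (x - r *\<^sub>R y) * h y \<partial>lborel)"
    unfolding conv_def using r by (intro nn_integral_dilate_mult) auto
  finally show ?thesis .
qed

lemma dilate_even: "(\<And>x. h (- x) = h x) \<Longrightarrow> dilate r h (- x) = dilate r h x"
  by (simp add: dilate_def)

lemma lsc_dilate: "lsc h \<Longrightarrow> lsc (dilate r h)"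
  unfolding dilate_def[abs_def]
  by (intro lsc_cmult, unfold lsc_def, intro allI impI) (drule spec, drule spec, erule mp, intro tendsto_intros)

text \<open>After rescaling, the average is an integral of \<open>v (x - r k *\<^sub>R y)\<close>
  against the fixed probability density \<open>h\<close>. Fatou then reduces the claim to lower
  semicontinuity at \<open>x\<close>, with no bound on \<open>v\<close>.\<close>

lemma lsc_le_liminf_conv_dilate:
  fixes h :: "'a::euclidean_space \<Rightarrow> ennreal"
  assumes [measurable]: "h \<in> borel_measurable borel" "v \<in> borel_measurable borel"
    and v: "lsc v" and h: "(\<integral>\<^sup>+ y. h y \<partial>lborel) = 1" and r: "\<And>k. r k > 0" "r \<longlonglongrightarrow> 0"
  shows "v x \<le> liminf (\<lambda>k. conv (dilate (r k) h) v x)"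
proof -
  have "v x = (\<integral>\<^sup>+ y. h y * v x \<partial>lborel)" by (simp add: nn_integral_multc h)
  also have "\<dots> \<le> (\<integral>\<^sup>+ y. liminf (\<lambda>k. h y * v (x - r k *\<^sub>R y)) \<partial>lborel)"
  proof (intro nn_integral_mono)
    fix y
    have "(\<lambda>k. x - r k *\<^sub>R y) \<longlonglongrightarrow> x - 0 *\<^sub>R y" by (intro tendsto_intros r)
    then have "v x \<le> liminf (\<lambda>k. v (x - r k *\<^sub>R y))" using lscD[OF v] by simp
    then have "h y * v x \<le> h y * liminf (\<lambda>k. v (x - r k *\<^sub>R y))" by (rule mult_left_mono) simp
    also have "\<dots> \<le> liminf (\<lambda>k. h y * v (x - r k *\<^sub>R y))" by (rule liminf_cmult_ennreal)
    finally show "h y * v x \<le> liminf (\<lambda>k. h y * v (x - r k *\<^sub>R y))" .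
  qed
  also have "\<dots> \<le> liminf (\<lambda>k. conv (dilate (r k) h) v x)"
    using nn_integral_liminf[of "\<lambda>k y. h y * v (x - r k *\<^sub>R y)" lborel] r by (simp add: conv_dilate mult.commute)
  finally show ?thesis .
qed

section \<open>The sweeping weight at all scales\<close>

context sweeping
begin

definition dimn :: real where "dimn = real DIM('a)"

lemma dimn: "dimn \<ge> 3" "\<alpha> < dimn" "\<alpha> < real DIM('a)"
  using dim alpha by (auto simp: dimn_def)

definition K :: "'a \<Rightarrow> ennreal" where "K = riesz \<alpha>"

lemma K_meas [measurable]: "K \<in> borel_measurable borel" by (simp add: K_def)
lemma K_even: "K (- x) = K x" by (simp add: K_def riesz_even)
lemma lsc_K: "lsc K" unfolding K_def using dimn by (intro lsc_riesz)

lemma potential_eq: "potential \<alpha> \<eta> = conv_measure K \<eta>" for \<eta> :: "'a measure"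
  by (simp add: fun_eq_iff potential_def conv_measure_def riesz_kernel_eq_riesz K_def)

definition sweep :: "real \<Rightarrow> 'a \<Rightarrow> ennreal" where "sweep r = dilate r \<rho>"
definition G :: ennreal where "G = (\<integral>\<^sup>+ x. g x \<partial>lborel)"
text \<open>The difference of \<open>K\<close> and \<open>K * \<rho>\<^sub>r\<close>, normalized to
  mass one. The homogeneity of \<open>K\<close> makes the removed mass scale like
  \<open>r powr \<alpha>\<close>, which is \<open>gap_mass r\<close>.\<close>

definition gap_density :: "real \<Rightarrow> 'a \<Rightarrow> ennreal" where "gap_density r = dilate r (\<lambda>x. g x / G)"
definition gap_mass :: "real \<Rightarrow> ennreal" where "gap_mass r = ennreal (r powr \<alpha>) * G"

lemma G: "G \<noteq> 0" "G \<noteq> \<infinity>" "G < \<infinity>" using g_mass by (auto simp: G_def)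

lemma gap_mass: "r > 0 \<Longrightarrow> gap_mass r \<noteq> 0" "gap_mass r \<noteq> \<infinity>" "gap_mass r < \<infinity>"
  using G by (auto simp: gap_mass_def ennreal_mult_eq_top_iff ennreal_mult_less_top)

lemma sweep_meas [measurable]: "sweep r \<in> borel_measurable borel" by (simp add: sweep_def)
lemma gap_density_meas [measurable]: "gap_density r \<in> borel_measurable borel" by (simp add: gap_density_def)
lemma sweep_even: "sweep r (- x) = sweep r x" unfolding sweep_def by (intro dilate_even rho_even)
lemma gap_density_even: "gap_density r (- x) = gap_density r x" unfolding gap_density_def by (intro dilate_even) (simp add: g_even)
lemma sweep_mass: "r > 0 \<Longrightarrow> (\<integral>\<^sup>+ x. sweep r x \<partial>lborel) = 1" by (simp add: sweep_def nn_integral_dilate rho_mass)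

lemma gG_mass: "(\<integral>\<^sup>+ x. g x / G \<partial>lborel) = 1"
  using G by (simp add: nn_integral_divide G_def[symmetric] ennreal_divide_self)

lemma gap_density_mass: "r > 0 \<Longrightarrow> (\<integral>\<^sup>+ x. gap_density r x \<partial>lborel) = 1"
  by (simp add: gap_density_def nn_integral_dilate gG_mass)

lemma lsc_sweep: "lsc (sweep r)"
  unfolding sweep_def by (rule lsc_dilate) (use rho_lsc in \<open>auto simp: lsc_def\<close>)

lemma conv_K_sweep_scale:
  assumes r: "r > 0"
  shows "conv K (sweep r) x = ennreal (r powr (\<alpha> - dimn)) * conv K \<rho> (x /\<^sub>R r)"
proof -
  have "K (x - r *\<^sub>R y) = ennreal (r powr (\<alpha> - dimn)) * K (x /\<^sub>R r - y)" for y
    using riesz_scale[OF r, of \<alpha> "x /\<^sub>R r - y"] r by (simp add: K_def dimn_def scaleR_diff_right)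
  moreover have "conv K (sweep r) x = (\<integral>\<^sup>+ y. K (x - r *\<^sub>R y) * \<rho> y \<partial>lborel)"
    using r by (subst conv_commute) (auto simp: sweep_def conv_dilate)
  ultimately show ?thesis by (simp add: conv_def mult.assoc nn_integral_cmult)
qed

text \<open>The decomposition at scale 1 is transported to scale \<open>r\<close> by the homogeneity
  of \<open>K\<close>; all losses of kernel under sweeping are read off from it.\<close>

lemma K_split:
  assumes r: "r > 0"
  shows "K x = gap_mass r * gap_density r x + conv K (sweep r) x"
proof -
  have "K x = ennreal (r powr (\<alpha> - dimn)) * K (x /\<^sub>R r)"
    using riesz_scale[OF r, of \<alpha> "x /\<^sub>R r"] r by (simp add: K_def dimn_def)
  also have "\<dots> = ennreal (r powr (\<alpha> - dimn)) * g (x /\<^sub>R r) + conv K (sweep r) x"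
    using riesz_split[of "x /\<^sub>R r", folded K_def] by (simp add: conv_K_sweep_scale[OF r] distrib_left)
  also have "ennreal (r powr (\<alpha> - dimn)) * g (x /\<^sub>R r) = gap_mass r * gap_density r x"
  proof -
    have "G * (z / G) = z" for z using G by (simp add: ennreal_times_divide ennreal_mult_divide_eq mult.commute)
    moreover have "gap_mass r * gap_density r x = ennreal (r powr \<alpha>) * ennreal (r powr (- dimn)) * (G * (g (x /\<^sub>R r) / G))"
      by (simp add: gap_mass_def gap_density_def dilate_def dimn_def mult_ac)
    ultimately have "gap_mass r * gap_density r x = ennreal (r powr \<alpha>) * ennreal (r powr (- dimn)) * g (x /\<^sub>R r)" by simp
    then show ?thesis by (simp add: ennreal_mult[symmetric] powr_add[symmetric])
  qed
  finally show ?thesis .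
qed

lemma conv_K_sweep_le: "r > 0 \<Longrightarrow> conv K (sweep r) x \<le> K x"
  using K_split[of r x] by (metis add.commute le_iff_add)

text \<open>The exponent \<open>\<alpha> - dimn\<close> is negative, so sweeping at a large scale
  makes the kernel uniformly small.\<close>

lemma conv_K_sweep_bound:
  assumes r: "r > 0"
  shows "conv K (sweep r) x \<le> ennreal (r powr (\<alpha> - dimn) * B)"
  using conv_bound[of "x /\<^sub>R r", folded K_def] B_nonneg
  by (simp add: conv_K_sweep_scale[OF r] ennreal_mult mult_left_mono)

lemma gap_mass_gap_density_le: "r > 0 \<Longrightarrow> gap_mass r * gap_density r x \<le> K x"
  using K_split[of r x] by (metis le_iff_add)

text \<open>Adding the kernel swept at both scales to either side gives \<open>K\<close>. That
  common term is bounded and can be cancelled even where \<open>K\<close> is infinite.\<close>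

lemma gap_density_add_conv:
  assumes N: "N > 0" and d: "d > 0"
  shows "gap_mass N * gap_density N x + gap_mass d * conv (gap_density d) (sweep N) x = gap_mass d * gap_density d x + gap_mass N * conv (gap_density N) (sweep d) x"
proof -
  have split: "conv K (sweep r) x = gap_mass s * conv (gap_density s) (sweep r) x + conv (conv K (sweep s)) (sweep r) x"
    if "r > 0" "s > 0" for r s
  proof -
    have "K = (\<lambda>x. gap_mass s * gap_density s x + conv K (sweep s) x)" using K_split[OF that(2)] by auto
    then have "conv K (sweep r) x = conv (\<lambda>x. gap_mass s * gap_density s x + conv K (sweep s) x) (sweep r) x" by simp
    also have "\<dots> = conv (\<lambda>x. gap_mass s * gap_density s x) (sweep r) x + conv (conv K (sweep s)) (sweep r) x"
      by (rule conv_add_left) auto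
    also have "conv (\<lambda>x. gap_mass s * gap_density s x) (sweep r) x = gap_mass s * conv (gap_density s) (sweep r) x"
      by (subst conv_commute; simp add: conv_cmult_right) (subst conv_commute; simp)
    finally show ?thesis .
  qed
  have comm: "conv (conv K (sweep d)) (sweep N) x = conv (conv K (sweep N)) (sweep d) x" (is "?a = ?b")
    by (simp add: conv_assoc[symmetric] conv_commute[of "sweep d" "sweep N"])
  have "?a \<le> (\<integral>\<^sup>+ y. sweep N y \<partial>lborel) * ennreal (d powr (\<alpha> - dimn) * B)"
    by (subst conv_commute, simp, simp, rule conv_le_const) (auto simp: conv_K_sweep_bound[OF d])
  then have fin: "?a \<noteq> \<infinity>" using N by (auto simp: sweep_mass top_unique)
  have "?a + (gap_mass N * gap_density N x + gap_mass d * conv (gap_density d) (sweep N) x) = K x"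
    unfolding K_split[OF N, of x] split[OF N d] by (simp add: add_ac)
  also have "\<dots> = ?a + (gap_mass d * gap_density d x + gap_mass N * conv (gap_density N) (sweep d) x)"
    unfolding K_split[OF d, of x] split[OF d N] comm by (simp add: add_ac)
  finally show ?thesis using fin by (simp add: ennreal_add_left_cancel)
qed

end

section \<open>The energy estimate\<close>

context sweeping
begin

lemma tendsto_scale_bound:
  assumes "c \<noteq> \<infinity>"
  shows "(\<lambda>k. c * ennreal (M * real (Suc k) powr (\<alpha> - dimn) * B)) \<longlonglongrightarrow> 0"
proof -
  have "(\<lambda>k. real (Suc k) powr (\<alpha> - dimn)) \<longlonglongrightarrow> 0"
    using dimn by (intro tendsto_neg_powr filterlim_compose[OF filterlim_real_sequentially filterlim_Suc]) auto
  then have "(\<lambda>k. ennreal (M * real (Suc k) powr (\<alpha> - dimn) * B)) \<longlonglongrightarrow> ennreal (M * 0 * B)"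
    by (intro tendsto_ennrealI tendsto_intros)
  then have "(\<lambda>k. c * ennreal (M * real (Suc k) powr (\<alpha> - dimn) * B)) \<longlonglongrightarrow> c * ennreal (M * 0 * B)"
    using assms by (intro ennreal_tendsto_cmult) (auto simp: less_top)
  then show ?thesis by simp
qed

text \<open>The majorant \<open>K * \<rho>\<close> lets the sweeping at scale \<open>N\<close> act
  on \<open>K\<close>, so \<open>v\<close> is swept away uniformly as \<open>N\<close>
  grows.\<close>

lemma conv_sweep_le_bound:
  assumes [measurable]: "v \<in> borel_measurable borel" and M: "M \<ge> 0"
    and v: "\<And>x. v x \<le> ennreal M * conv K \<rho> x" and N: "N > 0"
  shows "conv (sweep N) v x \<le> ennreal (M * N powr (\<alpha> - dimn) * B)"
proof -
  have "conv (sweep N) v x \<le> conv (sweep N) (\<lambda>x. ennreal M * conv K \<rho> x) x"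
    using v by (intro conv_mono) auto
  also have "\<dots> = ennreal M * conv (sweep N) (conv K \<rho>) x" by (rule conv_cmult_right) auto
  also have "conv (sweep N) (conv K \<rho>) = conv \<rho> (conv K (sweep N))"
    by (simp add: conv_assoc conv_commute[of "sweep N" K] conv_commute[of \<rho>])
       (simp add: conv_commute[of _ \<rho>] conv_assoc[symmetric])
  also have "conv \<rho> (conv K (sweep N)) x \<le> (\<integral>\<^sup>+ y. \<rho> y \<partial>lborel) * ennreal (N powr (\<alpha> - dimn) * B)"
    by (rule conv_le_const) (auto simp: conv_K_sweep_bound[OF N])
  finally show ?thesis using M B_nonneg
    by (simp add: rho_mass ennreal_mult mult_left_mono mult.assoc)
qed

text \<open>The identity below is formally the resolvent-type relation
  \<open>K * (v - \<rho>\<^sub>d * v) = (K - K * \<rho>\<^sub>d) * v\<close>; since \<open>K * v\<close> may be infinite, it is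
  obtained by replacing \<open>K\<close> with its integrable parts.\<close>

lemma conv_K_diff:
  assumes vm [measurable]: "v \<in> borel_measurable borel" and M: "M \<ge> 0"
    and v: "\<And>x. v x \<le> ennreal M * conv K \<rho> x" and d: "d > 0"
    and sup: "\<And>x. conv (sweep d) v x \<le> v x"
  shows "conv K (\<lambda>x. v x - conv (sweep d) v x) x = gap_mass d * conv (gap_density d) v x"
proof -
  define f where "f = (\<lambda>x. v x - conv (sweep d) v x)"
  have fm[measurable]: "f \<in> borel_measurable borel" unfolding f_def by measurable
  have vb: "v x \<le> ennreal (M * B)" for x
    using v[of x] mult_left_mono[OF conv_bound[of x, folded K_def], of "ennreal M"] M B_nonneg
    by (simp add: ennreal_mult)
  have vf: "v = (\<lambda>x. f x + conv (sweep d) v x)"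
    using sup by (auto simp: f_def fun_eq_iff diff_add_cancel_ennreal)
  \<comment> \<open>The relation with \<open>K\<close> replaced by its integrable part at scale
    \<open>N\<close>. It arises by convolving \<open>gap_density_add_conv\<close> with
    \<open>v\<close> and splitting \<open>v\<close> into \<open>f\<close> and its sweep; the term
    \<open>?c\<close> is finite because \<open>v\<close> is bounded. As \<open>N\<close> grows, the
    second summand on the left vanishes and the first recovers \<open>K * f\<close>.\<close>
  have key: "gap_mass N * conv (gap_density N) f x + gap_mass d * conv (gap_density d) (conv (sweep N) v) x = gap_mass d * conv (gap_density d) v x"
    if N: "N > 0" for N
  proof -
    let ?c = "gap_mass N * conv (gap_density N) (conv (sweep d) v) x"
    have "conv (gap_density N) (conv (sweep d) v) x \<le> (\<integral>\<^sup>+ y. gap_density N y \<partial>lborel) * ennreal (M * B)"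
      by (rule conv_le_const) (auto intro: order_trans[OF sup vb])
    then have "conv (gap_density N) (conv (sweep d) v) x < \<infinity>"
      using gap_density_mass[OF N] by (simp add: le_less_trans)
    then have fin: "?c \<noteq> \<infinity>" using gap_mass(3)[of N] by (simp add: ennreal_mult_eq_top_iff less_top[symmetric])
    have "conv (\<lambda>x. gap_mass N * gap_density N x + gap_mass d * conv (gap_density d) (sweep N) x) v x =
          conv (\<lambda>x. gap_mass d * gap_density d x + gap_mass N * conv (gap_density N) (sweep d) x) v x"
      using gap_density_add_conv[OF N d] by simp
    then have "gap_mass N * conv (gap_density N) v x + gap_mass d * conv (conv (gap_density d) (sweep N)) v x =
       gap_mass d * conv (gap_density d) v x + gap_mass N * conv (conv (gap_density N) (sweep d)) v x"
      by (simp add: conv_add_left conv_cmult_left)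
    then have "gap_mass N * conv (gap_density N) v x + gap_mass d * conv (gap_density d) (conv (sweep N) v) x = gap_mass d * conv (gap_density d) v x + ?c"
      by (simp add: conv_assoc)
    moreover have "conv (gap_density N) v x = conv (gap_density N) f x + conv (gap_density N) (conv (sweep d) v) x"
      by (subst vf) (rule conv_add_right, auto)
    ultimately have "?c + (gap_mass N * conv (gap_density N) f x + gap_mass d * conv (gap_density d) (conv (sweep N) v) x) = ?c + gap_mass d * conv (gap_density d) v x"
      by (simp add: distrib_left add_ac)
    then show ?thesis using fin by (simp add: ennreal_add_left_cancel)
  qed
  have key_Suc: "gap_mass (real (Suc k)) * conv (gap_density (real (Suc k))) f x + gap_mass d * conv (gap_density d) (conv (sweep (real (Suc k))) v) x
      = gap_mass d * conv (gap_density d) v x" for k by (rule key) simp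
  define e where "e = (\<lambda>k. gap_mass d * ennreal (M * real (Suc k) powr (\<alpha> - dimn) * B))"
  have e: "e \<longlonglongrightarrow> 0" unfolding e_def by (rule tendsto_scale_bound) (use gap_mass in auto)
  have "gap_mass d * conv (gap_density d) v x \<le> conv K f x + e k" for k
  proof -
    have "gap_mass (real (Suc k)) * conv (gap_density (real (Suc k))) f x = conv (\<lambda>x. gap_mass (real (Suc k)) * gap_density (real (Suc k)) x) f x"
      by (simp add: conv_cmult_left)
    also have "\<dots> \<le> conv K f x" by (intro conv_mono gap_mass_gap_density_le) auto
    finally have 1: "gap_mass (real (Suc k)) * conv (gap_density (real (Suc k))) f x \<le> conv K f x" .
    have "conv (gap_density d) (conv (sweep (real (Suc k))) v) x \<le> (\<integral>\<^sup>+ y. gap_density d y \<partial>lborel) * ennreal (M * real (Suc k) powr (\<alpha> - dimn) * B)"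
      by (intro conv_le_const gap_density_meas conv_sweep_le_bound vm M v) auto
    then have 2: "gap_mass d * conv (gap_density d) (conv (sweep (real (Suc k))) v) x \<le> e k"
      unfolding e_def using gap_density_mass[OF d] by (intro mult_left_mono) auto
    show ?thesis unfolding key_Suc[of k, symmetric] using 1 2
      by (intro add_mono) simp_all
  qed
  then have "gap_mass d * conv (gap_density d) v x \<le> liminf (\<lambda>k. conv K f x)" using e by (rule le_liminf_of_le_add)
  then have le: "gap_mass d * conv (gap_density d) v x \<le> conv K f x" by (simp add: Liminf_const)
  \<comment> \<open>The truncated kernels recover \<open>K\<close> up to a uniform error tending to
    0; together with Fatou this gives the upper bound for \<open>K * f\<close>.\<close>
  have Klim: "K y \<le> liminf (\<lambda>k. gap_mass (real (Suc k)) * gap_density (real (Suc k)) y)" for y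
  proof (rule le_liminf_of_le_add)
    show "K y \<le> gap_mass (real (Suc k)) * gap_density (real (Suc k)) y + 1 * ennreal (1 * real (Suc k) powr (\<alpha> - dimn) * B)" for k
      using K_split[of "real (Suc k)" y] conv_K_sweep_bound[of "real (Suc k)" y]
      by (simp del: of_nat_Suc)
    show "(\<lambda>k. 1 * ennreal (1 * real (Suc k) powr (\<alpha> - dimn) * B)) \<longlonglongrightarrow> 0" by (rule tendsto_scale_bound) simp
  qed
  have "conv K f x \<le> (\<integral>\<^sup>+ y. liminf (\<lambda>k. f y * (gap_mass (real (Suc k)) * gap_density (real (Suc k)) (x - y))) \<partial>lborel)"
    unfolding conv_def
  proof (intro nn_integral_mono)
    fix y
    have "K (x - y) * f y \<le> f y * liminf (\<lambda>k. gap_mass (real (Suc k)) * gap_density (real (Suc k)) (x - y))"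
      using Klim[of "x - y"] by (simp add: mult.commute mult_left_mono)
    also have "\<dots> \<le> liminf (\<lambda>k. f y * (gap_mass (real (Suc k)) * gap_density (real (Suc k)) (x - y)))" by (rule liminf_cmult_ennreal)
    finally show "K (x - y) * f y \<le> liminf (\<lambda>k. f y * (gap_mass (real (Suc k)) * gap_density (real (Suc k)) (x - y)))" .
  qed
  also have "\<dots> \<le> liminf (\<lambda>k. \<integral>\<^sup>+ y. f y * (gap_mass (real (Suc k)) * gap_density (real (Suc k)) (x - y)) \<partial>lborel)"
    by (rule nn_integral_liminf) measurable
  also have "\<dots> = liminf (\<lambda>k. gap_mass (real (Suc k)) * conv (gap_density (real (Suc k))) f x)"
    unfolding conv_def by (simp add: nn_integral_cmult[symmetric] mult_ac)
  also have "\<dots> \<le> liminf (\<lambda>k. gap_mass d * conv (gap_density d) v x)"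
  proof (intro Liminf_mono always_eventually allI)
    fix k show "gap_mass (real (Suc k)) * conv (gap_density (real (Suc k))) f x \<le> gap_mass d * conv (gap_density d) v x"
      unfolding key_Suc[of k, symmetric] by simp
  qed
  also have "\<dots> = gap_mass d * conv (gap_density d) v x" by (simp add: Liminf_const)
  finally show ?thesis using le by (simp add: f_def)
qed


text \<open>Cauchy-Schwarz for the charge whose potential is \<open>v\<close> smoothed by
  \<open>gap_density d\<close>, tested against \<open>\<nu>\<close> and its sweep. The bound depends
  on \<open>v\<close> only through \<open>M\<close>, so it is uniform over all functions below
  \<open>M\<close> times \<open>K * \<rho>\<close>.\<close>

lemma energy_estimate_aux:
  assumes vm [measurable]: "v \<in> borel_measurable borel" and M: "M \<ge> 0"
    and v: "\<And>x. v x \<le> ennreal M * conv K \<rho> x" and d: "d > 0"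
    and sup: "\<And>x. conv (sweep d) v x \<le> v x"
    and nu: "prob_space \<nu>" and sn [measurable_cong]: "sets \<nu> = sets borel"
    and fin: "(\<integral>\<^sup>+ x. conv_measure K \<nu> x \<partial>\<nu>) < \<infinity>" and r: "r > 0" and s: "s > 0"
  shows "2 * (\<integral>\<^sup>+ x. conv (gap_density d) v x \<partial>\<nu>) + ennreal (1 / s) * (\<integral>\<^sup>+ x. conv (sweep r) (conv_measure K \<nu>) x \<partial>\<nu>)
    \<le> 2 * (\<integral>\<^sup>+ x. conv (sweep r) (conv (gap_density d) v) x \<partial>\<nu>) + (ennreal s * ennreal (M * M * B)
       + ennreal (1 / s) * (\<integral>\<^sup>+ x. conv_measure K \<nu> x \<partial>\<nu>))"
proof -
  interpret nu: prob_space \<nu> by fact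
  have nusf: "sigma_finite_measure \<nu>" by (rule nu.sigma_finite_measure_axioms)
  have cb: "conv K \<rho> x \<le> ennreal B" for x using conv_bound[of x] by (simp add: K_def)
  have vb: "v x \<le> ennreal (M * B)" for x
    using v[of x] mult_left_mono[OF cb[of x], of "ennreal M"] M B_nonneg
    by (simp add: ennreal_mult)
  define f where "f = (\<lambda>x. (v x - conv (sweep d) v x) / gap_mass d)"
  have fm[measurable]: "f \<in> borel_measurable borel" unfolding f_def by measurable
  \<comment> \<open>By \<open>conv_K_diff\<close> this positive charge has
    \<open>gap_density d\<close> convolved with \<open>v\<close> as its potential; the sweeping
    inequality for \<open>v\<close> makes it positive.\<close>
  define l where "l = density lborel f"
  have sl[measurable_cong]: "sets l = sets borel" by (simp add: l_def)
  have "f x \<noteq> \<infinity>" for x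
  proof -
    have "v x - conv (sweep d) v x \<le> ennreal (M * B)" using vb[of x] by (metis diff_le_self_ennreal order_trans)
    then have "v x - conv (sweep d) v x < \<infinity>" by (simp add: le_less_trans)
    then show ?thesis using gap_mass[of d] d by (auto simp: f_def ennreal_divide_eq_top_iff)
  qed
  then have lsf: "sigma_finite_measure l" unfolding l_def
    by (subst sigma_finite_measure.sigma_finite_iff_density_finite[OF sigma_finite_lborel]) auto
  define V where "V = conv (gap_density d) v"
  have Vm[measurable]: "V \<in> borel_measurable borel" by (simp add: V_def)
  have V: "conv_measure K l = V"
  proof
    fix x
    have "conv_measure K l x = conv K f x" by (simp add: l_def conv_eq_conv_measure)
    also have "\<dots> = conv K (\<lambda>x. v x - conv (sweep d) v x) x / gap_mass d"
      unfolding conv_def f_def by (subst nn_integral_divide[symmetric]) (auto simp: ennreal_times_divide)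
    also have "\<dots> = V x" unfolding conv_K_diff[OF vm M v d sup] V_def
      using gap_mass[of d] d by (simp add: ennreal_mult_divide_eq mult.commute[of "gap_mass d"])
    finally show "conv_measure K l x = V x" .
  qed
  have Vb: "V x \<le> ennreal (M * B)" for x
    using conv_le_const[of "gap_density d" v "ennreal (M * B)" x] vb gap_density_mass[OF d] by (simp add: V_def)
  define \<nu>' where "\<nu>' = density lborel (conv_measure (sweep r) \<nu>)"
  have rm[measurable]: "conv_measure (sweep r) \<nu> \<in> borel_measurable borel"
    using nusf sn by (intro measurable_conv_measure) auto
  have Km[measurable]: "conv_measure K \<nu> \<in> borel_measurable borel"
    using nusf sn by (intro measurable_conv_measure) auto
  have sn'[measurable_cong]: "sets \<nu>' = sets borel" by (simp add: \<nu>'_def)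
  have dual: "(\<integral>\<^sup>+ x. h x \<partial>\<nu>') = (\<integral>\<^sup>+ x. conv (sweep r) h x \<partial>\<nu>)" if [measurable]: "h \<in> borel_measurable borel" for h
    unfolding \<nu>'_def using nusf sn by (subst nn_integral_density) (auto simp: nn_integral_conv_dual sweep_even)
  have "emeasure \<nu>' (space \<nu>') = (\<integral>\<^sup>+ x. 1 \<partial>\<nu>')" by simp
  also have "\<dots> = (\<integral>\<^sup>+ x. conv (sweep r) (\<lambda>_. 1) x \<partial>\<nu>)" by (rule dual) simp
  also have "\<dots> = (\<integral>\<^sup>+ x. 1 \<partial>\<nu>)" using sweep_mass[OF r] by (simp add: conv_def nn_integral_lborel_minus)
  also have "\<dots> = 1" by (simp add: nu.emeasure_space_1)
  finally interpret nu': prob_space \<nu>' by (rule prob_spaceI)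
  have nusf': "sigma_finite_measure \<nu>'" by (rule nu'.sigma_finite_measure_axioms)
  \<comment> \<open>\<open>e1\<close> is the mutual energy of \<open>\<nu>\<close> and
    \<open>\<nu>'\<close>. Sweeping decreases potentials, so the energy of \<open>\<nu>'\<close> is
    at most \<open>e1\<close>, and the squared norm of the difference is at most
    \<open>EN - e1\<close>; below, one of two copies of \<open>e1\<close> is cancelled
    accordingly.\<close>
  define e1 where "e1 = (\<integral>\<^sup>+ x. conv (sweep r) (conv_measure K \<nu>) x \<partial>\<nu>)"
  define EN where "EN = (\<integral>\<^sup>+ x. conv_measure K \<nu> x \<partial>\<nu>)"
  have E1: "(\<integral>\<^sup>+ x. conv_measure K \<nu> x \<partial>\<nu>') = e1" by (simp add: dual e1_def)
  have Kle: "conv (sweep r) (conv_measure K \<nu>) x \<le> conv_measure K \<nu> x" for x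
    using nusf sn by (simp add: conv_conv_measure conv_commute[of "sweep r"] )
      (auto simp: conv_measure_def intro!: nn_integral_mono conv_K_sweep_le r)
  have "e1 \<le> EN" unfolding e1_def EN_def by (intro nn_integral_mono Kle)
  then have e1: "e1 \<noteq> \<infinity>" using fin by (auto simp: EN_def top_unique)
  have "conv_measure K \<nu>' = conv K (conv_measure (sweep r) \<nu>)" by (simp add: \<nu>'_def conv_eq_conv_measure)
  also have "\<dots> = conv (sweep r) (conv_measure K \<nu>)"
    using nusf sn by (simp add: conv_conv_measure conv_commute[of "sweep r"])
  finally have "(\<integral>\<^sup>+ x. conv_measure K \<nu>' x \<partial>\<nu>') \<le> (\<integral>\<^sup>+ x. conv_measure K \<nu> x \<partial>\<nu>')"
    by (auto intro!: nn_integral_mono Kle)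
  then have E2: "(\<integral>\<^sup>+ x. conv_measure K \<nu>' x \<partial>\<nu>') \<le> e1" by (simp add: E1)
  \<comment> \<open>In the energy of \<open>l\<close> the potential is first replaced by its
    majorant, which has a density of mass \<open>M\<close>; after exchanging the roles by symmetry,
    the potential of \<open>l\<close> is bounded by the constant \<open>M * B\<close>. Hence no
    dependence on \<open>d\<close>.\<close>
  have E3: "(\<integral>\<^sup>+ x. V x \<partial>l) \<le> ennreal (M * M * B)"
  proof -
    have "(\<integral>\<^sup>+ x. V x \<partial>l) \<le> (\<integral>\<^sup>+ x. ennreal M * conv K (conv (gap_density d) \<rho>) x \<partial>l)"
    proof (intro nn_integral_mono)
      fix x
      have "V x \<le> conv (gap_density d) (\<lambda>x. ennreal M * conv K \<rho> x) x" unfolding V_def by (intro conv_mono v) auto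
      also have "\<dots> = ennreal M * conv K (conv (gap_density d) \<rho>) x"
        by (simp add: conv_cmult_right conv_assoc conv_commute[of "gap_density d" K])
      finally show "V x \<le> ennreal M * conv K (conv (gap_density d) \<rho>) x" .
    qed
    also have "\<dots> = ennreal M * (\<integral>\<^sup>+ x. conv K (conv (gap_density d) \<rho>) x \<partial>l)" by (rule nn_integral_cmult) measurable
    also have "(\<integral>\<^sup>+ x. conv K (conv (gap_density d) \<rho>) x \<partial>l) = (\<integral>\<^sup>+ x. V x * conv (gap_density d) \<rho> x \<partial>lborel)"
      using lsf sl by (subst nn_integral_conv_dual) (auto simp: V K_even)
    also have "\<dots> \<le> (\<integral>\<^sup>+ x. ennreal (M * B) * conv (gap_density d) \<rho> x \<partial>lborel)"
      by (intro nn_integral_mono mult_right_mono Vb) auto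
    also have "\<dots> = ennreal (M * B)"
      using gap_density_mass[OF d] by (simp add: nn_integral_cmult nn_integral_conv rho_mass)
    finally show ?thesis using M B_nonneg by (simp add: ennreal_mult mult_left_mono mult.assoc)
  qed
  have "2 * (\<integral>\<^sup>+ x. V x \<partial>\<nu>) + ennreal (2 / s) * e1
     \<le> 2 * (\<integral>\<^sup>+ x. V x \<partial>\<nu>') + ennreal s * (\<integral>\<^sup>+ x. V x \<partial>l) + ennreal (1 / s) * (EN + (\<integral>\<^sup>+ x. conv_measure K \<nu>' x \<partial>\<nu>'))"
    using posdef[OF s lsf sl nusf sn nusf' sn'] by (simp add: K_def[symmetric] V E1 EN_def)
  also have "\<dots> \<le> 2 * (\<integral>\<^sup>+ x. V x \<partial>\<nu>') + ennreal s * ennreal (M * M * B) + ennreal (1 / s) * (EN + e1)"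
    using E2 E3 by (intro add_mono mult_left_mono) auto
  finally have le: "2 * (\<integral>\<^sup>+ x. V x \<partial>\<nu>) + ennreal (2 / s) * e1
     \<le> 2 * (\<integral>\<^sup>+ x. V x \<partial>\<nu>') + ennreal s * ennreal (M * M * B) + ennreal (1 / s) * (EN + e1)" .
  have "ennreal (2 / s) = ennreal (1 / s) + ennreal (1 / s)" using s by (simp add: ennreal_plus[symmetric] del: ennreal_plus)
  with le have "ennreal (1 / s) * e1 + (2 * (\<integral>\<^sup>+ x. V x \<partial>\<nu>) + ennreal (1 / s) * e1)
     \<le> ennreal (1 / s) * e1 + (2 * (\<integral>\<^sup>+ x. V x \<partial>\<nu>') + (ennreal s * ennreal (M * M * B) + ennreal (1 / s) * EN))"
    by (simp add: distrib_left distrib_right add_ac)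
  then have "2 * (\<integral>\<^sup>+ x. V x \<partial>\<nu>) + ennreal (1 / s) * e1
     \<le> 2 * (\<integral>\<^sup>+ x. V x \<partial>\<nu>') + (ennreal s * ennreal (M * M * B) + ennreal (1 / s) * EN)"
    using e1 by (simp add: ennreal_add_left_cancel_le ennreal_mult_eq_top_iff)
  then show ?thesis by (simp add: dual V_def e1_def EN_def)
qed

text \<open>The limit of the previous estimate as \<open>d\<close> tends to 0. Fatou gives the wrong
  direction for the swept term on the right, so that term is replaced by its complement to a
  constant and moved to the left.\<close>

lemma energy_estimate:
  assumes vm [measurable]: "v \<in> borel_measurable borel" and lsc: "lsc v" and M: "M \<ge> 0"
    and v: "\<And>x. v x \<le> ennreal M * conv K \<rho> x"
    and sup: "\<And>x d. d > 0 \<Longrightarrow> conv (sweep d) v x \<le> v x"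
    and nu: "prob_space \<nu>" and sn [measurable_cong]: "sets \<nu> = sets borel"
    and fin: "(\<integral>\<^sup>+ x. conv_measure K \<nu> x \<partial>\<nu>) < \<infinity>" and r: "r > 0" and s: "s > 0"
  shows "2 * (\<integral>\<^sup>+ x. v x \<partial>\<nu>) + ennreal (1 / s) * (\<integral>\<^sup>+ x. conv (sweep r) (conv_measure K \<nu>) x \<partial>\<nu>)
    \<le> 2 * (\<integral>\<^sup>+ x. conv (sweep r) v x \<partial>\<nu>) + (ennreal s * ennreal (M * M * B)
       + ennreal (1 / s) * (\<integral>\<^sup>+ x. conv_measure K \<nu> x \<partial>\<nu>))" (is "2 * ?v + ?e \<le> 2 * ?rv + ?R")
proof -
  interpret nu: prob_space \<nu> by fact
  have cb: "conv K \<rho> x \<le> ennreal B" for x using conv_bound[of x] by (simp add: K_def)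
  define C where "C = ennreal (M * B)"
  have vb: "v x \<le> C" for x
    using v[of x] mult_left_mono[OF cb[of x], of "ennreal M"] M B_nonneg
    by (simp add: ennreal_mult C_def)
  have const: "conv h (\<lambda>_. C) x = C" if [measurable]: "h \<in> borel_measurable borel" and "(\<integral>\<^sup>+ y. h y \<partial>lborel) = 1" for h x
    using that by (simp add: conv_def nn_integral_multc nn_integral_lborel_minus)
  define u where "u = (\<lambda>x. C - v x)"
  have um[measurable]: "u \<in> borel_measurable borel" unfolding u_def by measurable
  have uv: "(\<lambda>x. v x + u x) = (\<lambda>_. C)" using vb by (auto simp: u_def fun_eq_iff add_diff_inverse_ennreal)
  \<comment> \<open>Up to the constant \<open>C\<close>, this is \<open>v\<close> minus its sweep.
    Both summands are lower semicontinuous, the second one although \<open>u\<close> is not, because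
    the sweeping density is; thus Fatou applies to \<open>q\<close> as a whole.\<close>
  define q where "q = (\<lambda>x. v x + conv (sweep r) u x)"
  have qm[measurable]: "q \<in> borel_measurable borel" unfolding q_def by measurable
  have qlsc: "lsc q" unfolding q_def by (intro lsc_add lsc lsc_conv lsc_sweep) auto
  define d where "d = (\<lambda>k. 1 / real (Suc k))"
  have d: "d k > 0" "d \<longlonglongrightarrow> 0" for k unfolding d_def using LIMSEQ_inverse_real_of_nat by (auto simp: divide_inverse)
  have bound: "2 * (\<integral>\<^sup>+ x. conv (gap_density (d k)) q x \<partial>\<nu>) + ?e \<le> 2 * C + ?R" for k
  proof -
    let ?g = "gap_density (d k)"
    have eqC: "conv (sweep r) (conv ?g v) x + conv (sweep r) (conv ?g u) x = C" for x
    proof -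
      have "conv (sweep r) (conv ?g v) x + conv (sweep r) (conv ?g u) x = conv (sweep r) (\<lambda>x. conv ?g v x + conv ?g u x) x"
        by (simp add: conv_add_right)
      also have "(\<lambda>x. conv ?g v x + conv ?g u x) = conv ?g (\<lambda>x. v x + u x)" by (auto simp: conv_add_right fun_eq_iff)
      also have "\<dots> = (\<lambda>_. C)" unfolding uv using gap_density_mass[OF d(1)] by (simp add: const fun_eq_iff)
      finally show ?thesis using sweep_mass[OF r] by (simp add: const)
    qed
    have "conv ?g q x = conv ?g v x + conv (sweep r) (conv ?g u) x" for x
      unfolding q_def by (simp add: conv_add_right conv_left_commute[of ?g "sweep r"])
    then have "(\<integral>\<^sup>+ x. conv ?g q x \<partial>\<nu>) = (\<integral>\<^sup>+ x. conv ?g v x \<partial>\<nu>) + (\<integral>\<^sup>+ x. conv (sweep r) (conv ?g u) x \<partial>\<nu>)"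
      by (simp add: nn_integral_add)
    then have "2 * (\<integral>\<^sup>+ x. conv ?g q x \<partial>\<nu>) + ?e = (2 * (\<integral>\<^sup>+ x. conv ?g v x \<partial>\<nu>) + ?e) + 2 * (\<integral>\<^sup>+ x. conv (sweep r) (conv ?g u) x \<partial>\<nu>)"
      by (simp add: distrib_left add_ac)
    also have "\<dots> \<le> (2 * (\<integral>\<^sup>+ x. conv (sweep r) (conv ?g v) x \<partial>\<nu>) + ?R) + 2 * (\<integral>\<^sup>+ x. conv (sweep r) (conv ?g u) x \<partial>\<nu>)"
      by (intro add_right_mono energy_estimate_aux vm M v d sup nu sn fin r s)
    also have "\<dots> = 2 * (\<integral>\<^sup>+ x. conv (sweep r) (conv ?g v) x + conv (sweep r) (conv ?g u) x \<partial>\<nu>) + ?R"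
      by (simp add: nn_integral_add distrib_left add_ac)
    finally show ?thesis by (simp add: eqC nu.emeasure_space_1)
  qed
  have "(\<integral>\<^sup>+ x. q x \<partial>\<nu>) \<le> (\<integral>\<^sup>+ x. liminf (\<lambda>k. conv (gap_density (d k)) q x) \<partial>\<nu>)"
    unfolding gap_density_def by (intro nn_integral_mono lsc_le_liminf_conv_dilate qlsc gG_mass d) auto
  also have "\<dots> \<le> liminf (\<lambda>k. \<integral>\<^sup>+ x. conv (gap_density (d k)) q x \<partial>\<nu>)" by (rule nn_integral_liminf) measurable
  finally have q1: "(\<integral>\<^sup>+ x. q x \<partial>\<nu>) \<le> liminf (\<lambda>k. \<integral>\<^sup>+ x. conv (gap_density (d k)) q x \<partial>\<nu>)" .
  have "2 * (\<integral>\<^sup>+ x. q x \<partial>\<nu>) + ?e \<le> liminf (\<lambda>k. 2 * (\<integral>\<^sup>+ x. conv (gap_density (d k)) q x \<partial>\<nu>)) + liminf (\<lambda>k. ?e)"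
    using mult_left_mono[OF q1, of 2] by (intro add_mono order_trans[OF _ liminf_cmult_ennreal]) (auto simp: Liminf_const)
  also have "\<dots> \<le> liminf (\<lambda>k. 2 * (\<integral>\<^sup>+ x. conv (gap_density (d k)) q x \<partial>\<nu>) + ?e)" by (rule liminf_add_ennreal)
  also have "\<dots> \<le> liminf (\<lambda>k::nat. 2 * C + ?R)" using bound by (intro Liminf_mono always_eventually) auto
  also have "\<dots> = 2 * C + ?R" by (simp add: Liminf_const)
  finally have *: "2 * (\<integral>\<^sup>+ x. q x \<partial>\<nu>) + ?e \<le> 2 * C + ?R" .
  let ?ru = "\<integral>\<^sup>+ x. conv (sweep r) u x \<partial>\<nu>"
  have "C = (\<integral>\<^sup>+ x. C \<partial>\<nu>)" by (simp add: nu.emeasure_space_1)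
  also have "\<dots> = (\<integral>\<^sup>+ x. conv (sweep r) (\<lambda>x. v x + u x) x \<partial>\<nu>)" unfolding uv using sweep_mass[OF r] by (simp add: const)
  also have "\<dots> = ?rv + ?ru" by (simp add: conv_add_right nn_integral_add)
  finally have C: "C = ?rv + ?ru" .
  then have "?ru \<noteq> \<infinity>" by (auto simp: C_def)
  moreover have "2 * ?ru + (2 * ?v + ?e) \<le> 2 * ?ru + (2 * ?rv + ?R)"
    using * unfolding q_def C by (simp add: nn_integral_add distrib_left add_ac)
  ultimately show ?thesis by (simp add: ennreal_add_left_cancel_le ennreal_mult_eq_top_iff)
qed

end

section \<open>Sets of inner capacity zero\<close>

text \<open>An infimum of finite energies is infinite only over the empty family, so vanishing inner
  capacity says that no test measure exists.\<close>

lemma inner_cap_zero_iff: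
  "inner_cap \<alpha> A = 0 \<longleftrightarrow>
    \<not> (\<exists>\<nu>. radon_pos \<nu> \<and> energy \<alpha> \<nu> < \<infinity> \<and> concentrated_on \<nu> A \<and> emeasure \<nu> UNIV = 1)"
proof -
  let ?S = "{\<nu>. radon_pos \<nu> \<and> energy \<alpha> \<nu> < \<infinity> \<and> concentrated_on \<nu> A \<and> emeasure \<nu> UNIV = 1}"
  have "inner_cap \<alpha> A = 0 \<longleftrightarrow> (INF \<nu>\<in>?S. energy \<alpha> \<nu>) = \<top>"
    by (simp add: inner_cap_def)
  also have "\<dots> \<longleftrightarrow> ?S = {}" by (auto simp: INF_top_conv)
  finally show ?thesis by auto
qed

lemma concentrated_on_mono: "concentrated_on \<nu> A \<Longrightarrow> A \<subseteq> B \<Longrightarrow> concentrated_on \<nu> B"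
  unfolding concentrated_on_def by blast

lemma inner_cap_zero_mono: "inner_cap \<alpha> B = 0 \<Longrightarrow> A \<subseteq> B \<Longrightarrow> inner_cap \<alpha> A = 0"
  unfolding inner_cap_zero_iff using concentrated_on_mono by blast

lemma radon_pos_sets: "radon_pos \<mu> \<Longrightarrow> sets \<mu> = sets borel" by (simp add: radon_pos_def)

lemma radon_pos_sigma_finite:
  assumes "radon_pos (\<mu> :: 'a::euclidean_space measure)" shows "sigma_finite_measure \<mu>"
proof
  have sp: "space \<mu> = UNIV" using assms sets_eq_imp_space_eq[of \<mu> borel] by (simp add: radon_pos_def)
  have "(\<Union>n. cball (0::'a) (real n)) = UNIV"
    by (auto simp: real_arch_simple)
  then show "\<exists>A. countable A \<and> A \<subseteq> sets \<mu> \<and> \<Union>A = space \<mu> \<and> (\<forall>a\<in>A. emeasure \<mu> a \<noteq> \<infinity>)"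
    using assms sp by (intro exI[of _ "range (\<lambda>n. cball (0::'a) (real n))"]) (auto simp: radon_pos_def less_top)
qed

text \<open>The normalized restriction to \<open>S\<close> is again a test measure: its energy grows
  at most by the factor \<open>1 / c\<close> twice.\<close>

lemma restrict_probability:
  fixes \<nu> :: "'a::euclidean_space measure"
  assumes rad: "radon_pos \<nu>" and en: "energy \<alpha> \<nu> < \<infinity>" and co: "concentrated_on \<nu> A"
    and one: "emeasure \<nu> UNIV = 1" and S: "S \<in> sets borel" and pos: "emeasure \<nu> S \<noteq> 0"
  shows "inner_cap \<alpha> (A \<inter> S) \<noteq> 0"
proof -
  note sn[measurable_cong] = radon_pos_sets[OF rad]
  note S[measurable]
  interpret sigma_finite_measure \<nu> by (rule radon_pos_sigma_finite[OF rad])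
  define c where "c = emeasure \<nu> S"
  have "c \<le> emeasure \<nu> UNIV" unfolding c_def using sn by (intro emeasure_mono) auto
  then have c: "c \<noteq> 0" "c \<noteq> \<infinity>" using pos one by (auto simp: c_def top_unique)
  define \<nu>' where "\<nu>' = density \<nu> (\<lambda>x. indicator S x / c)"
  have s': "sets \<nu>' = sets borel" by (simp add: \<nu>'_def sn)
  have int_le: "(\<integral>\<^sup>+ x. f x \<partial>\<nu>') \<le> (\<integral>\<^sup>+ x. f x \<partial>\<nu>) / c" if [measurable]: "f \<in> borel_measurable borel" for f
  proof -
    have "(\<integral>\<^sup>+ x. f x \<partial>\<nu>') = (\<integral>\<^sup>+ x. indicator S x / c * f x \<partial>\<nu>)"
      unfolding \<nu>'_def by (rule nn_integral_density) auto
    also have "\<dots> \<le> (\<integral>\<^sup>+ x. f x / c \<partial>\<nu>)"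
      by (intro nn_integral_mono) (auto simp: divide_ennreal_def mult.commute split: split_indicator)
    also have "\<dots> = (\<integral>\<^sup>+ x. f x \<partial>\<nu>) / c" by (rule nn_integral_divide) auto
    finally show ?thesis .
  qed
  have mass: "emeasure \<nu>' UNIV = 1"
  proof -
    have "emeasure \<nu>' UNIV = (\<integral>\<^sup>+ x. indicator S x / c \<partial>\<nu>)"
      unfolding \<nu>'_def using sn by (subst emeasure_density) auto
    also have "\<dots> = c / c" by (subst nn_integral_divide) (auto simp: c_def sn)
    finally show ?thesis using c by (simp add: ennreal_divide_self less_top[symmetric])
  qed
  have "radon_pos \<nu>'" unfolding radon_pos_def
  proof (intro conjI allI impI s')
    fix C :: "'a set"
    have "emeasure \<nu>' C \<le> emeasure \<nu>' UNIV" using s' by (intro emeasure_mono) auto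
    then show "emeasure \<nu>' C < \<infinity>" using mass by (simp add: le_less_trans)
  qed
  moreover have "energy \<alpha> \<nu>' < \<infinity>"
  proof -
    have m[measurable]: "(\<lambda>x. \<integral>\<^sup>+ y. riesz \<alpha> (x - y) \<partial>\<nu>) \<in> borel_measurable borel" by measurable
    have "energy \<alpha> \<nu>' = (\<integral>\<^sup>+ x. (\<integral>\<^sup>+ y. riesz \<alpha> (x - y) \<partial>\<nu>') \<partial>\<nu>')"
      by (simp add: energy_def mutual_energy_def riesz_kernel_eq_riesz)
    also have "\<dots> \<le> (\<integral>\<^sup>+ x. (\<integral>\<^sup>+ y. riesz \<alpha> (x - y) \<partial>\<nu>) / c \<partial>\<nu>')"
      by (intro nn_integral_mono int_le) auto
    also have "\<dots> \<le> (\<integral>\<^sup>+ x. (\<integral>\<^sup>+ y. riesz \<alpha> (x - y) \<partial>\<nu>) / c \<partial>\<nu>) / c"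
      by (intro int_le) auto
    also have "\<dots> = energy \<alpha> \<nu> / c / c"
      by (subst nn_integral_divide) (auto simp: energy_def mutual_energy_def riesz_kernel_eq_riesz)
    also have "\<dots> < \<infinity>" using c en by (simp add: divide_ennreal_def ennreal_mult_less_top less_top[symmetric] ennreal_mult_eq_top_iff ennreal_inverse_eq_top_iff)
    finally show ?thesis .
  qed
  moreover have "concentrated_on \<nu>' (A \<inter> S)"
  proof -
    obtain N where N: "N \<in> null_sets \<nu>" "UNIV - A \<subseteq> N" using co by (auto simp: concentrated_on_def)
    have Nb: "N \<in> sets borel" using N(1) sn by auto
    have "emeasure \<nu>' (N \<union> (UNIV - S)) = 0"
    proof -
      have "AE x in \<nu>. x \<notin> N" using N(1) by (rule AE_not_in)
      then have "AE x in \<nu>'. x \<notin> N \<union> (UNIV - S)" unfolding \<nu>'_def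
        by (subst AE_density) (auto split: split_indicator elim!: eventually_mono)
      then show ?thesis using Nb s' by (subst (asm) AE_iff_measurable[where N="N \<union> (UNIV - S)"])
         (auto simp: sets_eq_imp_space_eq[OF s'])
    qed
    then have "N \<union> (UNIV - S) \<in> null_sets \<nu>'" using Nb s' by auto
    then show ?thesis using N(2) unfolding concentrated_on_def by (intro bexI[of _ "N \<union> (UNIV - S)"]) auto
  qed
  ultimately show ?thesis using mass unfolding inner_cap_zero_iff not_not by (intro exI[of _ \<nu>']) simp
qed

text \<open>Inner capacity is not countably subadditive for arbitrary pieces, since a set and its
  complement may both be negligible for all test measures. Universal measurability provides a Borel
  core of \<open>U j\<close> up to a null set; a test measure on \<open>A\<close> charges one of the
  cores and can be restricted to it.\<close>

lemma inner_cap_zero_UN: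
  fixes U :: "nat \<Rightarrow> 'a::euclidean_space set"
  assumes U: "\<And>j. universally_measurable (U j)" and cov: "A \<subseteq> (\<Union>j. U j)"
    and z: "\<And>j. inner_cap \<alpha> (A \<inter> U j) = 0"
  shows "inner_cap \<alpha> A = 0"
  unfolding inner_cap_zero_iff
proof (rule notI, elim exE conjE)
  fix \<nu> :: "'a measure"
  assume nu: "radon_pos \<nu>" "energy \<alpha> \<nu> < \<infinity>" "concentrated_on \<nu> A" "emeasure \<nu> UNIV = 1"
  note sn = radon_pos_sets[OF nu(1)]
  obtain N where N: "N \<in> null_sets \<nu>" "UNIV - A \<subseteq> N" using nu(3) by (auto simp: concentrated_on_def)
  have "\<exists>S N'. S \<in> sets \<nu> \<and> N' \<in> null_sets \<nu> \<and> S \<subseteq> U j \<and> U j \<subseteq> S \<union> N'" for j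
  proof -
    have "U j \<in> sets (completion \<nu>)" using U nu(1) by (auto simp: universally_measurable_def)
    then obtain S N1 N' where "U j = S \<union> N1" "N1 \<subseteq> N'" "N' \<in> null_sets \<nu>" "S \<in> sets \<nu>"
      by (elim sets_completionE)
    then show ?thesis by blast
  qed
  then obtain S N' where SN: "\<And>j. S j \<in> sets \<nu>" "\<And>j. N' j \<in> null_sets \<nu>" "\<And>j. S j \<subseteq> U j" "\<And>j. U j \<subseteq> S j \<union> N' j"
    by metis
  have "emeasure \<nu> (S j) = 0" for j
  proof (rule ccontr)
    assume "emeasure \<nu> (S j) \<noteq> 0"
    then have "inner_cap \<alpha> (A \<inter> S j) \<noteq> 0" using restrict_probability[OF nu, of "S j"] SN(1)[of j] sn by auto
    moreover have "inner_cap \<alpha> (A \<inter> S j) = 0" using z[of j] by (rule inner_cap_zero_mono) (use SN in auto)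
    ultimately show False by simp
  qed
  then have "S j \<in> null_sets \<nu>" for j using SN by auto
  then have "N \<union> (\<Union>j. S j \<union> N' j) \<in> null_sets \<nu>"
    using N SN by (intro null_sets.Un null_sets_UN) auto
  moreover have "UNIV \<subseteq> N \<union> (\<Union>j. S j \<union> N' j)" using N(2) cov SN(4) by blast
  ultimately have "UNIV \<in> null_sets \<nu>" by (metis top.extremum_unique)
  then show False using nu(4) by (auto simp: null_sets_def)
qed

lemma universally_measurable_borel: "S \<in> sets borel \<Longrightarrow> universally_measurable S"
  unfolding universally_measurable_def using radon_pos_sets by (metis sets_completionI_sets)

text \<open>Choquet's topological lemma: a countable subfamily has the same lower semicontinuous
  minorants as the whole family, although its pointwise infimum may be larger.\<close>

lemma choquet_countable:
  fixes F :: "('a::euclidean_space \<Rightarrow> ennreal) set"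
  assumes ne: "F \<noteq> {}"
  obtains f :: "nat \<Rightarrow> 'a \<Rightarrow> ennreal" where "range f \<subseteq> F"
    "\<forall>h g x. lsc h \<longrightarrow> (\<forall>j x. h x \<le> f j x) \<longrightarrow> g \<in> F \<longrightarrow> h x \<le> g x"
proof -
  obtain Bs :: "'a set set" where Bs: "countable Bs" "topological_basis Bs"
    using ex_countable_basis by blast
  \<comment> \<open>On each basic open set countably many members attain the infimum. Lower
    semicontinuity makes \<open>h\<close> exceed \<open>a\<close> on a whole basic set, so the
    selected members, and with them all of \<open>F\<close>, are at least \<open>a\<close>
    there.\<close>
  have "\<exists>f. range f \<subseteq> F \<and> (INF g\<in>F. INF y\<in>V. g y) = (INF i::nat. INF y\<in>V. f i y)" for V
  proof -
    have "(\<lambda>g. INF y\<in>V. g y) ` F \<noteq> {}" using ne by auto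
    from ennreal_Inf_countable_INF[OF this] obtain a :: "nat \<Rightarrow> ennreal"
      where a: "range a \<subseteq> (\<lambda>g. INF y\<in>V. g y) ` F" "Inf ((\<lambda>g. INF y\<in>V. g y) ` F) = (INF i. a i)"
      by auto
    then have "\<forall>i. \<exists>g\<in>F. a i = (INF y\<in>V. g y)" by (auto simp: image_iff subset_eq)
    then obtain f where "\<And>i. f i \<in> F \<and> a i = (INF y\<in>V. f i y)" by metis
    then show ?thesis using a(2) by (intro exI[of _ f]) auto
  qed
  then obtain fs where fs: "\<And>V. range (fs V) \<subseteq> F" "\<And>V. (INF g\<in>F. INF y\<in>V. g y) = (INF i::nat. INF y\<in>V. fs V i y)"
    by metis
  obtain g0 where g0: "g0 \<in> F" using ne by auto
  define F' where "F' = insert g0 (\<Union>V\<in>Bs. range (fs V))"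
  have F': "countable F'" "F' \<noteq> {}" "F' \<subseteq> F" using Bs(1) fs(1) g0 by (auto simp: F'_def)
  define f where "f = from_nat_into F'"
  have rf: "range f = F'" unfolding f_def using F' by (simp add: range_from_nat_into)
  show ?thesis
  proof (rule that[of f], use rf F' in simp, intro allI impI)
    fix h g and x :: 'a
    assume h: "lsc h" and le': "\<forall>j x. h x \<le> f j x" and g: "g \<in> F"
    have le: "h x \<le> f j x" for j x using le' by blast
    show "h x \<le> g x"
    proof (rule dense_le)
      fix a assume a: "a < h x"
      have "\<exists>e>0. \<forall>y\<in>ball x e. a < h y"
      proof (rule ccontr)
        assume "\<not> ?thesis"
        then have "\<forall>k. \<exists>y. y \<in> ball x (1 / real (Suc k)) \<and> h y \<le> a"
          by (metis not_le of_nat_0_less_iff zero_less_Suc zero_less_divide_1_iff)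
        then obtain X where X: "\<And>k. X k \<in> ball x (1 / real (Suc k))" "\<And>k. h (X k) \<le> a" by metis
        have "(\<lambda>k. dist (X k) x) \<longlonglongrightarrow> 0"
        proof (rule tendsto_sandwich[OF _ _ tendsto_const LIMSEQ_inverse_real_of_nat])
          show "eventually (\<lambda>k. dist (X k) x \<le> inverse (real (Suc k))) sequentially"
            using X(1) by (intro always_eventually allI) (metis dist_commute inverse_eq_divide less_imp_le mem_ball)
        qed auto
        then have "X \<longlonglongrightarrow> x" using tendsto_dist_iff by blast
        then have "h x \<le> liminf (\<lambda>k. h (X k))" by (rule lscD[OF h])
        also have "\<dots> \<le> liminf (\<lambda>k::nat. a)" using X(2) by (intro Liminf_mono) auto
        finally show False using a by (simp add: Liminf_const)
      qed
      then obtain e where e: "e > 0" "\<And>y. y \<in> ball x e \<Longrightarrow> a < h y" by auto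
      obtain V where V: "V \<in> Bs" "x \<in> V" "V \<subseteq> ball x e"
        using topological_basisE[OF Bs(2), of "ball x e" x] e(1) by auto
      have "a \<le> fs V i y" if "y \<in> V" for i y
      proof -
        have "fs V i \<in> range f" using V(1) by (auto simp: rf F'_def)
        then obtain j where "fs V i = f j" by auto
        then show ?thesis using le[of y j] e(2)[of y] V(3) that by (simp add: subset_eq)
      qed
      then have "a \<le> (INF i. INF y\<in>V. fs V i y)" by (intro INF_greatest)
      also have "\<dots> = (INF g\<in>F. INF y\<in>V. g y)" by (rule fs(2)[symmetric])
      also have "\<dots> \<le> (INF y\<in>V. g y)" using g by (rule INF_lower)
      also have "\<dots> \<le> g x" using V(2) by (rule INF_lower)
      finally show "a \<le> g x" .
    qed
  qed
qed

text \<open>The countable family is not monotone. Finite minima keep lower semicontinuity and the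
  sweeping inequality and give a decreasing sequence with the same infimum.\<close>

primrec run_min :: "(nat \<Rightarrow> 'a \<Rightarrow> ennreal) \<Rightarrow> nat \<Rightarrow> 'a \<Rightarrow> ennreal" where
  "run_min f 0 = f 0"
| "run_min f (Suc j) = (\<lambda>x. min (run_min f j x) (f (Suc j) x))"

lemma run_min_le: "i \<le> j \<Longrightarrow> run_min f j x \<le> f i x"
  by (induction j) (auto simp: le_Suc_eq min.coboundedI1)

lemma INF_run_min: "(INF j. run_min f j x) = (INF j. f j x)"
proof (rule antisym)
  show "(INF j. run_min f j x) \<le> (INF j. f j x)" by (intro INF_mono) (auto intro: run_min_le)
  have "(INF j. f j x) \<le> run_min f i x" for i by (induction i) (auto intro: INF_lower)
  then show "(INF j. f j x) \<le> (INF j. run_min f j x)" by (intro INF_greatest)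
qed

lemma decseq_run_min: "decseq (\<lambda>j. run_min f j x)" by (rule decseq_SucI) simp

section \<open>Infimum and regularization with respect to measures of finite energy\<close>

context sweeping
begin

lemma energy_eq: "energy \<alpha> \<nu> = (\<integral>\<^sup>+ x. conv_measure K \<nu> x \<partial>\<nu>)" for \<nu> :: "'a measure"
  by (simp add: energy_def mutual_energy_def riesz_kernel_eq_riesz conv_measure_def K_def)

lemma potential_measurable: "radon_pos \<eta> \<Longrightarrow> conv_measure K \<eta> \<in> borel_measurable borel"
  by (intro measurable_conv_measure radon_pos_sigma_finite radon_pos_sets K_meas)

lemma conv_sweep_potential_le:
  assumes "sigma_finite_measure \<eta>" "sets \<eta> = sets borel" "r > 0"
  shows "conv (sweep r) (conv_measure K \<eta>) x \<le> conv_measure K \<eta> x"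
proof -
  have "conv (sweep r) (conv_measure K \<eta>) x = conv_measure (conv K (sweep r)) \<eta> x"
    using assms by (simp add: conv_conv_measure conv_commute[of "sweep r"])
  also have "\<dots> \<le> conv_measure K \<eta> x"
    using assms by (auto simp: conv_measure_def intro!: nn_integral_mono conv_K_sweep_le)
  finally show ?thesis .
qed

lemma lsc_potential: "sets \<eta> = sets borel \<Longrightarrow> lsc (conv_measure K \<eta>)"
  by (intro lsc_conv_measure lsc_K K_meas)

text \<open>A bounded, strictly positive potential of a probability density. Its multiples serve as
  truncation levels that satisfy the sweeping inequality and the majorant condition of the energy
  estimate at once.\<close>

definition swept_kernel :: "'a \<Rightarrow> ennreal" where "swept_kernel = conv K \<rho>"

lemma swept_kernel_meas [measurable]: "swept_kernel \<in> borel_measurable borel" by (simp add: swept_kernel_def)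

lemma swept_kernel_le: "swept_kernel x \<le> ennreal B" using conv_bound by (simp add: swept_kernel_def K_def)

lemma swept_kernel_pos: "swept_kernel x \<noteq> 0"
proof
  assume "swept_kernel x = 0"
  then have "(\<integral>\<^sup>+ y. K (x - y) * \<rho> y \<partial>lborel) = 0" by (simp add: swept_kernel_def conv_def)
  then have "AE y in lborel. K (x - y) * \<rho> y = 0" by (subst (asm) nn_integral_0_iff_AE) auto
  then have "AE y in lborel. \<rho> y = 0" by eventually_elim (auto simp: K_def riesz_eq split: if_splits)
  then have "(\<integral>\<^sup>+ y. \<rho> y \<partial>lborel) = 0" by (subst nn_integral_0_iff_AE) auto
  then show False by (simp add: rho_mass)
qed

lemma rho_sigma_finite: "sigma_finite_measure (density lborel \<rho>)"
proof -
  have "prob_space (density lborel \<rho>)" by (rule prob_spaceI) (simp add: emeasure_density rho_mass)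
  then show ?thesis by (simp add: prob_space_def finite_measure_def)
qed

lemma swept_kernel_eq: "swept_kernel = conv_measure K (density lborel \<rho>)" by (simp add: swept_kernel_def conv_eq_conv_measure)

lemma conv_sweep_swept_kernel: "r > 0 \<Longrightarrow> conv (sweep r) swept_kernel x \<le> swept_kernel x"
  unfolding swept_kernel_eq by (rule conv_sweep_potential_le[OF rho_sigma_finite]) auto

lemma lsc_swept_kernel: "lsc swept_kernel" unfolding swept_kernel_eq by (rule lsc_potential) simp

lemma conv_sweep_min:
  assumes "\<And>x. conv (sweep r) u x \<le> u x" "\<And>x. conv (sweep r) v x \<le> v x"
  shows "conv (sweep r) (\<lambda>x. min (u x) (v x)) x \<le> min (u x) (v x)"
  using order_trans[OF conv_mono[of "sweep r" "sweep r" "\<lambda>x. min (u x) (v x)" u x] assms(1)]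
    order_trans[OF conv_mono[of "sweep r" "sweep r" "\<lambda>x. min (u x) (v x)" v x] assms(2)] by simp

text \<open>The energy estimate for truncated finite minima is passed to the limit in three
  parameters: the index of the minimum, then \<open>r\<close> to 0, then \<open>s\<close> to 0. What
  remains is that the integral of the truncated infimum is at most that of its minimum with
  \<open>u\<close>.\<close>

lemma infimum_le_regularization_AE:
  fixes f :: "nat \<Rightarrow> 'a \<Rightarrow> ennreal"
  assumes fm[measurable]: "\<And>j. f j \<in> borel_measurable borel" and fl: "\<And>j. lsc (f j)"
    and fs: "\<And>j r x. r > 0 \<Longrightarrow> conv (sweep r) (f j) x \<le> f j x"
    and um[measurable]: "u \<in> borel_measurable borel"
    and u: "\<And>r x. r > 0 \<Longrightarrow> conv (sweep r) (\<lambda>x. INF j. f j x) x \<le> u x"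
    and nu: "prob_space \<nu>" and sn[measurable_cong]: "sets \<nu> = sets borel"
    and fin: "(\<integral>\<^sup>+ x. conv_measure K \<nu> x \<partial>\<nu>) < \<infinity>"
  shows "AE x in \<nu>. (INF j. f j x) \<le> u x"
proof -
  interpret nu: prob_space \<nu> by fact
  have nusf: "sigma_finite_measure \<nu>" by (rule nu.sigma_finite_measure_axioms)
  have Km[measurable]: "conv_measure K \<nu> \<in> borel_measurable borel"
    using nusf sn by (intro measurable_conv_measure) auto
  define w where "w = (\<lambda>x. INF j. f j x)"
  have wm[measurable]: "w \<in> borel_measurable borel" unfolding w_def by measurable
  have main: "AE x in \<nu>. min (w x) (ennreal (real m) * swept_kernel x) \<le> u x" for m :: nat
  proof -
    define M where "M = real m"
    have M: "M \<ge> 0" by (simp add: M_def)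
    \<comment> \<open>All \<open>v j\<close> lie below the same multiple of
      \<open>swept_kernel\<close>, so the constant \<open>M * M * B\<close> in the energy estimate
      does not depend on \<open>j\<close>.\<close>
    define v where "v = (\<lambda>j x. min (run_min f j x) (ennreal M * swept_kernel x))"
    have rm[measurable]: "run_min f j \<in> borel_measurable borel" for j by (induction j) auto
    have vm[measurable]: "v j \<in> borel_measurable borel" for j unfolding v_def by measurable
    have "lsc (run_min f j)" for j by (induction j) (auto intro: lsc_min fl)
    then have vl: "lsc (v j)" for j unfolding v_def by (intro lsc_min lsc_cmult lsc_swept_kernel)
    have "conv (sweep r) (run_min f j) x \<le> run_min f j x" if "r > 0" for j r x
      using that by (induction j arbitrary: x) (simp_all add: fs conv_sweep_min del: min.bounded_iff)
    moreover have "conv (sweep r) (\<lambda>x. ennreal M * swept_kernel x) x \<le> ennreal M * swept_kernel x" if "r > 0" for r x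
      using conv_sweep_swept_kernel[OF that, of x] by (simp add: conv_cmult_right mult_left_mono)
    ultimately have vs: "conv (sweep r) (v j) x \<le> v j x" if "r > 0" for r x j
      unfolding v_def using that by (intro conv_sweep_min) auto
    have vb: "v j x \<le> ennreal M * conv K \<rho> x" for j x by (simp add: v_def swept_kernel_def)
    have vB: "v j x \<le> ennreal (M * B)" for j x
      using order_trans[OF vb mult_left_mono[OF swept_kernel_le[unfolded swept_kernel_def]]] M B_nonneg by (simp add: ennreal_mult)
    define W where "W = (\<lambda>x. min (w x) (ennreal M * swept_kernel x))"
    have Wm[measurable]: "W \<in> borel_measurable borel" unfolding W_def by measurable
    have vdec: "decseq (\<lambda>j. v j x)" for x
      using decseq_run_min[of f x] unfolding v_def decseq_def by (meson min.mono order_refl)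
    have Wv: "W x = (INF j. v j x)" for x
      unfolding W_def w_def v_def INF_run_min[of f x, symmetric]
      by (rule antisym) (auto intro!: INF_greatest min.mono intro: INF_lower INF_lower2 simp: INF_inf_distrib[symmetric] inf_min[symmetric])
    define z where "z = (\<lambda>x. min (u x) (W x))"
    have zm[measurable]: "z \<in> borel_measurable borel" unfolding z_def by measurable
    \<comment> \<open>Decreasing limits require a finite first integral, provided by the truncation.
      Multiplication by the sweeping density commutes with the limit only where that density is
      finite, which its unit mass guarantees almost everywhere.\<close>
    have conv_lim: "(INF j. conv (sweep r) (v j) x) = conv (sweep r) W x" if r: "r > 0" for r x
    proof -
      have "(\<integral>\<^sup>+ y. sweep r (x - y) * v 0 y \<partial>lborel) \<le> (\<integral>\<^sup>+ y. sweep r y \<partial>lborel) * ennreal (M * B)"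
        using conv_le_const[of "sweep r" "v 0" "ennreal (M * B)" x] vB by (simp add: conv_def)
      then have fin0: "(\<integral>\<^sup>+ y. sweep r (x - y) * v 0 y \<partial>lborel) < \<infinity>" using sweep_mass[OF r] by (simp add: le_less_trans)
      have "conv (sweep r) W x = (\<integral>\<^sup>+ y. (INF j. sweep r (x - y) * v j y) \<partial>lborel)"
        unfolding conv_def
      proof (rule nn_integral_cong_AE)
        have "AE y in lborel. sweep r (x - y) \<noteq> \<infinity>"
          by (rule nn_integral_noteq_infinite) (use sweep_mass[OF r] in \<open>auto simp: nn_integral_lborel_minus\<close>)
        then show "AE y in lborel. sweep r (x - y) * W y = (INF j. sweep r (x - y) * v j y)"
        proof eventually_elim
          case (elim y)
          have "(\<lambda>j. sweep r (x - y) * v j y) \<longlonglongrightarrow> sweep r (x - y) * W y"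
            using elim LIMSEQ_INF[OF vdec[of y]] unfolding Wv by (intro ennreal_tendsto_cmult) (auto simp: less_top)
          moreover have "decseq (\<lambda>j. sweep r (x - y) * v j y)"
            using vdec[of y] by (auto simp: decseq_def intro: mult_left_mono)
          ultimately show ?case using LIMSEQ_INF LIMSEQ_unique by blast
        qed
      qed
      also have "\<dots> = (INF j. \<integral>\<^sup>+ y. sweep r (x - y) * v j y \<partial>lborel)"
      proof (rule nn_integral_monotone_convergence_INF_decseq)
        show "decseq (\<lambda>j y. sweep r (x - y) * v j y)"
          by (intro decseq_SucI le_funI mult_left_mono decseq_SucD[OF vdec]) auto
        show "(\<integral>\<^sup>+ y. sweep r (x - y) * v 0 y \<partial>lborel) < \<infinity>" by (rule fin0)
      qed measurable
      finally show ?thesis by (simp add: conv_def)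
    qed
    \<comment> \<open>The infimum is taken on the swept side, where the hypothesis bounds the sweep
      of the infimum by \<open>u\<close>; the sweep is also below \<open>W\<close>, hence below
      \<open>z\<close>.\<close>
    have est: "2 * (\<integral>\<^sup>+ x. W x \<partial>\<nu>) + ennreal (1 / s) * (\<integral>\<^sup>+ x. conv (sweep r) (conv_measure K \<nu>) x \<partial>\<nu>)
      \<le> 2 * (\<integral>\<^sup>+ x. z x \<partial>\<nu>) + (ennreal s * ennreal (M * M * B) + ennreal (1 / s) * (\<integral>\<^sup>+ x. conv_measure K \<nu> x \<partial>\<nu>))"
      if r: "r > 0" and s: "s > 0" for r s
    proof -
      let ?e = "ennreal (1 / s) * (\<integral>\<^sup>+ x. conv (sweep r) (conv_measure K \<nu>) x \<partial>\<nu>)"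
      let ?R = "ennreal s * ennreal (M * M * B) + ennreal (1 / s) * (\<integral>\<^sup>+ x. conv_measure K \<nu> x \<partial>\<nu>)"
      have 1: "2 * (\<integral>\<^sup>+ x. W x \<partial>\<nu>) + ?e \<le> 2 * (\<integral>\<^sup>+ x. conv (sweep r) (v j) x \<partial>\<nu>) + ?R" for j
      proof -
        have "2 * (\<integral>\<^sup>+ x. W x \<partial>\<nu>) + ?e \<le> 2 * (\<integral>\<^sup>+ x. v j x \<partial>\<nu>) + ?e"
          unfolding Wv by (intro add_right_mono mult_left_mono nn_integral_mono INF_lower) auto
        also have "\<dots> \<le> 2 * (\<integral>\<^sup>+ x. conv (sweep r) (v j) x \<partial>\<nu>) + ?R"
          by (rule energy_estimate[OF vm vl M vb vs nu sn fin r s])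
        finally show ?thesis .
      qed
      have cB: "conv (sweep r) (v j) x \<le> ennreal (M * B)" for j x
        using conv_le_const[of "sweep r" "v j" "ennreal (M * B)" x] vB sweep_mass[OF r] by simp
      have "(\<integral>\<^sup>+ x. conv (sweep r) (v 0) x \<partial>\<nu>) \<le> (\<integral>\<^sup>+ x. ennreal (M * B) \<partial>\<nu>)" by (intro nn_integral_mono cB)
      then have f0: "(\<integral>\<^sup>+ x. conv (sweep r) (v 0) x \<partial>\<nu>) < \<infinity>" by (simp add: nu.emeasure_space_1 le_less_trans)
      have dec: "decseq (\<lambda>j. conv (sweep r) (v j))"
        by (intro decseq_SucI le_funI conv_mono decseq_SucD[OF vdec]) auto
      have I: "(INF j. \<integral>\<^sup>+ x. conv (sweep r) (v j) x \<partial>\<nu>) = (\<integral>\<^sup>+ x. conv (sweep r) W x \<partial>\<nu>)"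
        using nn_integral_monotone_convergence_INF_decseq[OF dec _ f0] by (simp add: conv_lim[OF r])
      have "decseq (\<lambda>j. \<integral>\<^sup>+ x. conv (sweep r) (v j) x \<partial>\<nu>)"
        by (intro decseq_SucI nn_integral_mono le_funD[OF decseq_SucD[OF dec]])
      from LIMSEQ_INF[OF this] have "(\<lambda>j. \<integral>\<^sup>+ x. conv (sweep r) (v j) x \<partial>\<nu>) \<longlonglongrightarrow> (\<integral>\<^sup>+ x. conv (sweep r) W x \<partial>\<nu>)"
        by (simp add: I)
      then have "(\<lambda>j. 2 * (\<integral>\<^sup>+ x. conv (sweep r) (v j) x \<partial>\<nu>) + ?R) \<longlonglongrightarrow> 2 * (\<integral>\<^sup>+ x. conv (sweep r) W x \<partial>\<nu>) + ?R"
        by (intro tendsto_add ennreal_tendsto_cmult tendsto_const) auto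
      then have "2 * (\<integral>\<^sup>+ x. W x \<partial>\<nu>) + ?e \<le> 2 * (\<integral>\<^sup>+ x. conv (sweep r) W x \<partial>\<nu>) + ?R"
        by (rule LIMSEQ_le_const) (use 1 in auto)
      also have "\<dots> \<le> 2 * (\<integral>\<^sup>+ x. z x \<partial>\<nu>) + ?R"
      proof (intro add_right_mono mult_left_mono nn_integral_mono)
        fix x
        have "conv (sweep r) W x \<le> conv (sweep r) w x" unfolding W_def by (intro conv_mono) auto
        also have "\<dots> \<le> u x" using u[OF r] by (simp add: w_def)
        finally have "conv (sweep r) W x \<le> u x" .
        moreover have "conv (sweep r) W x \<le> W x"
          unfolding conv_lim[OF r, symmetric] Wv by (intro INF_mono) (use vs[OF r] in auto)
        ultimately show "conv (sweep r) W x \<le> z x" by (simp add: z_def)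
      qed simp
      finally show ?thesis .
    qed
    define EN where "EN = (\<integral>\<^sup>+ x. conv_measure K \<nu> x \<partial>\<nu>)"
    define X where "X = (\<integral>\<^sup>+ x. W x \<partial>\<nu>)"
    define Z where "Z = (\<integral>\<^sup>+ x. z x \<partial>\<nu>)"
    have WB: "W x \<le> ennreal (M * B)" for x using vB[of 0 x] unfolding Wv by (metis INF_lower UNIV_I order_trans)
    have "X \<le> (\<integral>\<^sup>+ x. ennreal (M * B) \<partial>\<nu>)" unfolding X_def by (intro nn_integral_mono WB)
    then have Xfin: "X \<noteq> \<infinity>" by (auto simp: nu.emeasure_space_1 top_unique)
    have ZX: "Z \<le> X" unfolding X_def Z_def z_def by (intro nn_integral_mono) auto
    \<comment> \<open>As \<open>r\<close> tends to 0, the mutual energy of \<open>\<nu>\<close> with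
      its sweep has lower limit at least the energy of \<open>\<nu>\<close>. The energy terms on
      both sides then cancel because the energy is finite.\<close>
    have est2: "2 * X \<le> 2 * Z + ennreal s * ennreal (M * M * B)" if s: "s > 0" for s
    proof -
      define r where "r = (\<lambda>k. 1 / real (Suc k))"
      have r: "r k > 0" "r \<longlonglongrightarrow> 0" for k unfolding r_def using LIMSEQ_inverse_real_of_nat by (auto simp: divide_inverse)
      have "EN \<le> (\<integral>\<^sup>+ x. liminf (\<lambda>k. conv (sweep (r k)) (conv_measure K \<nu>) x) \<partial>\<nu>)"
        unfolding EN_def sweep_def by (intro nn_integral_mono lsc_le_liminf_conv_dilate lsc_potential sn rho_mass r) auto
      also have "\<dots> \<le> liminf (\<lambda>k. \<integral>\<^sup>+ x. conv (sweep (r k)) (conv_measure K \<nu>) x \<partial>\<nu>)" by (rule nn_integral_liminf) measurable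
      finally have "ennreal (1 / s) * EN \<le> ennreal (1 / s) * liminf (\<lambda>k. \<integral>\<^sup>+ x. conv (sweep (r k)) (conv_measure K \<nu>) x \<partial>\<nu>)"
        by (rule mult_left_mono) simp
      also have "\<dots> \<le> liminf (\<lambda>k. ennreal (1 / s) * (\<integral>\<^sup>+ x. conv (sweep (r k)) (conv_measure K \<nu>) x \<partial>\<nu>))"
        by (rule liminf_cmult_ennreal)
      finally have "2 * X + ennreal (1 / s) * EN \<le> liminf (\<lambda>k::nat. 2 * X) + liminf (\<lambda>k. ennreal (1 / s) * (\<integral>\<^sup>+ x. conv (sweep (r k)) (conv_measure K \<nu>) x \<partial>\<nu>))"
        by (intro add_mono) (auto simp: Liminf_const)
      also have "\<dots> \<le> liminf (\<lambda>k. 2 * X + ennreal (1 / s) * (\<integral>\<^sup>+ x. conv (sweep (r k)) (conv_measure K \<nu>) x \<partial>\<nu>))"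
        by (rule liminf_add_ennreal)
      also have "\<dots> \<le> liminf (\<lambda>k::nat. 2 * Z + (ennreal s * ennreal (M * M * B) + ennreal (1 / s) * EN))"
        using est[OF r(1) s] by (intro Liminf_mono always_eventually) (auto simp: X_def Z_def EN_def)
      finally have "2 * X + ennreal (1 / s) * EN \<le> 2 * Z + (ennreal s * ennreal (M * M * B) + ennreal (1 / s) * EN)"
        by (simp add: Liminf_const)
      then have "ennreal (1 / s) * EN + 2 * X \<le> ennreal (1 / s) * EN + (2 * Z + ennreal s * ennreal (M * M * B))"
        by (simp add: add_ac)
      then show ?thesis using fin by (auto simp: ennreal_add_left_cancel_le ennreal_mult_eq_top_iff EN_def)
    qed
    have "X \<le> Z"
    proof -
      obtain x' where x': "X = ennreal x'" "x' \<ge> 0" using Xfin by (cases X) auto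
      obtain z' where z': "Z = ennreal z'" "z' \<ge> 0" using ZX Xfin by (cases Z) (auto simp: top_unique)
      have le: "2 * x' \<le> 2 * z' + s * (M * M * B)" if s: "s > 0" for s
      proof -
        have "ennreal (2 * x') \<le> ennreal (2 * z' + s * (M * M * B))"
          using est2[OF s] x' z' s M B_nonneg by (simp add: ennreal_mult)
        then show ?thesis using z' s M B_nonneg by (subst (asm) ennreal_le_iff) auto
      qed
      have "x' \<le> z'"
      proof (rule field_le_epsilon)
        fix e :: real assume e: "e > 0"
        \<comment> \<open>The 1 keeps the denominator positive when \<open>M\<close> or
          \<open>B\<close> is zero.\<close>
        define s where "s = e / (M * M * B + 1)"
        have p: "M * M * B + 1 > 0" using M B_nonneg by (simp add: add_nonneg_pos)
        then have s: "s > 0" using e by (simp add: s_def)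
        have "s * (M * M * B) \<le> s * (M * M * B + 1)" using s by (simp add: algebra_simps)
        also have "\<dots> = e" using p by (simp add: s_def)
        finally show "x' \<le> z' + e" using le[OF s] e by linarith
      qed
      then show ?thesis using x' z' by (simp add: ennreal_leI)
    qed
    have zW: "z x \<le> W x" for x by (simp add: z_def)
    have "(\<integral>\<^sup>+ x. W x - z x \<partial>\<nu>) = X - Z"
      unfolding X_def Z_def using ZX Xfin
      by (intro nn_integral_diff) (auto simp: zW Z_def[symmetric] top_unique)
    also have "\<dots> = 0" using \<open>X \<le> Z\<close> Xfin by (simp add: diff_eq_0_iff_ennreal less_top[symmetric])
    finally have "AE x in \<nu>. W x - z x = 0" by (subst (asm) nn_integral_0_iff_AE) auto
    then show ?thesis
    proof eventually_elim
      case (elim x)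
      have "W x \<noteq> \<infinity>" using WB[of x] by (auto simp: top_unique)
      then have "W x \<le> z x" using elim by (simp add: diff_eq_0_iff_ennreal)
      then show ?case by (simp add: z_def W_def M_def)
    qed
  qed
  then have "AE x in \<nu>. \<forall>m. min (w x) (ennreal (real m) * swept_kernel x) \<le> u x" by (simp add: AE_all_countable)
  then show ?thesis
  proof eventually_elim
    case (elim x)
    show ?case
    proof (rule ccontr)
      assume "\<not> ?thesis"
      then have lt: "u x < w x" by (simp add: w_def not_le)
      then have ux: "u x \<noteq> \<infinity>" by auto
      then have "u x / swept_kernel x < \<top>" using swept_kernel_pos[of x] by (simp add: less_top[symmetric] ennreal_divide_eq_top_iff)
      \<comment> \<open>Since \<open>swept_kernel\<close> is positive and finite, a truncation level
        above \<open>u x\<close> exists, so truncation cannot hide a strict inequality.\<close>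
      then obtain m :: nat where m: "u x / swept_kernel x < of_nat m" using ennreal_Ex_less_of_nat by blast
      have h: "swept_kernel x \<noteq> \<infinity>" using swept_kernel_le[of x] by (auto simp: top_unique)
      have "u x = u x / swept_kernel x * swept_kernel x" using h swept_kernel_pos[of x] by (simp add: ennreal_divide_times ennreal_divide_self less_top[symmetric])
      also have "\<dots> < of_nat m * swept_kernel x" using m h swept_kernel_pos[of x]
        by (intro ennreal_mult_strict_right_mono) (auto simp: less_top zero_less_iff_neq_zero)
      finally have "u x < ennreal (real m) * swept_kernel x" by (simp add: ennreal_of_nat_eq_real_of_nat)
      then show False using lt elim[rule_format, of m] by (auto simp: min_le_iff_disj)
    qed
  qed
qed


lemma Mplus_radon: "\<eta> \<in> Mplus \<alpha> \<Longrightarrow> radon_pos \<eta>" by (simp add: Mplus_def)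

text \<open>Each competitor dominates off its own exceptional set, but there are uncountably many of
  them. Choquet's lemma leaves countably many sets to collect, and the remaining gap between the
  countable infimum and the balayage potential is invisible to test measures.\<close>

lemma balayage_ge_nearly_everywhere:
  fixes \<mu> \<nu> :: "'a measure"
  assumes mu: "\<mu> \<in> Mplus \<alpha>" and bal: "is_balayage \<alpha> \<mu> A \<nu>"
  shows "inner_cap \<alpha> {x \<in> A. potential \<alpha> \<nu> x < potential \<alpha> \<mu> x} = 0"
proof -
  define \<Gamma> where "\<Gamma> = {\<eta> \<in> Mplus \<alpha>. nearly_everywhere_on \<alpha> A (\<lambda>y. potential \<alpha> \<eta> y \<ge> potential \<alpha> \<mu> y)}"
  have nu: "\<nu> \<in> Mplus \<alpha>" and pot: "\<And>x. potential \<alpha> \<nu> x = (INF \<eta>\<in>\<Gamma>. potential \<alpha> \<eta> x)"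
    using bal by (auto simp: is_balayage_def \<Gamma>_def)
  define F where "F = potential \<alpha> ` \<Gamma>"
  \<comment> \<open>Without competitors the infimum would be identically infinite, contrary to
    \<open>\<nu> \<in> Mplus \<alpha>\<close>.\<close>
  have "\<Gamma> \<noteq> {}"
  proof
    assume "\<Gamma> = {}"
    then have "\<forall>x. potential \<alpha> \<nu> x = \<infinity>" using pot by simp
    then show False using nu by (simp add: Mplus_def)
  qed
  then have Fne: "F \<noteq> {}" by (simp add: F_def)
  obtain f :: "nat \<Rightarrow> 'a \<Rightarrow> ennreal" where f: "range f \<subseteq> F"
    and fc: "\<forall>h g x. lsc h \<longrightarrow> (\<forall>j x. h x \<le> f j x) \<longrightarrow> g \<in> F \<longrightarrow> h x \<le> g x"
    by (rule choquet_countable[OF Fne]) (rule that)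
  have "\<exists>\<eta>. \<eta> \<in> \<Gamma> \<and> f j = conv_measure K \<eta>" for j
    using f by (auto simp: F_def potential_eq subset_eq image_iff)
  then obtain \<eta> where eta: "\<And>j. \<eta> j \<in> \<Gamma>" "\<And>j. f j = conv_measure K (\<eta> j)" by metis
  have rad: "radon_pos (\<eta> j)" for j using eta(1)[of j] by (simp add: \<Gamma>_def Mplus_radon)
  note sf = radon_pos_sigma_finite[OF rad] and st = radon_pos_sets[OF rad]
  have fm[measurable]: "f j \<in> borel_measurable borel" for j unfolding eta using rad by (rule potential_measurable)
  have fl: "lsc (f j)" for j unfolding eta by (intro lsc_potential st)
  have fs: "conv (sweep r) (f j) x \<le> f j x" if "r > 0" for j r x
    unfolding eta using that by (intro conv_sweep_potential_le sf st)
  define u where "u = conv_measure K \<nu>"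
  define m where "m = conv_measure K \<mu>"
  have um[measurable]: "u \<in> borel_measurable borel" "m \<in> borel_measurable borel"
    unfolding u_def m_def using nu mu by (auto intro: potential_measurable Mplus_radon)
  define w where "w = (\<lambda>x. INF j. f j x)"
  have wm[measurable]: "w \<in> borel_measurable borel" unfolding w_def by measurable
  \<comment> \<open>The sweep of the countable infimum is lower semicontinuous and below every
    selected potential; Choquet's lemma puts it below all competitors, hence below their infimum
    \<open>u\<close>.\<close>
  have wu: "conv (sweep r) w x \<le> u x" if r: "r > 0" for r x
  proof -
    have "conv (sweep r) w y \<le> f j y" for y j
      using order_trans[OF conv_mono[of "sweep r" "sweep r" w "f j" y] fs[OF r]] by (auto simp: w_def intro: INF_lower)
    moreover have "lsc (conv (sweep r) w)" by (intro lsc_conv lsc_sweep) auto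
    ultimately have "conv (sweep r) w x \<le> h x" if "h \<in> F" for h
      using fc that by blast
    then show ?thesis using pot by (auto simp: u_def potential_eq F_def intro!: INF_greatest)
  qed
  define E where "E = {x \<in> A. u x < m x}"
  \<comment> \<open>Borel pieces for the gluing. Where \<open>f j < m\<close>, the point is
    exceptional for the competitor \<open>\<eta> j\<close>; where \<open>m \<le> w\<close>, a point
    of \<open>E\<close> has \<open>u < w\<close>, which test measures do not see.\<close>
  define D where "D = (\<lambda>j. case j of 0 \<Rightarrow> {x. m x \<le> w x} | Suc j \<Rightarrow> {x. f j x < m x})"
  have "inner_cap \<alpha> E = 0"
  proof (rule inner_cap_zero_UN[of D])
    show "universally_measurable (D j)" for j
      by (rule universally_measurable_borel) (auto simp: D_def split: nat.split)
    have "x \<in> (\<Union>j. D j)" for x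
    proof (cases "m x \<le> w x")
      case True then show ?thesis by (auto simp: D_def intro!: exI[of _ 0])
    next
      case False
      then obtain j where "f j x < m x" unfolding w_def by (auto simp: not_le INF_less_iff)
      then show ?thesis by (auto simp: D_def intro!: exI[of _ "Suc j"])
    qed
    then show "E \<subseteq> (\<Union>j. D j)" by auto
    fix j
    show "inner_cap \<alpha> (E \<inter> D j) = 0"
    proof (cases j)
      case (Suc i)
      obtain N where N: "inner_cap \<alpha> N = 0" "\<forall>x\<in>A - N. potential \<alpha> (\<eta> i) x \<ge> potential \<alpha> \<mu> x"
        using eta(1)[of i] unfolding \<Gamma>_def nearly_everywhere_on_def by blast
      have "E \<inter> D j \<subseteq> N" using N(2) unfolding E_def D_def Suc
        by (auto simp: potential_eq eta(2) m_def not_le[symmetric])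
      then show ?thesis using N(1) by (rule inner_cap_zero_mono[rotated])
    next
      case 0
      show ?thesis unfolding inner_cap_zero_iff
      proof (rule notI, elim exE conjE)
        fix \<nu>0 :: "'a measure"
        assume n: "radon_pos \<nu>0" "energy \<alpha> \<nu>0 < \<infinity>" "concentrated_on \<nu>0 (E \<inter> D j)" "emeasure \<nu>0 UNIV = 1"
        have s0: "sets \<nu>0 = sets borel" by (rule radon_pos_sets[OF n(1)])
        interpret p: prob_space \<nu>0
          using n(4) sets_eq_imp_space_eq[OF s0] by (intro prob_spaceI) simp
        have "AE x in \<nu>0. w x \<le> u x" unfolding w_def
          by (rule infimum_le_regularization_AE)
            (use fm fl fs um wu p.prob_space_axioms s0 n(2) in \<open>auto simp: w_def energy_eq\<close>)
        moreover obtain N where N: "N \<in> null_sets \<nu>0" "UNIV - E \<inter> D j \<subseteq> N"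
          using n(3) by (auto simp: concentrated_on_def)
        have "AE x in \<nu>0. x \<notin> N" using N(1) by (rule AE_not_in)
        ultimately have "AE x in \<nu>0. False"
        proof eventually_elim
          case (elim x)
          then have "x \<in> E \<inter> D j" using N(2) by auto
          then have "u x < m x" "m x \<le> w x" by (auto simp: E_def D_def 0)
          then show ?case using elim(1) by simp
        qed
        then show False by (simp add: p.AE_False)
      qed
    qed
  qed
  then show ?thesis by (simp add: E_def u_def m_def potential_eq)
qed

end

section \<open>Vague compactness\<close>

text \<open>Schoenberg's plateau function, obtained by clipping a cosine: period 2, value 0 on the
  first third of the unit interval and 1 on the last third, since the cosine is one half at pi /
  3.\<close>

definition tooth :: "real \<Rightarrow> real" where
  "tooth y = max 0 (min 1 (1 / 2 - cos (pi * y)))"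

lemma tooth_bounds: "0 \<le> tooth y" "tooth y \<le> 1" by (auto simp: tooth_def)

lemma continuous_tooth: "continuous_on UNIV tooth"
  unfolding tooth_def[abs_def] by (intro continuous_intros)

lemma tooth_periodic: "tooth (2 * of_int k + y) = tooth y"
proof -
  have "pi * (2 * of_int k + y) = pi * y + of_int (2 * k) * pi" by (simp add: algebra_simps)
  then have "cos (pi * (2 * of_int k + y)) = cos (pi * y)"
    using cos_int_2pin[of k] sin_int_2pin[of k] by (simp add: cos_add mult_ac)
  then show ?thesis by (simp add: tooth_def)
qed

lemma tooth_low: assumes "0 \<le> y" "y \<le> 1 / 3" shows "tooth y = 0"
proof -
  have "pi * y \<le> pi * (1 / 3)" using assms by (intro mult_left_mono) auto
  then have "cos (pi / 3) \<le> cos (pi * y)" using assms pi_gt_zero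
    by (intro cos_monotone_0_pi_le) auto
  then show ?thesis by (simp add: tooth_def cos_60)
qed

lemma tooth_high: assumes "2 / 3 \<le> y" "y \<le> 1" shows "tooth y = 1"
proof -
  have "0 \<le> 1 - y" "1 - y \<le> 1 / 3" using assms by auto
  then have "pi * (1 - y) \<le> pi * (1 / 3)" by (intro mult_left_mono) auto
  then have "cos (pi / 3) \<le> cos (pi * (1 - y))" using assms pi_gt_zero
    by (intro cos_monotone_0_pi_le) auto
  moreover have "cos (pi * (1 - y)) = - cos (pi * y)" by (simp add: right_diff_distrib)
  ultimately show ?thesis by (simp add: tooth_def cos_60)
qed

text \<open>The Cantor point with ternary digits \<open>2 * d l\<close>. Doubling the digits keeps
  every tail out of the middle third, where \<open>tooth\<close> is not constant.\<close>

definition ternary :: "(nat \<Rightarrow> real) \<Rightarrow> real" where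
  "ternary d = (\<Sum>l. 2 * d l / 3 ^ Suc l)"

lemma ternary_summable:
  assumes "\<And>l. d l \<in> {0, 1::real}" shows "summable (\<lambda>l. 2 * d l / 3 ^ Suc l)"
proof (rule summable_comparison_test')
  show "summable (\<lambda>l. 2 / 3 * (1 / 3 :: real) ^ l)" by (intro summable_mult summable_geometric) auto
  show "norm (2 * d l / 3 ^ Suc l) \<le> 2 / 3 * (1 / 3 :: real) ^ l" if "l \<ge> 0" for l
    using assms[of l] by (auto simp: power_divide)
qed

lemma ternary_bounds:
  assumes d: "\<And>l. d l \<in> {0, 1::real}" shows "0 \<le> ternary d" "ternary d \<le> 1"
proof -
  have nn: "0 \<le> 2 * d l / 3 ^ Suc l" for l using d[of l] by auto
  show "0 \<le> ternary d" unfolding ternary_def by (intro suminf_nonneg ternary_summable d nn)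
  have s: "summable (\<lambda>l. 2 / 3 * (1 / 3 :: real) ^ l)" by (intro summable_mult summable_geometric) auto
  have "ternary d \<le> (\<Sum>l. 2 / 3 * (1 / 3 :: real) ^ l)"
    unfolding ternary_def
  proof (intro suminf_le ternary_summable d s)
    show "2 * d l / 3 ^ Suc l \<le> 2 / 3 * (1 / 3) ^ l" for l using d[of l] by (auto simp: power_divide)
  qed
  also have "\<dots> = 2 / 3 * (1 / (1 - 1 / 3))" by (subst suminf_mult) (auto intro: summable_geometric simp: suminf_geometric)
  finally show "ternary d \<le> 1" by simp
qed

lemma ternary_Suc:
  assumes d: "\<And>l. d l \<in> {0, 1::real}"
  shows "3 * ternary d = 2 * d 0 + ternary (\<lambda>l. d (Suc l))"
proof -
  have "ternary d = (\<Sum>l. 2 * d (Suc l) / 3 ^ Suc (Suc l)) + 2 * d 0 / 3"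
    unfolding ternary_def using suminf_split_head[OF ternary_summable[of d]] d by simp
  also have "(\<Sum>l. 2 * d (Suc l) / 3 ^ Suc (Suc l)) = (\<Sum>l. (1 / 3) * (2 * d (Suc l) / 3 ^ Suc l))" by simp
  also have "\<dots> = 1 / 3 * ternary (\<lambda>l. d (Suc l))"
    unfolding ternary_def by (rule suminf_mult) (rule ternary_summable, rule d)
  finally show ?thesis by simp
qed

text \<open>Multiplication by a power of 3 shifts the digits; what moves in front of the point is an
  even integer because the digits are doubled, so \<open>tooth\<close>, of period 2, sees only the
  tail.\<close>

lemma ternary_shift:
  assumes d: "\<And>l. d l \<in> {0, 1::real}"
  shows "\<exists>k::int. 3 ^ l * ternary d = 2 * of_int k + ternary (\<lambda>j. d (j + l))"
proof (induction l)
  case 0 show ?case by (intro exI[of _ 0]) simp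
next
  case (Suc l)
  then obtain k :: int where k: "3 ^ l * ternary d = 2 * of_int k + ternary (\<lambda>j. d (j + l))" by auto
  have "3 ^ Suc l * ternary d = 3 * (3 ^ l * ternary d)" by simp
  also have "\<dots> = 6 * of_int k + 3 * ternary (\<lambda>j. d (j + l))" using k by simp
  also have "3 * ternary (\<lambda>j. d (j + l)) = 2 * d l + ternary (\<lambda>j. d (j + Suc l))"
    using ternary_Suc[of "\<lambda>j. d (j + l)"] d by simp
  finally show ?case using d[of l]
    by (intro exI[of _ "3 * k + \<lfloor>d l\<rfloor>"]) auto
qed

lemma tooth_ternary:
  assumes d: "\<And>l. d l \<in> {0, 1::real}" shows "tooth (3 ^ l * ternary d) = d l"
proof -
  obtain k :: int where "3 ^ l * ternary d = 2 * of_int k + ternary (\<lambda>j. d (j + l))"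
    using ternary_shift[of d l, OF d] by blast
  then have 1: "tooth (3 ^ l * ternary d) = tooth (ternary (\<lambda>j. d (j + l)))" by (simp add: tooth_periodic)
  have 2: "3 * ternary (\<lambda>j. d (j + l)) = 2 * d l + ternary (\<lambda>j. d (Suc j + l))"
    using ternary_Suc[of "\<lambda>j. d (j + l)"] d by simp
  have 3: "0 \<le> ternary (\<lambda>j. d (Suc j + l))" "ternary (\<lambda>j. d (Suc j + l)) \<le> 1"
    using ternary_bounds[of "\<lambda>j. d (Suc j + l)"] d by auto
  show ?thesis
  proof (cases "d l = 0")
    case True then show ?thesis using 1 2 3 by (simp add: tooth_low)
  next
    case False then have "d l = 1" using d[of l] by auto
    then show ?thesis using 1 2 3 by (simp add: tooth_high)
  qed
qed

text \<open>The binary digit of place \<open>m + 1\<close> after the point, written with floors so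
  that it is visibly Borel in \<open>x\<close>.\<close>

definition bdigit :: "nat \<Rightarrow> real \<Rightarrow> real" where
  "bdigit m x = of_int \<lfloor>2 ^ Suc m * x\<rfloor> - 2 * of_int \<lfloor>2 ^ m * x\<rfloor>"

lemma bdigit_range: "bdigit m x \<in> {0, 1}"
proof -
  define y where "y = 2 ^ m * x"
  have "2 * \<lfloor>y\<rfloor> \<le> \<lfloor>2 * y\<rfloor>" by (simp add: le_floor_iff)
  moreover have "\<lfloor>2 * y\<rfloor> < 2 * \<lfloor>y\<rfloor> + 2" by (simp add: floor_less_iff) linarith
  ultimately have "\<lfloor>2 * y\<rfloor> - 2 * \<lfloor>y\<rfloor> = 0 \<or> \<lfloor>2 * y\<rfloor> - 2 * \<lfloor>y\<rfloor> = 1" by linarith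
  then have "real_of_int (\<lfloor>2 * y\<rfloor> - 2 * \<lfloor>y\<rfloor>) \<in> {0, 1}" by auto
  then show ?thesis by (simp add: bdigit_def y_def mult.assoc)
qed

lemma bdigit_sums:
  assumes "0 \<le> x" "x < 1" shows "(\<lambda>m. bdigit m x / 2 ^ Suc m) sums x"
proof -
  have part: "(\<Sum>m<N. bdigit m x / 2 ^ Suc m) = of_int \<lfloor>2 ^ N * x\<rfloor> / 2 ^ N" for N
  proof (induction N)
    case 0 have "\<lfloor>x\<rfloor> = 0" using assms by (simp add: floor_eq_iff)
    then show ?case by simp
  next
    case (Suc N) then show ?case by (simp add: bdigit_def field_simps)
  qed
  have "(\<lambda>N. of_int \<lfloor>2 ^ N * x\<rfloor> / 2 ^ N) \<longlonglongrightarrow> x"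
  proof (rule tendsto_sandwich)
    show "eventually (\<lambda>N. x - (1 / 2) ^ N \<le> of_int \<lfloor>2 ^ N * x\<rfloor> / 2 ^ N) sequentially"
    proof (intro always_eventually allI)
      fix N :: nat
      have "2 ^ N * x - 1 \<le> of_int \<lfloor>2 ^ N * x\<rfloor>" by linarith
      then have "(2 ^ N * x - 1) / 2 ^ N \<le> of_int \<lfloor>2 ^ N * x\<rfloor> / 2 ^ N" by (rule divide_right_mono) simp
      then show "x - (1 / 2) ^ N \<le> of_int \<lfloor>2 ^ N * x\<rfloor> / 2 ^ N" by (simp add: diff_divide_distrib power_divide)
    qed
    show "eventually (\<lambda>N. of_int \<lfloor>2 ^ N * x\<rfloor> / 2 ^ N \<le> x) sequentially"
      by (intro always_eventually allI) (simp add: field_simps)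
    have "(\<lambda>N. x - (1 / 2) ^ N) \<longlonglongrightarrow> x - 0" by (intro tendsto_intros LIMSEQ_power_zero) auto
    then show "(\<lambda>N. x - (1 / 2) ^ N) \<longlonglongrightarrow> x" by simp
  qed simp
  then show ?thesis unfolding sums_def part .
qed

text \<open>Schoenberg's space-filling curve, with the Cantor-type selection as Borel right inverse.\<close>

lemma space_filling_curve:
  obtains h :: "real \<Rightarrow> 'a::euclidean_space" and s :: "'a \<Rightarrow> real"
  where "continuous_on UNIV h" "s \<in> borel_measurable borel" "\<And>x. 0 \<le> s x \<and> s x \<le> 1"
    "\<And>x. (\<And>b. b \<in> Basis \<Longrightarrow> 0 \<le> x \<bullet> b \<and> x \<bullet> b < 1) \<Longrightarrow> h (s x) = x"
proof -
  define n where "n = DIM('a)"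
  have n: "n > 0" by (simp add: n_def)
  obtain e where e: "bij_betw e {0..<n} (Basis :: 'a set)"
    using ex_bij_betw_nat_finite[OF finite_Basis] by (auto simp: n_def)
  define idx where "idx = inv_into {0..<n} e"
  have idx: "idx b < n" "e (idx b) = b" if "b \<in> Basis" for b
    using that e bij_betw_inv_into_right[OF e that] bij_betw_apply[OF bij_betw_inv_into[OF e] that]
    by (auto simp: idx_def)
  \<comment> \<open>The coordinates' binary digits are interleaved: position \<open>l\<close> holds
    digit \<open>l div n\<close> of coordinate \<open>l mod n\<close>.\<close>
  define d where "d = (\<lambda>(x::'a) l. bdigit (l div n) (x \<bullet> e (l mod n)))"
  have d: "d x l \<in> {0, 1}" for x l unfolding d_def by (rule bdigit_range)
  define s where "s = (\<lambda>x. ternary (d x))"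
  \<comment> \<open>Component \<open>i\<close> of the curve collects the ternary positions congruent
    to \<open>i\<close> modulo \<open>n\<close> and reassembles the coordinate from them.\<close>
  define c where "c = (\<lambda>i t. \<Sum>m. tooth (3 ^ (n * m + i) * t) / 2 ^ Suc m)"
  define h where "h = (\<lambda>t. \<Sum>b\<in>(Basis::'a set). c (idx b) t *\<^sub>R b)"
  show ?thesis
  proof (rule that[of h s])
    have sg: "summable (\<lambda>m. 1 / 2 ^ Suc m :: real)"
      using summable_mult[OF summable_geometric[of "1 / 2 :: real"], of "1 / 2"] by (simp add: power_divide)
    have "continuous_on UNIV (c i)" for i
    proof -
      have "uniform_limit UNIV (\<lambda>N t. \<Sum>m<N. tooth (3 ^ (n * m + i) * t) / 2 ^ Suc m)
         (\<lambda>t. \<Sum>m. tooth (3 ^ (n * m + i) * t) / 2 ^ Suc m) sequentially"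
      proof (rule Weierstrass_m_test)
        show "norm (tooth (3 ^ (n * m + i) * t) / 2 ^ Suc m) \<le> 1 / 2 ^ Suc m" for m t
          using tooth_bounds[of "3 ^ (n * m + i) * t"] by (simp add: divide_right_mono)
      qed (rule sg)
      moreover have "continuous_on UNIV (\<lambda>t. \<Sum>m<N. tooth (3 ^ (n * m + i) * t) / 2 ^ Suc m)" for N
        by (intro continuous_intros continuous_on_compose2[OF continuous_tooth]) auto
      ultimately show ?thesis unfolding c_def
        by (intro uniform_limit_theorem) auto
    qed
    then show "continuous_on UNIV h" unfolding h_def by (intro continuous_intros) auto
    show "s \<in> borel_measurable borel"
      unfolding s_def ternary_def d_def bdigit_def by measurable
    show "0 \<le> s x \<and> s x \<le> 1" for x unfolding s_def using ternary_bounds[of "d x"] d by auto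
    fix x :: 'a assume x: "\<And>b. b \<in> Basis \<Longrightarrow> 0 \<le> x \<bullet> b \<and> x \<bullet> b < 1"
    have "c (idx b) (s x) = x \<bullet> b" if b: "b \<in> Basis" for b
    proof -
      have "tooth (3 ^ (n * m + idx b) * s x) = bdigit m (x \<bullet> b)" for m
        unfolding s_def tooth_ternary[OF d] using idx[OF b] n by (simp add: d_def)
      then have "c (idx b) (s x) = (\<Sum>m. bdigit m (x \<bullet> b) / 2 ^ Suc m)" by (simp add: c_def)
      also have "\<dots> = x \<bullet> b" using bdigit_sums[of "x \<bullet> b"] x[OF b] by (simp add: sums_iff)
      finally show ?thesis .
    qed
    then show "h (s x) = x" unfolding h_def by (simp add: euclidean_representation)
  qed
qed

section \<open>Selection theorems for bounded measures\<close>

abbreviation compactly_supported :: "('a::euclidean_space \<Rightarrow> real) \<Rightarrow> bool" where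
  "compactly_supported f \<equiv> continuous_on UNIV f \<and> compact (closure {x. f x \<noteq> 0})"

lemma compactly_supported_bounded:
  assumes "compactly_supported f" obtains C where "C \<ge> 0" "\<And>x. \<bar>f x\<bar> \<le> C"
proof -
  let ?S = "closure {x. f x \<noteq> 0}"
  have "compact (f ` ?S)" using assms by (intro compact_continuous_image) (auto intro: continuous_on_subset)
  then obtain C where C: "\<And>y. y \<in> f ` ?S \<Longrightarrow> \<bar>y\<bar> \<le> C"
    by (metis compact_imp_bounded bounded_iff real_norm_def)
  have "\<bar>f x\<bar> \<le> max 0 C" for x
  proof (cases "f x = 0")
    case False then have "x \<in> ?S" by (intro closure_subset[THEN subsetD]) auto
    then show ?thesis using C[of "f x"] by auto
  qed auto
  then show ?thesis by (intro that[of "max 0 C"]) auto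
qed

text \<open>The space is squeezed into a ball inside the unit cube and the laws are carried to the
  line by the Borel section \<open>s\<close>. Carried laws live on the unit interval, hence are
  tight; a weak limit is brought back by the continuous curve \<open>h\<close>. Continuity of
  \<open>h\<close> suffices although \<open>s\<close> is only Borel, since test functions are
  composed with \<open>h\<close>.\<close>

lemma finite_measures_normalized_compact:
  fixes N :: "nat \<Rightarrow> 'a::euclidean_space measure"
  assumes P: "\<And>k. prob_space (N k)" and sN: "\<And>k. sets (N k) = sets borel"
  obtains r M where "strict_mono (r :: nat \<Rightarrow> nat)" "finite_measure M" "sets M = sets borel"
    "\<And>f. compactly_supported f \<Longrightarrow> (\<lambda>k. integral\<^sup>L (N (r k)) f) \<longlonglongrightarrow> integral\<^sup>L M f"
proof -
  obtain h :: "real \<Rightarrow> 'a" and s where h: "continuous_on UNIV h" and s: "s \<in> borel_measurable borel"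
    "\<And>x. 0 \<le> s x \<and> s x \<le> 1" and hs: "\<And>x. (\<And>b. b \<in> Basis \<Longrightarrow> 0 \<le> x \<bullet> b \<and> x \<bullet> b < 1) \<Longrightarrow> h (s x) = x"
    using space_filling_curve[where 'a='a] by blast
  \<comment> \<open>The centre of the unit cube, so that the open ball of radius one half lies in
    the half-open cube on which \<open>h\<close> inverts \<open>s\<close>.\<close>
  define z :: 'a where "z = (\<Sum>b\<in>Basis. (1 / 2) *\<^sub>R b)"
  define S where "S = ball z (1 / 2)"
  have "S homeomorphic (UNIV :: 'a set)" unfolding S_def by (rule homeomorphic_ball_UNIV) simp
  then obtain p q where pq: "homeomorphism S (UNIV::'a set) p q" unfolding homeomorphic_def by auto
  have p: "continuous_on S p" and q: "continuous_on UNIV q" and qS: "q x \<in> S" and pq1: "p (q x) = x" for x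
    using pq by (auto simp: homeomorphism_def)
  have qp: "q (p y) = y" if "y \<in> S" for y using that pq by (auto simp: homeomorphism_def)
  have hsq: "h (s (q x)) = q x" for x
  proof (rule hs)
    fix b :: 'a assume b: "b \<in> Basis"
    have "\<bar>(q x - z) \<bullet> b\<bar> \<le> norm (q x - z)" using b by (rule Basis_le_norm)
    also have "\<dots> < 1 / 2" using qS[of x] by (simp add: S_def dist_norm norm_minus_commute)
    finally have "\<bar>q x \<bullet> b - 1 / 2\<bar> < 1 / 2" using b by (simp add: z_def inner_diff_left)
    then show "0 \<le> q x \<bullet> b \<and> q x \<bullet> b < 1" by (auto simp: abs_if split: if_splits)
  qed
  have [measurable]: "h \<in> borel_measurable borel" "q \<in> borel_measurable borel" "s \<in> borel_measurable borel"
    "S \<in> sets borel"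
    using h q s by (auto intro: borel_measurable_continuous_onI simp: S_def)
  note sN[measurable_cong]
  interpret N: prob_space "N k" for k by (rule P)
  define Q where "Q = (\<lambda>k. distr (N k) borel (\<lambda>x. s (q x)))"
  have rd: "real_distribution (Q k)" for k unfolding Q_def by (rule N.real_distribution_distr) measurable
  have "tight Q" unfolding tight_def
  proof (intro conjI allI impI rd)
    fix e :: real assume e: "e > 0"
    \<comment> \<open>Tightness is phrased with left-open intervals; the left end -1 makes the
      interval contain the point 0.\<close>
    have "measure (Q k) {-1<..1} = 1" for k
    proof -
      have "measure (Q k) {-1<..1} = measure (N k) ((\<lambda>x. s (q x)) -` {-1<..1} \<inter> space (N k))"
        unfolding Q_def by (rule measure_distr) auto
      also have "(\<lambda>x. s (q x)) -` {-1<..1} \<inter> space (N k) = space (N k)"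
      proof -
        have "-1 < s y" for y using s(2)[of y] by linarith
        then show ?thesis using s(2) by auto
      qed
      finally show ?thesis by (simp add: N.prob_space)
    qed
    then show "\<exists>a b. a < b \<and> (\<forall>n. 1 - e < measure (Q n) {a<..b})" using e by (intro exI[of _ "-1"] exI[of _ 1]) auto
  qed
  from tight_imp_convergent_subsubsequence[OF this strict_mono_id]
  obtain r Q' where r: "strict_mono r" and Q': "real_distribution Q'" and wc: "weak_conv_m (Q \<circ> id \<circ> r) Q'" by blast
  interpret Q': real_distribution Q' by (rule Q')
  define p' where "p' = (\<lambda>y. if y \<in> S then p y else 0)"
  have [measurable]: "p' \<in> borel_measurable borel"
    unfolding p'_def using p by (intro borel_measurable_continuous_on_if) auto
  \<comment> \<open>Limit mass whose image under \<open>h\<close> leaves the open ball has escaped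
    to infinity and is discarded. Hence the limit is finite but need not have mass one.\<close>
  define D where "D = density Q' (indicator {t. h t \<in> S})"
  define M where "M = distr D borel (\<lambda>t. p' (h t))"
  have sD[measurable_cong]: "sets D = sets borel" by (simp add: D_def)
  have finD: "finite_measure D"
  proof
    have "emeasure D (space D) = (\<integral>\<^sup>+ t. indicator {t. h t \<in> S} t \<partial>Q')"
      unfolding D_def by (simp add: emeasure_density cong: nn_integral_cong)
    also have "\<dots> \<le> (\<integral>\<^sup>+ t. 1 \<partial>Q')" by (intro nn_integral_mono) (auto split: split_indicator)
    also have "\<dots> = 1" using Q'.emeasure_space_1 by simp
    finally show "emeasure D (space D) \<noteq> \<infinity>" by (auto simp: top_unique)
  qed
  show ?thesis
  proof (rule that[of r M])
    show "strict_mono r" by fact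
    show "finite_measure M" unfolding M_def by (rule finite_measure.finite_measure_distr[OF finD]) measurable
    show "sets M = sets borel" by (simp add: M_def)
    fix f :: "'a \<Rightarrow> real" assume f: "compactly_supported f"
    obtain C where C: "C \<ge> 0" "\<And>x. \<bar>f x\<bar> \<le> C" using compactly_supported_bounded[OF f] by blast
    have [measurable]: "f \<in> borel_measurable borel" using f by (auto intro: borel_measurable_continuous_onI)
    \<comment> \<open>Extended by zero this is continuous: the support of \<open>f\<close> has a
      compact image \<open>T\<close> in the open ball, and \<open>F\<close> vanishes off
      \<open>T\<close>.\<close>
    define F where "F = (\<lambda>y. if y \<in> S then f (p y) else 0)"
    define T where "T = q ` closure {x. f x \<noteq> 0}"
    have T: "compact T" unfolding T_def using f q by (intro compact_continuous_image) (auto intro: continuous_on_subset)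
    have TS: "T \<subseteq> S" using qS by (auto simp: T_def)
    have cF: "continuous_on UNIV F"
    proof -
      have "continuous_on S F"
        using f p by (subst continuous_on_cong[OF refl, where g="\<lambda>y. f (p y)"])
          (auto simp: F_def intro: continuous_on_compose2[of UNIV f S p])
      moreover have "F y = 0" if "y \<in> - T" for y
      proof (rule ccontr)
        assume "F y \<noteq> 0"
        then have y: "y \<in> S" "f (p y) \<noteq> 0" by (auto simp: F_def split: if_splits)
        then have "p y \<in> closure {x. f x \<noteq> 0}" by (intro closure_subset[THEN subsetD]) auto
        then have "q (p y) \<in> T" by (auto simp: T_def)
        then show False using qp y that by auto
      qed
      then have "continuous_on (- T) F" by (subst continuous_on_cong[OF refl, where g="\<lambda>_. 0"]) auto
      ultimately have "continuous_on (S \<union> - T) F"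
        using T by (intro continuous_on_open_Un) (auto simp: S_def compact_imp_closed)
      moreover have "S \<union> - T = UNIV" using TS by auto
      ultimately show ?thesis by simp
    qed
    have Fb: "\<bar>F y\<bar> \<le> C" for y using C by (auto simp: F_def)
    have [measurable]: "F \<in> borel_measurable borel" using cF by (rule borel_measurable_continuous_onI)
    have cFh: "continuous_on UNIV (\<lambda>t. F (h t))" by (rule continuous_on_compose2[OF cF h]) auto
    have "(\<lambda>k. integral\<^sup>L ((Q \<circ> id \<circ> r) k) (\<lambda>t. F (h t))) \<longlonglongrightarrow> integral\<^sup>L Q' (\<lambda>t. F (h t))"
    proof (rule weak_conv_imp_integral_bdd_continuous_conv[OF _ Q' wc])
      show "real_distribution ((Q \<circ> id \<circ> r) k)" for k using rd by simp
      show "isCont (\<lambda>t. F (h t)) t" for t using cFh by (simp add: continuous_on_eq_continuous_at)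
      show "norm (F (h t)) \<le> C" for t using Fb by simp
    qed
    moreover have "integral\<^sup>L ((Q \<circ> id \<circ> r) k) (\<lambda>t. F (h t)) = integral\<^sup>L (N (r k)) f" for k
    proof -
      have "integral\<^sup>L ((Q \<circ> id \<circ> r) k) (\<lambda>t. F (h t)) = (\<integral>x. F (h (s (q x))) \<partial>N (r k))"
        unfolding Q_def comp_def id_def by (rule integral_distr) measurable
      also have "(\<lambda>x. F (h (s (q x)))) = f" using qS pq1 by (auto simp: hsq F_def)
      finally show ?thesis .
    qed
    moreover have "integral\<^sup>L M f = integral\<^sup>L Q' (\<lambda>t. F (h t))"
    proof -
      have "integral\<^sup>L M f = (\<integral>t. f (p' (h t)) \<partial>D)" unfolding M_def by (rule integral_distr) measurable
      also have "\<dots> = (\<integral>t. indicator {t. h t \<in> S} t *\<^sub>R f (p' (h t)) \<partial>Q')"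
        unfolding D_def ennreal_indicator[symmetric] by (rule integral_density) auto
      also have "(\<lambda>t. indicator {t. h t \<in> S} t *\<^sub>R f (p' (h t))) = (\<lambda>t. F (h t))"
        by (auto simp: F_def p'_def split: split_indicator)
      finally show ?thesis .
    qed
    ultimately show "(\<lambda>k. integral\<^sup>L (N (r k)) f) \<longlonglongrightarrow> integral\<^sup>L M f" by simp
  qed
qed

lemma integral_density_const:
  fixes f :: "'a \<Rightarrow> real"
  assumes "c \<ge> 0" "f \<in> borel_measurable M"
  shows "integral\<^sup>L (density M (\<lambda>_. ennreal c)) f = c * integral\<^sup>L M f"
  using assms by (subst integral_density) auto

text \<open>The total masses converge along a subsequence. A zero limit gives the null measure;
  otherwise the measures are eventually nonzero and can be normalized.\<close>

lemma bounded_measures_compact: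
  fixes N :: "nat \<Rightarrow> 'a::euclidean_space measure"
  assumes fin: "\<And>k. finite_measure (N k)" and sN: "\<And>k. sets (N k) = sets borel"
    and bd: "\<And>k. measure (N k) UNIV \<le> C"
  obtains r M where "strict_mono (r :: nat \<Rightarrow> nat)" "finite_measure M" "sets M = sets borel"
    "\<And>f. compactly_supported f \<Longrightarrow> (\<lambda>k. integral\<^sup>L (N (r k)) f) \<longlonglongrightarrow> integral\<^sup>L M f"
proof -
  define m where "m = (\<lambda>k. measure (N k) UNIV)"
  have sp: "space (N k) = UNIV" for k using sets_eq_imp_space_eq[OF sN[of k]] by simp
  have "seq_compact {0..C}" using compact_Icc compact_imp_seq_compact by blast
  then obtain l r1 where r1: "strict_mono r1" and l: "(m \<circ> r1) \<longlonglongrightarrow> l" "l \<in> {0..C}"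
    using bd by (elim seq_compactE[where f=m]) (auto simp: m_def)
  note sN[measurable_cong]
  interpret N: finite_measure "N k" for k by (rule fin)
  have em: "emeasure (N k) UNIV = ennreal (m k)" for k by (simp add: m_def N.emeasure_eq_measure)
  show ?thesis
  proof (cases "l = 0")
    case True
    show ?thesis
    proof (rule that[of r1 "null_measure borel"])
      fix f :: "'a \<Rightarrow> real" assume f: "compactly_supported f"
      obtain c where c: "c \<ge> 0" "\<And>x. \<bar>f x\<bar> \<le> c" using compactly_supported_bounded[OF f] by blast
      have [measurable]: "f \<in> borel_measurable borel" using f by (auto intro: borel_measurable_continuous_onI)
      have bnd: "\<bar>integral\<^sup>L (N k) f\<bar> \<le> c * m k" for k
      proof -
        have "norm (integral\<^sup>L (N k) f) \<le> (\<integral>x. c \<partial>N k)"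
          using c by (intro Bochner_Integration.integral_norm_bound_integral N.integrable_const_bound[where B=c]) auto
        then show ?thesis using sp by (simp add: m_def mult.commute)
      qed
      have lim0: "(\<lambda>k. c * m (r1 k)) \<longlonglongrightarrow> c * 0" using l True by (intro tendsto_intros) (auto simp: comp_def)
      have "(\<lambda>k. integral\<^sup>L (N (r1 k)) f) \<longlonglongrightarrow> 0"
      proof (rule Lim_null_comparison)
        show "eventually (\<lambda>k. norm (integral\<^sup>L (N (r1 k)) f) \<le> c * m (r1 k)) sequentially"
          unfolding real_norm_def by (rule always_eventually) (use bnd in blast)
        show "(\<lambda>k. c * m (r1 k)) \<longlonglongrightarrow> 0" using lim0 by simp
      qed
      moreover have "integral\<^sup>L (null_measure borel) f = 0"
        by (rule integral_eq_zero_AE) (auto simp: AE_iff_null_sets intro!: AE_I'[of "space borel"])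
      ultimately show "(\<lambda>k. integral\<^sup>L (N (r1 k)) f) \<longlonglongrightarrow> integral\<^sup>L (null_measure borel) f" by simp
    qed (use r1 in \<open>auto intro: finite_measureI\<close>)
  next
    case False
    then have lpos: "l > 0" using l(2) by auto
    have "eventually (\<lambda>k. (m \<circ> r1) k > 0) sequentially" using order_tendstoD(1)[OF l(1) lpos] .
    then obtain k0 where k0: "\<And>k. k \<ge> k0 \<Longrightarrow> m (r1 k) > 0" by (auto simp: eventually_sequentially)
    define r2 where "r2 = (\<lambda>k. r1 (k + k0))"
    have r2: "strict_mono r2" using r1 by (auto simp: r2_def strict_mono_def)
    have m2: "m (r2 k) > 0" for k using k0 by (simp add: r2_def)
    have l2: "(\<lambda>k. m (r2 k)) \<longlonglongrightarrow> l" using LIMSEQ_ignore_initial_segment[OF l(1), of k0] by (simp add: r2_def)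
    define P where "P = (\<lambda>k. density (N (r2 k)) (\<lambda>_. ennreal (1 / m (r2 k))))"
    have "prob_space (P k)" for k
      by (rule prob_spaceI) (use m2[of k] in \<open>simp add: P_def emeasure_density sp em ennreal_mult[symmetric]\<close>)
    moreover have "sets (P k) = sets borel" for k by (simp add: P_def sN)
    ultimately obtain r3 M where r3: "strict_mono (r3 :: nat \<Rightarrow> nat)" "finite_measure M" and sM: "sets M = sets borel" and
      conv: "\<And>f. compactly_supported f \<Longrightarrow> (\<lambda>k. integral\<^sup>L (P (r3 k)) f) \<longlonglongrightarrow> integral\<^sup>L M f"
      using finite_measures_normalized_compact by blast
    show ?thesis
    proof (rule that[of "r2 \<circ> r3" "density M (\<lambda>_. ennreal l)"])
      show "strict_mono (r2 \<circ> r3)" using r2 r3 by (simp add: strict_mono_o)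
      show "sets (density M (\<lambda>_. ennreal l)) = sets borel" by (simp add: sM)
      interpret M: finite_measure M by fact
      show "finite_measure (density M (\<lambda>_. ennreal l))"
        by (rule finite_measureI) (simp add: emeasure_density ennreal_mult_eq_top_iff)
      fix f :: "'a \<Rightarrow> real" assume f: "compactly_supported f"
      have [measurable]: "f \<in> borel_measurable borel" using f by (auto intro: borel_measurable_continuous_onI)
      have "integral\<^sup>L (N (r2 k)) f = m (r2 k) * integral\<^sup>L (P k) f" for k
        unfolding P_def using m2[of k] by (subst integral_density_const) auto
      moreover have "(\<lambda>k. m (r2 (r3 k)) * integral\<^sup>L (P (r3 k)) f) \<longlonglongrightarrow> l * integral\<^sup>L M f"
        using LIMSEQ_subseq_LIMSEQ[OF l2 r3(1)] conv[OF f] by (intro tendsto_mult) (auto simp: comp_def)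
      moreover have "integral\<^sup>L (density M (\<lambda>_. ennreal l)) f = l * integral\<^sup>L M f"
        using lpos sM by (intro integral_density_const) (auto cong: measurable_cong_sets)
      ultimately show "(\<lambda>k. integral\<^sup>L (N ((r2 \<circ> r3) k)) f) \<longlonglongrightarrow> integral\<^sup>L (density M (\<lambda>_. ennreal l)) f"
        by simp
    qed
  qed
qed

section \<open>Increasing limits of potentials\<close>

text \<open>The weight \<open>\<psi>\<close> turns measures of possibly infinite mass into bounded
  ones. Dividing a test function by the positive continuous weight keeps its support, so the limit
  can be unweighted again.\<close>

lemma radon_compact:
  fixes \<mu> :: "nat \<Rightarrow> 'a::euclidean_space measure" and \<psi> :: "'a \<Rightarrow> real"
  assumes rad: "\<And>k. radon_pos (\<mu> k)" and psi: "continuous_on UNIV \<psi>" "\<And>x. \<psi> x > 0"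
    and bd: "\<And>k. (\<integral>\<^sup>+ x. ennreal (\<psi> x) \<partial>\<mu> k) \<le> ennreal C" and C: "C \<ge> 0"
  obtains r M where "strict_mono (r :: nat \<Rightarrow> nat)" "radon_pos M"
    "\<And>f. compactly_supported f \<Longrightarrow> (\<lambda>k. integral\<^sup>L (\<mu> (r k)) f) \<longlonglongrightarrow> integral\<^sup>L M f"
proof -
  note sm[measurable_cong] = radon_pos_sets[OF rad]
  have pm[measurable]: "\<psi> \<in> borel_measurable borel" using psi by (intro borel_measurable_continuous_onI)
  define N where "N = (\<lambda>k. density (\<mu> k) \<psi>)"
  have em: "emeasure (N k) UNIV = (\<integral>\<^sup>+ x. ennreal (\<psi> x) \<partial>\<mu> k)" for k
    unfolding N_def using sm by (subst emeasure_density) auto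
  have sN: "sets (N k) = sets borel" for k by (simp add: N_def sm)
  have spN: "space (N k) = UNIV" for k using sets_eq_imp_space_eq[OF sN[of k]] by simp
  have fin: "finite_measure (N k)" for k
  proof
    have "emeasure (N k) UNIV < \<infinity>" using em[of k] bd[of k] by (simp add: le_less_trans)
    then show "emeasure (N k) (space (N k)) \<noteq> \<infinity>" by (simp add: spN)
  qed
  have mass: "measure (N k) UNIV \<le> C" for k
  proof -
    have "ennreal (measure (N k) UNIV) \<le> ennreal C"
      using em[of k] bd[of k] finite_measure.emeasure_eq_measure[OF fin, of k UNIV] by simp
    then show ?thesis using C by simp
  qed
  obtain r M where r: "strict_mono (r :: nat \<Rightarrow> nat)"
    and M: "finite_measure M" and sM: "sets M = sets borel"
    and lim: "\<And>f. compactly_supported f \<Longrightarrow> (\<lambda>k. integral\<^sup>L (N (r k)) f) \<longlonglongrightarrow> integral\<^sup>L M f"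
    by (rule bounded_measures_compact[OF fin sN mass]) (rule that)
  note sM[measurable_cong]
  interpret M: finite_measure M by fact
  define L where "L = density M (\<lambda>x. ennreal (1 / \<psi> x))"
  show ?thesis
  proof (rule that[of r L])
    show "strict_mono r" by fact
    show "radon_pos L" unfolding radon_pos_def
    proof (intro conjI allI impI)
      show "sets L = sets borel" by (simp add: L_def sM)
      fix S :: "'a set" assume S: "compact S"
      show "emeasure L S < \<infinity>"
      proof (cases "S = {}")
        case False
        obtain z where z: "z \<in> S" "\<And>y. y \<in> S \<Longrightarrow> \<psi> z \<le> \<psi> y"
          using continuous_attains_inf[OF S False, of \<psi>] psi by (auto intro: continuous_on_subset)
        have Sb: "S \<in> sets borel" using S by (intro borel_closed compact_imp_closed)
        have "emeasure L S = (\<integral>\<^sup>+ x. ennreal (1 / \<psi> x) * indicator S x \<partial>M)"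
          unfolding L_def using Sb by (intro emeasure_density) auto
        also have "\<dots> \<le> (\<integral>\<^sup>+ x. ennreal (1 / \<psi> z) \<partial>M)"
          using z psi(2) by (intro nn_integral_mono) (auto split: split_indicator intro!: ennreal_leI divide_left_mono)
        also have "\<dots> < \<infinity>" by (simp add: ennreal_mult_eq_top_iff M.emeasure_finite less_top[symmetric])
        finally show ?thesis .
      qed simp
    qed
    fix f :: "'a \<Rightarrow> real" assume f: "compactly_supported f"
    have [measurable]: "f \<in> borel_measurable borel" using f by (auto intro: borel_measurable_continuous_onI)
    have psi0: "\<psi> x \<noteq> 0" for x using psi(2)[of x] by simp
    have fp: "compactly_supported (\<lambda>x. f x / \<psi> x)"
      using f psi psi0 by (auto intro!: continuous_intros)
    have 1: "integral\<^sup>L (\<mu> k) f = integral\<^sup>L (N k) (\<lambda>x. f x / \<psi> x)" for k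
      unfolding N_def using psi(2) psi0 by (subst integral_density) (auto simp: less_imp_le)
    have 2: "integral\<^sup>L L f = integral\<^sup>L M (\<lambda>x. f x / \<psi> x)"
      unfolding L_def using psi(2) by (subst integral_density) (auto simp: less_imp_le)
    show "(\<lambda>k. integral\<^sup>L (\<mu> (r k)) f) \<longlonglongrightarrow> integral\<^sup>L L f" unfolding 1 2 by (rule lim[OF fp])
  qed
qed

lemma compactly_supported_nn_integral:
  fixes f :: "'a::euclidean_space \<Rightarrow> real"
  assumes f: "compactly_supported f" and nn: "\<And>x. f x \<ge> 0" and rad: "radon_pos \<mu>"
  shows "(\<integral>\<^sup>+ x. ennreal (f x) \<partial>\<mu>) = ennreal (integral\<^sup>L \<mu> f)" "integrable \<mu> f"
proof -
  note sm[measurable_cong] = radon_pos_sets[OF rad]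
  have [measurable]: "f \<in> borel_measurable borel" using f by (auto intro: borel_measurable_continuous_onI)
  obtain C where C: "C \<ge> 0" "\<And>x. \<bar>f x\<bar> \<le> C" using compactly_supported_bounded[OF f] by blast
  define S where "S = closure {x. f x \<noteq> 0}"
  have S: "S \<in> sets borel" "emeasure \<mu> S < \<infinity>" using f rad by (auto simp: S_def radon_pos_def)
  have "(\<integral>\<^sup>+ x. ennreal (f x) \<partial>\<mu>) \<le> (\<integral>\<^sup>+ x. ennreal C * indicator S x \<partial>\<mu>)"
  proof (intro nn_integral_mono)
    fix x show "ennreal (f x) \<le> ennreal C * indicator S x"
      using C(2)[of x] closure_subset[of "{x. f x \<noteq> 0}"]
      by (cases "f x = 0") (auto simp: S_def split: split_indicator intro!: ennreal_leI)
  qed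
  also have "\<dots> = ennreal C * emeasure \<mu> S" using S sm by (subst nn_integral_cmult) auto
  also have "\<dots> < \<infinity>" using S by (simp add: ennreal_mult_less_top)
  finally show "integrable \<mu> f" using nn by (intro integrableI_nonneg) auto
  then show "(\<integral>\<^sup>+ x. ennreal (f x) \<partial>\<mu>) = ennreal (integral\<^sup>L \<mu> f)"
    using nn by (intro nn_integral_eq_integral) auto
qed

text \<open>The ramp lies between the radii \<open>R - 1\<close> and \<open>R\<close>, hence radius
  \<open>R + 1\<close> when the value 1 is wanted up to distance \<open>R\<close>.\<close>

definition cutoff :: "'a::euclidean_space \<Rightarrow> real \<Rightarrow> 'a \<Rightarrow> real" where
  "cutoff x R z = max 0 (min 1 (R - dist x z))"

lemma cutoff_bounds: "0 \<le> cutoff x R z" "cutoff x R z \<le> 1" by (auto simp: cutoff_def)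

lemma cutoff_eq_1: "dist x z \<le> R - 1 \<Longrightarrow> cutoff x R z = 1" by (auto simp: cutoff_def)

lemma cutoff_mono: "R \<le> R' \<Longrightarrow> cutoff x R z \<le> cutoff x R' z" by (auto simp: cutoff_def)

lemma compactly_supported_cutoff:
  fixes f :: "'a::euclidean_space \<Rightarrow> real"
  assumes "continuous_on UNIV f" shows "compactly_supported (\<lambda>z. f z * cutoff x R z)"
proof
  show "continuous_on UNIV (\<lambda>z. f z * cutoff x R z)"
    unfolding cutoff_def by (intro continuous_intros assms)
  have "{z. f z * cutoff x R z \<noteq> 0} \<subseteq> cball x R" by (auto simp: cutoff_def)
  then show "compact (closure {z. f z * cutoff x R z \<noteq> 0})"
    by (metis bounded_cball bounded_subset compact_closure)
qed

context sweeping
begin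

text \<open>\<open>K\<close> is an increasing limit of continuous functions of compact support, for
  which vague convergence gives equality. Both the singularity and mass moving to infinity can only
  make the limit potential smaller.\<close>

lemma potential_vague_le:
  assumes rad: "\<And>k. radon_pos (\<mu> k)" and M: "radon_pos M"
    and lim: "\<And>f. compactly_supported f \<Longrightarrow> (\<lambda>k. integral\<^sup>L (\<mu> k) f) \<longlonglongrightarrow> integral\<^sup>L M f"
  shows "conv_measure K M x \<le> liminf (\<lambda>k. conv_measure K (\<mu> k) x)"
proof -
  note sM[measurable_cong] = radon_pos_sets[OF M]
  \<comment> \<open>One index caps the singularity and enlarges the support at the same time, which
    makes the sequence increasing.\<close>
  define f where "f = (\<lambda>j z. enn2real (min (of_nat j) (K (x - z))) * cutoff x (real j) z)"
  have fin: "min (of_nat j) (K y) \<noteq> \<top>" for j y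
    by (rule less_imp_neq[OF le_less_trans[OF min.cobounded1 of_nat_less_top]])
  have cs: "compactly_supported (f j)" for j
    unfolding f_def
  proof (rule compactly_supported_cutoff)
    show "continuous_on UNIV (\<lambda>z. enn2real (min (of_nat j) (K (x - z))))"
    proof (rule continuous_on_sequentiallyI)
      fix Z :: "nat \<Rightarrow> 'a" and z assume "Z \<longlonglongrightarrow> z"
      then have "(\<lambda>k. x - Z k) \<longlonglongrightarrow> x - z" by (intro tendsto_intros)
      then have "(\<lambda>k. K (x - Z k)) \<longlonglongrightarrow> K (x - z)" unfolding K_def by (rule tendsto_riesz) (use dimn in simp)
      then have "(\<lambda>k. min (of_nat j) (K (x - Z k))) \<longlonglongrightarrow> min (of_nat j) (K (x - z))"
        by (rule tendsto_min[OF tendsto_const])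
      then show "(\<lambda>k. enn2real (min (of_nat j) (K (x - Z k)))) \<longlonglongrightarrow> enn2real (min (of_nat j) (K (x - z)))"
        using fin by (intro tendsto_enn2real) (auto simp: less_top)
    qed
  qed
  have nn: "f j z \<ge> 0" for j z by (simp add: f_def cutoff_bounds)
  have fe: "ennreal (f j z) = min (of_nat j) (K (x - z)) * ennreal (cutoff x (real j) z)" for j z
    using fin[of j "x - z"] by (simp add: f_def ennreal_mult cutoff_bounds less_top)
  have [measurable]: "f j \<in> borel_measurable borel" for j using cs[of j] by (auto intro: borel_measurable_continuous_onI)
  have fK: "ennreal (f j z) \<le> K (x - z)" for j z
    unfolding fe using mult_mono[of "min (of_nat j) (K (x - z))" "K (x - z)" "ennreal (cutoff x (real j) z)" 1]
      cutoff_bounds[of x "real j" z] by simp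
  have "incseq (\<lambda>j z. ennreal (f j z))"
    by (intro incseq_SucI le_funI, unfold fe) (intro mult_mono min.mono ennreal_leI cutoff_mono; simp)
  then have "(\<integral>\<^sup>+ z. (SUP j. ennreal (f j z)) \<partial>M) = (SUP j. \<integral>\<^sup>+ z. ennreal (f j z) \<partial>M)"
    by (rule nn_integral_monotone_convergence_SUP) measurable
  moreover have "(SUP j. ennreal (f j z)) = K (x - z)" for z
  proof (rule antisym)
    show "(SUP j. ennreal (f j z)) \<le> K (x - z)" by (intro SUP_least fK)
    show "K (x - z) \<le> (SUP j. ennreal (f j z))"
    proof (rule dense_le)
      fix c assume c: "c < K (x - z)"
      then have "c < \<top>" by (rule order_less_le_trans) simp
      then obtain j1 :: nat where j1: "c < of_nat j1" using ennreal_Ex_less_of_nat by blast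
      obtain j2 :: nat where j2: "dist x z + 1 \<le> real j2" using real_arch_simple by blast
      define j where "j = max j1 j2"
      have "cutoff x (real j) z = 1" using j2 by (intro cutoff_eq_1) (auto simp: j_def)
      moreover have "c < of_nat j" using j1 by (rule order_less_le_trans) (simp add: j_def)
      ultimately have "c \<le> ennreal (f j z)" unfolding fe using c by (auto simp: min_def)
      then show "c \<le> (SUP j. ennreal (f j z))" by (rule order_trans) (rule SUP_upper, simp)
    qed
  qed
  ultimately have "conv_measure K M x = (SUP j. \<integral>\<^sup>+ z. ennreal (f j z) \<partial>M)"
    by (simp add: conv_measure_def)
  also have "\<dots> \<le> liminf (\<lambda>k. conv_measure K (\<mu> k) x)"
  proof (rule SUP_least)
    fix j
    have "(\<lambda>k. \<integral>\<^sup>+ z. ennreal (f j z) \<partial>\<mu> k) \<longlonglongrightarrow> (\<integral>\<^sup>+ z. ennreal (f j z) \<partial>M)"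
      unfolding compactly_supported_nn_integral(1)[OF cs nn rad] compactly_supported_nn_integral(1)[OF cs nn M]
      by (intro tendsto_ennrealI lim cs)
    then have "(\<integral>\<^sup>+ z. ennreal (f j z) \<partial>M) = liminf (\<lambda>k. \<integral>\<^sup>+ z. ennreal (f j z) \<partial>\<mu> k)"
      by (intro lim_imp_Liminf[symmetric]) auto
    also have "\<dots> \<le> liminf (\<lambda>k. conv_measure K (\<mu> k) x)"
      unfolding conv_measure_def by (intro Liminf_mono always_eventually allI nn_integral_mono fK)
    finally show "(\<integral>\<^sup>+ z. ennreal (f j z) \<partial>M) \<le> liminf (\<lambda>k. conv_measure K (\<mu> k) x)" .
  qed
  finally show ?thesis .
qed

text \<open>A converse to \<open>conv_K_sweep_le\<close> away from the ball of radius
  \<open>R\<close>, with a constant independent of \<open>R\<close> by homogeneity. It bounds the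
  part of a potential produced outside a large ball by the swept potential, which tends to
  0.\<close>

lemma conv_K_sweep_lower:
  obtains \<kappa> :: real where "\<kappa> > 0" "\<And>R y. R > 0 \<Longrightarrow> norm y \<ge> R \<Longrightarrow> ennreal \<kappa> * K y \<le> conv K (sweep R) y"
proof -
  obtain e where e: "e > 0" "\<And>z. norm z \<le> 1 \<Longrightarrow> ennreal e \<le> \<rho> z" using rho_pos[of 1] by auto
  define c where "c = measure lborel (cball (0::'a) 1)"
  have c: "c > 0" "emeasure lborel (cball (0::'a) 1) = ennreal c"
  proof -
    show "c > 0" by (simp add: c_def content_cball_gt_0_iff)
    have "emeasure lborel (cball (0::'a) 1) \<noteq> \<top>" using emeasure_lborel_cball_finite[of "0::'a" 1] by simp
    then show "emeasure lborel (cball (0::'a) 1) = ennreal c" unfolding c_def by (rule emeasure_eq_ennreal_measure)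
  qed
  \<comment> \<open>For \<open>norm y \<ge> 1\<close> and \<open>norm z \<le> 1\<close> the distance
    of \<open>y\<close> and \<open>z\<close> is at most twice the norm of \<open>y\<close>, which
    gives the power of 2; \<open>e\<close> and \<open>c\<close> are the lower bound of
    \<open>\<rho>\<close> on the unit ball and the volume of that ball.\<close>
  define \<kappa> where "\<kappa> = 2 powr (\<alpha> - dimn) * e * c"
  have kap: "\<kappa> > 0" using e c by (simp add: \<kappa>_def)
  have base: "ennreal \<kappa> * K y \<le> conv K \<rho> y" if y: "norm y \<ge> 1" for y
  proof -
    have y0: "y \<noteq> 0" using y by auto
    have "ennreal \<kappa> * K y = (\<integral>\<^sup>+ z. ennreal (2 powr (\<alpha> - dimn)) * K y * ennreal e * indicator (cball (0::'a) 1) z \<partial>lborel)"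
      using e(1) c by (subst nn_integral_cmult_indicator) (auto simp: \<kappa>_def ennreal_mult mult_ac)
    also have "\<dots> \<le> (\<integral>\<^sup>+ z. K (y - z) * \<rho> z \<partial>lborel)"
    proof (intro nn_integral_mono)
      fix z :: 'a
      show "ennreal (2 powr (\<alpha> - dimn)) * K y * ennreal e * indicator (cball (0::'a) 1) z \<le> K (y - z) * \<rho> z"
      proof (cases "norm z \<le> 1")
        case True
        have "ennreal (2 powr (\<alpha> - dimn)) * K y \<le> K (y - z)"
        proof (cases "y = z")
          case False
          have "norm (y - z) \<le> 2 * norm y" using norm_triangle_ineq4[of y z] True y by linarith
          then have "(2 * norm y) powr (\<alpha> - dimn) \<le> norm (y - z) powr (\<alpha> - dimn)"
            using False dimn by (intro powr_mono2') auto
          then show ?thesis using False y0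
            by (simp add: K_def riesz_eq dimn_def powr_mult ennreal_mult[symmetric] ennreal_leI)
        qed (simp add: K_def riesz_eq)
        then show ?thesis using True e(2)[of z] by (auto intro!: mult_mono)
      qed simp
    qed
    finally show ?thesis by (simp add: conv_def)
  qed
  show ?thesis
  proof (rule that[OF kap])
    fix R and y :: 'a assume R: "R > (0::real)" and y: "norm y \<ge> R"
    have "norm (y /\<^sub>R R) \<ge> 1" using R y by (simp add: field_simps)
    then have "ennreal (R powr (\<alpha> - dimn)) * (ennreal \<kappa> * K (y /\<^sub>R R)) \<le> conv K (sweep R) y"
      unfolding conv_K_sweep_scale[OF R] by (intro mult_left_mono base) auto
    moreover have "K y = ennreal (R powr (\<alpha> - dimn)) * K (y /\<^sub>R R)"
      using riesz_scale[OF R, of \<alpha> "y /\<^sub>R R"] R by (simp add: K_def dimn_def)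
    ultimately show "ennreal \<kappa> * K y \<le> conv K (sweep R) y" by (simp add: mult_ac)
  qed
qed

text \<open>The average of the potential around \<open>x0\<close> with the everywhere positive
  density \<open>sweep 1\<close> is at most its finite value at \<open>x0\<close>.\<close>

lemma potential_AE_finite:
  assumes M: "radon_pos M" and x0: "conv_measure K M x0 < \<infinity>"
  shows "AE y in lborel. conv_measure K M y < \<infinity>"
proof -
  have [measurable]: "conv_measure K M \<in> borel_measurable borel" by (rule potential_measurable[OF M])
  have "conv (sweep 1) (conv_measure K M) x0 \<le> conv_measure K M x0"
    by (intro conv_sweep_potential_le radon_pos_sigma_finite radon_pos_sets M) simp
  then have "(\<integral>\<^sup>+ y. sweep 1 (x0 - y) * conv_measure K M y \<partial>lborel) \<noteq> \<infinity>"
    using x0 by (auto simp: conv_def top_unique)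
  then have "AE y in lborel. sweep 1 (x0 - y) * conv_measure K M y \<noteq> \<infinity>"
    by (intro nn_integral_noteq_infinite) auto
  then show ?thesis
  proof eventually_elim
    case (elim y)
    obtain e where "e > 0" "ennreal e \<le> \<rho> (x0 - y)" using rho_pos[of "norm (x0 - y)"] by auto
    then have "sweep 1 (x0 - y) \<noteq> 0" by (auto simp: sweep_def dilate_def)
    then show ?case using elim by (auto simp: less_top[symmetric] ennreal_mult_eq_top_iff)
  qed
qed


lemma conv_SUP:
  fixes h :: "'a \<Rightarrow> ennreal" and v :: "nat \<Rightarrow> 'a \<Rightarrow> ennreal"
  assumes [measurable]: "h \<in> borel_measurable borel" "\<And>k. v k \<in> borel_measurable borel"
    and inc: "\<And>x. incseq (\<lambda>k. v k x)"
  shows "conv h (\<lambda>x. SUP k. v k x) x = (SUP k. conv h (v k) x)"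
proof -
  have "conv h (\<lambda>x. SUP k. v k x) x = (\<integral>\<^sup>+ y. (SUP k. h (x - y) * v k y) \<partial>lborel)"
    unfolding conv_def by (intro nn_integral_cong SUP_mult_left_ennreal)
  also have "\<dots> = (SUP k. \<integral>\<^sup>+ y. h (x - y) * v k y \<partial>lborel)"
  proof (rule nn_integral_monotone_convergence_SUP)
    show "incseq (\<lambda>k y. h (x - y) * v k y)"
      by (intro incseq_SucI le_funI mult_left_mono incseq_SucD[OF inc]) auto
  qed simp
  finally show ?thesis by (simp add: conv_def)
qed

text \<open>The swept kernels vanish uniformly and are dominated by \<open>K\<close>, which is
  integrable at \<open>x\<close>.\<close>

lemma conv_sweep_potential_tendsto_0:
  assumes M: "radon_pos M" and x: "conv_measure K M x < \<infinity>"
  shows "(\<lambda>j. conv (sweep (real (Suc j))) (conv_measure K M) x) \<longlonglongrightarrow> 0"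
proof -
  note sM[measurable_cong] = radon_pos_sets[OF M]
  have eq: "conv (sweep r) (conv_measure K M) x = (\<integral>\<^sup>+ z. conv K (sweep r) (x - z) \<partial>M)" for r
    using radon_pos_sigma_finite[OF M] sM
    by (simp add: conv_conv_measure conv_commute[of "sweep r"]) (simp add: conv_measure_def)
  have "(\<lambda>j. \<integral>\<^sup>+ z. conv K (sweep (real (Suc j))) (x - z) \<partial>M) \<longlonglongrightarrow> (\<integral>\<^sup>+ z. 0 \<partial>M)"
  proof (rule nn_integral_dominated_convergence)
    show "(\<integral>\<^sup>+ z. K (x - z) \<partial>M) < \<infinity>" using x by (simp add: conv_measure_def)
    show "AE z in M. conv K (sweep (real (Suc j))) (x - z) \<le> K (x - z)" for j
      by (intro AE_I2 conv_K_sweep_le) simp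
    show "AE z in M. (\<lambda>j. conv K (sweep (real (Suc j))) (x - z)) \<longlonglongrightarrow> 0"
    proof (rule AE_I2, rule tendsto_sandwich[OF _ _ tendsto_const])
      fix z
      show "(\<lambda>j. 1 * ennreal (1 * real (Suc j) powr (\<alpha> - dimn) * B)) \<longlonglongrightarrow> 0" by (rule tendsto_scale_bound) simp
      show "eventually (\<lambda>j. conv K (sweep (real (Suc j))) (x - z) \<le> 1 * ennreal (1 * real (Suc j) powr (\<alpha> - dimn) * B)) sequentially"
        using conv_K_sweep_bound[of "real (Suc j)" "x - z" for j] by (intro always_eventually allI) simp
    qed simp
  qed measurable
  then show ?thesis by (simp add: eq)
qed

lemma tendsto_conv_K_sweep:
  assumes r: "r > 0" and X: "X \<longlonglongrightarrow> x" shows "(\<lambda>k. conv K (sweep r) (X k)) \<longlonglongrightarrow> conv K (sweep r) x"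
  unfolding conv_K_sweep_scale[OF r]
  by (intro ennreal_tendsto_cmult conv_tendsto[folded K_def] tendsto_intros X) simp

text \<open>A vague limit may lose mass to infinity, so only one inequality between the potentials
  is automatic. The common majorant \<open>U\<close> excludes the loss: its large-scale sweeps tend
  to 0 and control all tails uniformly in \<open>k\<close>.\<close>

lemma increasing_potentials_limit:
  assumes rad: "\<And>k. radon_pos (\<mu> k)" and inc: "\<And>x. incseq (\<lambda>k. conv_measure K (\<mu> k) x)"
    and A: "radon_pos MA" and le: "\<And>k x. conv_measure K (\<mu> k) x \<le> conv_measure K MA x"
    and x0: "conv_measure K MA x0 < \<infinity>"
  obtains M where "radon_pos M" "\<And>x. conv_measure K M x = (SUP k. conv_measure K (\<mu> k) x)"
proof -
  \<comment> \<open>A minorant of the kernel seen from \<open>x0\<close> with the same decay but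
    without the singularity; the 1 makes it continuous at \<open>x0\<close>.\<close>
  define \<psi> where "\<psi> = (\<lambda>z. (1 + norm (x0 - z)) powr (\<alpha> - dimn))"
  have psiK: "ennreal (\<psi> z) \<le> K (x0 - z)" for z
  proof (cases "x0 = z")
    case False
    then show ?thesis using dimn
      by (auto simp: \<psi>_def K_def riesz_eq dimn_def intro!: ennreal_leI powr_mono2')
  qed (simp add: K_def riesz_eq)
  obtain C where C: "conv_measure K MA x0 = ennreal C" "C \<ge> 0"
    using x0 by (cases "conv_measure K MA x0") auto
  have bd: "(\<integral>\<^sup>+ z. ennreal (\<psi> z) \<partial>\<mu> k) \<le> ennreal C" for k
  proof -
    have "(\<integral>\<^sup>+ z. ennreal (\<psi> z) \<partial>\<mu> k) \<le> conv_measure K (\<mu> k) x0"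
      unfolding conv_measure_def by (intro nn_integral_mono psiK)
    then show ?thesis using le[of k x0] C by simp
  qed
  have psi: "continuous_on UNIV \<psi>" "\<psi> z > 0" for z
    unfolding \<psi>_def by (auto intro!: continuous_intros simp: add_nonneg_eq_0_iff)
  obtain r M where r: "strict_mono (r :: nat \<Rightarrow> nat)" and M: "radon_pos M"
    and lim: "\<And>f. compactly_supported f \<Longrightarrow> (\<lambda>k. integral\<^sup>L (\<mu> (r k)) f) \<longlonglongrightarrow> integral\<^sup>L M f"
    by (rule radon_compact[OF rad psi bd C(2)]) (rule that)
  note sf = radon_pos_sigma_finite and st = radon_pos_sets
  note sM[measurable_cong] = st[OF M] and sMu[measurable_cong] = st[OF rad] and sA[measurable_cong] = st[OF A]
  define u where "u = (\<lambda>x. SUP k. conv_measure K (\<mu> k) x)"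
  define V where "V = conv_measure K M"
  define U where "U = conv_measure K MA"
  have [measurable]: "conv_measure K (\<mu> k) \<in> borel_measurable borel" "V \<in> borel_measurable borel" "U \<in> borel_measurable borel" for k
    unfolding V_def U_def by (intro potential_measurable rad M A)+
  have um[measurable]: "u \<in> borel_measurable borel" unfolding u_def by measurable
  have ulim: "(\<lambda>k. conv_measure K (\<mu> (r k)) x) \<longlonglongrightarrow> u x" for x
    using LIMSEQ_subseq_LIMSEQ[OF LIMSEQ_SUP[OF inc[of x]] r] by (simp add: comp_def u_def)
  have Vu: "V x \<le> u x" for x
  proof -
    have "V x \<le> liminf (\<lambda>k. conv_measure K (\<mu> (r k)) x)" unfolding V_def
      by (rule potential_vague_le[OF rad M lim])
    also have "\<dots> = u x" using ulim by (intro lim_imp_Liminf) auto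
    finally show ?thesis .
  qed
  have cm_eq: "conv (sweep d) (conv_measure K L) x = (\<integral>\<^sup>+ z. conv K (sweep d) (x - z) \<partial>L)" if L: "radon_pos L" for d L x
    using sf[OF L] st[OF L] by (simp add: conv_conv_measure conv_commute[of "sweep d"]) (simp add: conv_measure_def)
  obtain \<kappa> where kap: "\<kappa> > 0" "\<And>R y. R > 0 \<Longrightarrow> norm y \<ge> R \<Longrightarrow> ennreal \<kappa> * K y \<le> conv K (sweep R) y"
    by (rule conv_K_sweep_lower) (rule that)
  \<comment> \<open>After one sweeping the kernel is bounded and continuous, so a cutoff makes it an
    admissible test function; only the far part needs the majorant.\<close>
  have key: "conv (sweep d) u x \<le> V x" if d: "d > 0" and Ux: "U x < \<infinity>" for d x
  proof -
    have fin: "conv K (sweep d) y < \<infinity>" for y using conv_K_sweep_bound[OF d, of y] by (simp add: le_less_trans)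
    define H where "H = (\<lambda>z. enn2real (conv K (sweep d) (x - z)))"
    have He: "ennreal (H z) = conv K (sweep d) (x - z)" for z using fin[of "x - z"] by (simp add: H_def)
    have Hc: "continuous_on UNIV H"
    proof (rule continuous_on_sequentiallyI)
      fix Z :: "nat \<Rightarrow> 'a" and z assume "Z \<longlonglongrightarrow> z"
      then have "(\<lambda>k. x - Z k) \<longlonglongrightarrow> x - z" by (intro tendsto_intros)
      then have "(\<lambda>k. conv K (sweep d) (x - Z k)) \<longlonglongrightarrow> conv K (sweep d) (x - z)" by (rule tendsto_conv_K_sweep[OF d])
      then show "(\<lambda>k. H (Z k)) \<longlonglongrightarrow> H z" unfolding H_def using fin by (intro tendsto_enn2real) (auto simp: less_top)
    qed
    have est: "conv (sweep d) u x \<le> V x + ennreal (1 / \<kappa>) * conv (sweep R) U x" if R: "R > 0" for R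
    proof -
      define f where "f = (\<lambda>z. H z * cutoff x (R + 1) z)"
      have cs: "compactly_supported f" unfolding f_def by (rule compactly_supported_cutoff[OF Hc])
      have nn: "f z \<ge> 0" for z by (simp add: f_def H_def cutoff_bounds)
      have [measurable]: "f \<in> borel_measurable borel" using cs by (auto intro: borel_measurable_continuous_onI)
      \<comment> \<open>Inside radius \<open>R\<close> the cutoff equals 1; outside, the kernel is
        dominated by its sweep at scale \<open>R\<close>.\<close>
      have pw: "conv K (sweep d) (x - z) \<le> ennreal (f z) + ennreal (1 / \<kappa>) * conv K (sweep R) (x - z)" for z
      proof (cases "dist x z \<le> R")
        case True
        then have "ennreal (f z) = conv K (sweep d) (x - z)" by (simp add: f_def cutoff_eq_1 He)
        then show ?thesis by simp
      next
        case False
        have "conv K (sweep d) (x - z) \<le> K (x - z)" by (rule conv_K_sweep_le[OF d])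
        also have "\<dots> = ennreal (1 / \<kappa>) * (ennreal \<kappa> * K (x - z))"
          using kap(1) by (simp add: mult.assoc[symmetric] ennreal_mult[symmetric])
        also have "\<dots> \<le> ennreal (1 / \<kappa>) * conv K (sweep R) (x - z)"
          using False R by (intro mult_left_mono kap(2)) (auto simp: dist_norm)
        finally show ?thesis by (simp add: add_increasing)
      qed
      have 1: "conv (sweep d) (conv_measure K (\<mu> k)) x \<le> (\<integral>\<^sup>+ z. ennreal (f z) \<partial>\<mu> k) + ennreal (1 / \<kappa>) * conv (sweep R) U x" for k
      proof -
        have "conv (sweep d) (conv_measure K (\<mu> k)) x \<le> (\<integral>\<^sup>+ z. ennreal (f z) + ennreal (1 / \<kappa>) * conv K (sweep R) (x - z) \<partial>\<mu> k)"
          unfolding cm_eq[OF rad] by (intro nn_integral_mono pw)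
        also have "\<dots> = (\<integral>\<^sup>+ z. ennreal (f z) \<partial>\<mu> k) + ennreal (1 / \<kappa>) * conv (sweep R) (conv_measure K (\<mu> k)) x"
          unfolding cm_eq[OF rad] by (simp add: nn_integral_add nn_integral_cmult)
        also have "conv (sweep R) (conv_measure K (\<mu> k)) x \<le> conv (sweep R) U x"
          unfolding U_def by (intro conv_mono le) auto
        finally show ?thesis by (simp add: add_left_mono mult_left_mono)
      qed
      have "(\<lambda>k. \<integral>\<^sup>+ z. ennreal (f z) \<partial>\<mu> (r k)) \<longlonglongrightarrow> (\<integral>\<^sup>+ z. ennreal (f z) \<partial>M)"
        unfolding compactly_supported_nn_integral(1)[OF cs nn rad] compactly_supported_nn_integral(1)[OF cs nn M]
        by (intro tendsto_ennrealI lim cs)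
      then have 2: "(\<lambda>k. (\<integral>\<^sup>+ z. ennreal (f z) \<partial>\<mu> (r k)) + ennreal (1 / \<kappa>) * conv (sweep R) U x) \<longlonglongrightarrow>
          (\<integral>\<^sup>+ z. ennreal (f z) \<partial>M) + ennreal (1 / \<kappa>) * conv (sweep R) U x"
        by (intro tendsto_add tendsto_const)
      have 3: "(\<lambda>k. conv (sweep d) (conv_measure K (\<mu> (r k))) x) \<longlonglongrightarrow> conv (sweep d) u x"
      proof -
        have "incseq (\<lambda>k. conv (sweep d) (conv_measure K (\<mu> k)) x)"
          by (intro incseq_SucI conv_mono incseq_SucD[OF inc]) auto
        from LIMSEQ_subseq_LIMSEQ[OF LIMSEQ_SUP[OF this] r] show ?thesis
          unfolding u_def using inc by (subst conv_SUP) (auto simp: comp_def)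
      qed
      have "conv (sweep d) u x \<le> (\<integral>\<^sup>+ z. ennreal (f z) \<partial>M) + ennreal (1 / \<kappa>) * conv (sweep R) U x"
        by (rule LIMSEQ_le[OF 3 2]) (use 1 in auto)
      also have "(\<integral>\<^sup>+ z. ennreal (f z) \<partial>M) \<le> V x"
      proof -
        have "ennreal (f z) \<le> K (x - z)" for z
        proof -
          have "ennreal (f z) \<le> ennreal (H z)" using cutoff_bounds[of x "R + 1" z]
            by (intro ennreal_leI) (simp add: f_def H_def mult_left_le)
          also have "\<dots> \<le> K (x - z)" unfolding He by (rule conv_K_sweep_le[OF d])
          finally show ?thesis .
        qed
        then show ?thesis unfolding V_def conv_measure_def by (intro nn_integral_mono)
      qed
      finally show ?thesis by (simp add: add_right_mono)
    qed
    have "(\<lambda>j. conv (sweep (real (Suc j))) U x) \<longlonglongrightarrow> 0"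
      unfolding U_def by (rule conv_sweep_potential_tendsto_0[OF A]) (use Ux in \<open>simp add: U_def\<close>)
    then have "(\<lambda>j. V x + ennreal (1 / \<kappa>) * conv (sweep (real (Suc j))) U x) \<longlonglongrightarrow> V x + ennreal (1 / \<kappa>) * 0"
      by (intro tendsto_add tendsto_const ennreal_tendsto_cmult) auto
    then have "conv (sweep d) u x \<le> V x + ennreal (1 / \<kappa>) * 0"
      by (rule LIMSEQ_le_const) (use est[of "real (Suc j)" for j] in auto)
    then show ?thesis by simp
  qed
  have AEU: "AE y in lborel. U y < \<infinity>" unfolding U_def by (rule potential_AE_finite[OF A x0])
  have ulsc: "lsc u" unfolding u_def by (intro lsc_SUP lsc_potential sMu)
  have uV: "u x \<le> V x" for x
  proof -
    define d where "d = (\<lambda>k. 1 / real (Suc k))"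
    have d: "d k > 0" "d \<longlonglongrightarrow> 0" for k unfolding d_def using LIMSEQ_inverse_real_of_nat by (auto simp: divide_inverse)
    \<comment> \<open>The previous bound holds only where \<open>U\<close> is finite, that is almost
      everywhere. A second averaging ignores the exceptional set, and lower semicontinuity removes
      the two averagings one after the other.\<close>
    have dd: "conv (sweep e) (conv (sweep e') u) x \<le> V x" if e: "e > 0" and e': "e' > 0" for e e'
    proof -
      have "conv (sweep e) (conv (sweep e') u) x \<le> conv (sweep e) V x"
        unfolding conv_def[of "sweep e"]
      proof (rule nn_integral_mono_AE, use AEU in eventually_elim)
        fix y assume "U y < \<infinity>"
        then show "sweep e (x - y) * conv (sweep e') u y \<le> sweep e (x - y) * V y"
          by (intro mult_left_mono key e') auto
      qed
      also have "\<dots> \<le> V x" unfolding V_def by (intro conv_sweep_potential_le sf st M e)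
      finally show ?thesis .
    qed
    have step: "conv (sweep e) u x \<le> V x" if e: "e > 0" for e
    proof -
      have "conv (sweep e) u x \<le> liminf (\<lambda>k. conv (dilate (d k) \<rho>) (conv (sweep e) u) x)"
        by (intro lsc_le_liminf_conv_dilate lsc_conv lsc_sweep rho_mass d) auto
      also have "\<dots> \<le> liminf (\<lambda>k::nat. V x)"
        using dd[OF d(1) e] by (intro Liminf_mono always_eventually) (auto simp: sweep_def[symmetric])
      finally show ?thesis by (simp add: Liminf_const)
    qed
    have "u x \<le> liminf (\<lambda>k. conv (dilate (d k) \<rho>) u x)"
      by (intro lsc_le_liminf_conv_dilate ulsc rho_mass d) auto
    also have "\<dots> \<le> liminf (\<lambda>k::nat. V x)"
      using step[OF d(1)] by (intro Liminf_mono always_eventually) (auto simp: sweep_def[symmetric])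
    finally show ?thesis by (simp add: Liminf_const)
  qed
  show ?thesis
    by (rule that[OF M]) (use uV Vu in \<open>auto simp: u_def V_def intro: antisym\<close>)
qed

end

section \<open>Vague and strong convergence\<close>

lemma compactly_supported_ball:
  fixes f :: "'a::euclidean_space \<Rightarrow> real"
  assumes "compactly_supported f" obtains R where "R \<ge> 1" "\<And>x. norm x \<ge> R \<Longrightarrow> f x = 0"
proof -
  have "bounded (closure {x. f x \<noteq> 0})" using assms compact_imp_bounded by blast
  then obtain b where b: "\<And>x. x \<in> closure {x. f x \<noteq> 0} \<Longrightarrow> norm x \<le> b" by (auto simp: bounded_iff)
  show ?thesis
  proof (rule that[of "max 1 (b + 1)"])
    fix x :: 'a assume "max 1 (b + 1) \<le> norm x"
    then have "x \<notin> closure {x. f x \<noteq> 0}" using b[of x] by auto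
    then show "f x = 0" using closure_subset[of "{x. f x \<noteq> 0}"] by auto
  qed simp
qed

lemma compactly_supported_uniform:
  fixes f :: "'a::euclidean_space \<Rightarrow> real"
  assumes f: "compactly_supported f" and e: "e > 0"
  obtains d where "d > 0" "\<And>z w. norm w < d \<Longrightarrow> \<bar>f (z - w) - f z\<bar> \<le> e"
proof -
  obtain R where R: "R \<ge> 1" "\<And>x. norm x \<ge> R \<Longrightarrow> f x = 0" using compactly_supported_ball[OF f] by blast
  have "uniformly_continuous_on (cball 0 (R + 1)) f"
    using f by (intro compact_uniformly_continuous) (auto intro: continuous_on_subset)
  then obtain d where d: "d > 0" "\<And>x y. x \<in> cball 0 (R + 1) \<Longrightarrow> y \<in> cball 0 (R + 1) \<Longrightarrow> dist x y < d \<Longrightarrow> dist (f x) (f y) < e"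
    using e unfolding uniformly_continuous_on_def by metis
  show ?thesis
  proof (rule that[of "min d 1"])
    fix z w :: 'a assume w: "norm w < min d 1"
    show "\<bar>f (z - w) - f z\<bar> \<le> e"
    proof (cases "norm z \<le> R + 1 \<and> norm (z - w) \<le> R + 1")
      case True
      then show ?thesis using d(2)[of "z - w" z] w by (auto simp: dist_norm norm_minus_commute[of w z])
    next
      case False
      have "norm z \<le> norm (z - w) + norm w" "norm (z - w) \<le> norm z + norm w"
        using norm_triangle_ineq[of "z - w" w] norm_triangle_ineq4[of z w] by auto
      then have "norm z \<ge> R" "norm (z - w) \<ge> R" using False w by auto
      then show ?thesis using R(2) e by simp
    qed
  qed (use d in simp)
qed

context sweeping
begin

text \<open>The error must be small relative to a weight comparable with \<open>K (x0 - z)\<close>,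
  because the measures to be tested have bounded potential at \<open>x0\<close> rather than bounded
  mass. The growth exponent in \<open>w\<close> is the moment of \<open>g\<close> known to be
  finite.\<close>

lemma compactly_supported_modulus:
  fixes f :: "'a \<Rightarrow> real" and x0 :: 'a
  assumes f: "compactly_supported f" and e: "e > 0"
  obtains D where "D \<ge> 0"
    "\<And>z w. \<bar>f (z - w) - f z\<bar> \<le> (e + D * norm w powr (dimn - \<alpha>)) * (norm x0 + norm z + 1) powr (\<alpha> - dimn)"
proof -
  define p where "p = dimn - \<alpha>"
  have p: "p > 0" using dimn by (simp add: p_def)
  obtain C where C: "C \<ge> 0" "\<And>x. \<bar>f x\<bar> \<le> C" using compactly_supported_bounded[OF f] by blast
  obtain R where R: "R \<ge> 1" "\<And>x. norm x \<ge> R \<Longrightarrow> f x = 0" using compactly_supported_ball[OF f] by blast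
  define a where "a = (\<lambda>z::'a. (norm x0 + norm z + 1) powr (- p))"
  have apos: "a z > 0" for z
  proof -
    have "norm x0 + norm z + 1 > 0" using norm_ge_zero[of x0] norm_ge_zero[of z] by linarith
    then show ?thesis by (simp add: a_def)
  qed
  define a1 where "a1 = (norm x0 + 2 * R + 1) powr (- p)"
  have "norm x0 + 2 * R + 1 > 0" using R(1) norm_ge_zero[of x0] by linarith
  then have a1: "a1 > 0" by (simp add: a1_def)
  obtain d where d: "d > 0" "\<And>z w. norm w < d \<Longrightarrow> \<bar>f (z - w) - f z\<bar> \<le> e * a1"
    using compactly_supported_uniform[OF f, of "e * a1"] e a1 by (metis mult_pos_pos)
  \<comment> \<open>\<open>D1\<close> covers \<open>z\<close> near the support when \<open>w\<close>
    is not small; \<open>D2\<close> covers \<open>z\<close> beyond radius \<open>2 * R\<close>,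
    where a nonzero value forces the norm of \<open>w\<close> to be at least half that of
    \<open>z\<close>.\<close>
  define D1 where "D1 = 2 * C / (d powr p * a1)"
  define D2 where "D2 = C * 2 powr p * (norm x0 + 2) powr p"
  have D1: "D1 \<ge> 0" and D2: "D2 \<ge> 0" using C a1 by (auto simp: D1_def D2_def)
  have main: "\<bar>f (z - w) - f z\<bar> \<le> (e + (D1 + D2) * norm w powr p) * a z" for z w
  proof (cases "norm z \<le> 2 * R")
    case True
    have "a1 \<le> a z" unfolding a1_def a_def using True p norm_ge_zero[of x0] norm_ge_zero[of z]
      by (intro powr_mono2') linarith+
    have "\<bar>f (z - w) - f z\<bar> \<le> e * a1 + D1 * norm w powr p * a1"
    proof (cases "norm w < d")
      case True
      then have "\<bar>f (z - w) - f z\<bar> \<le> e * a1" by (rule d(2))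
      moreover have "0 \<le> D1 * norm w powr p * a1" using D1 a1 by simp
      ultimately show ?thesis by linarith
    next
      case False
      have "d powr p \<le> norm w powr p" using False d p by (intro powr_mono2) auto
      then have "1 \<le> norm w powr p / d powr p" using d by (simp add: field_simps)
      then have "2 * C * 1 \<le> 2 * C * (norm w powr p / d powr p)" using C by (intro mult_left_mono) auto
      also have "\<dots> = D1 * norm w powr p * a1" using a1 by (simp add: D1_def)
      finally have "2 * C \<le> D1 * norm w powr p * a1" by simp
      moreover have "\<bar>f (z - w) - f z\<bar> \<le> 2 * C" using C(2)[of "z - w"] C(2)[of z] by linarith
      moreover have "0 \<le> e * a1" using e a1 by simp
      ultimately show ?thesis by linarith
    qed
    also have "\<dots> = (e + D1 * norm w powr p) * a1" by (simp add: algebra_simps)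
    also have "\<dots> \<le> (e + (D1 + D2) * norm w powr p) * a z"
      using e D1 D2 a1 \<open>a1 \<le> a z\<close> by (intro mult_mono add_mono mult_right_mono) auto
    finally show ?thesis .
  next
    case False
    then have z: "norm z > 2 * R" by simp
    then have z0: "f z = 0" "norm z \<ge> 1" using R by auto
    show ?thesis
    proof (cases "f (z - w) = 0")
      case True
      have "0 \<le> (e + (D1 + D2) * norm w powr p) * a z"
        using e D1 D2 apos[of z] by (intro mult_nonneg_nonneg add_nonneg_nonneg) auto
      then show ?thesis using True z0 by simp
    next
      case False
      then have "norm (z - w) < R" using R(2)[of "z - w"] by fastforce
      moreover have "norm z \<le> norm (z - w) + norm w" using norm_triangle_ineq[of "z - w" w] by simp
      ultimately have w: "norm z \<le> 2 * norm w" using z by linarith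
      have "norm x0 + norm z + 1 \<le> (norm x0 + 2) * norm z"
      proof -
        have "norm x0 * 1 \<le> norm x0 * norm z" using z0 by (intro mult_left_mono) auto
        then show ?thesis using z0 by (simp add: algebra_simps)
      qed
      then have "((norm x0 + 2) * norm z) powr (- p) \<le> a z" unfolding a_def
        using p norm_ge_zero[of x0] norm_ge_zero[of z] by (intro powr_mono2') linarith+
      then have az: "(norm x0 + 2) powr (- p) * norm z powr (- p) \<le> a z" by (simp add: powr_mult)
      have "(norm z) powr p \<le> (2 * norm w) powr p" using w p z0 by (intro powr_mono2) auto
      moreover have zp: "0 < norm z powr p" using z0 by auto
      ultimately have "1 \<le> (2 * norm w) powr p / norm z powr p" by (simp add: le_divide_eq_1_pos[OF zp])
      then have "1 \<le> (2 * norm w) powr p * norm z powr (- p)" by (simp add: powr_minus_divide)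
      then have "C * 1 \<le> C * ((2 * norm w) powr p * norm z powr (- p))" using C by (intro mult_left_mono)
      also have "\<dots> = D2 * norm w powr p * ((norm x0 + 2) powr (- p) * norm z powr (- p))"
      proof -
        have "norm x0 + 2 > 0" using norm_ge_zero[of x0] by linarith
        then have "(norm x0 + 2) powr p * (norm x0 + 2) powr (- p) = 1" by (simp add: powr_add[symmetric])
        then show ?thesis by (simp add: D2_def powr_mult mult_ac)
      qed
      also have "\<dots> \<le> D2 * norm w powr p * a z" using az D2 by (intro mult_left_mono) auto
      also have "\<dots> \<le> (e + (D1 + D2) * norm w powr p) * a z"
      proof (rule mult_right_mono)
        have "0 \<le> D1 * norm w powr p" using D1 by simp
        then show "D2 * norm w powr p \<le> e + (D1 + D2) * norm w powr p" using e by (simp add: distrib_right)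
      qed (use apos[of z] in simp)
      finally show ?thesis using C(2)[of "z - w"] z0 by simp
    qed
  qed
  show ?thesis
    by (rule that[of "D1 + D2"]) (use D1 D2 main in \<open>auto simp: a_def p_def\<close>)
qed

text \<open>The dilated gap densities are an approximate identity. The two-sided error is a small
  multiple of the kernel seen from \<open>x0\<close>, so integrated against a measure it is
  controlled by the potential at \<open>x0\<close>.\<close>

lemma gap_density_approximation:
  fixes f :: "'a \<Rightarrow> real" and x0 :: 'a
  assumes f: "compactly_supported f" and nn: "\<And>x. f x \<ge> 0" and e: "e > 0"
  obtains r where "r > 0"
    "\<And>z. conv (gap_density r) (\<lambda>x. ennreal (f x)) z \<le> ennreal (f z) + ennreal e * K (x0 - z)"
    "\<And>z. ennreal (f z) \<le> conv (gap_density r) (\<lambda>x. ennreal (f x)) z + ennreal e * K (x0 - z)"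
proof -
  define p where "p = dimn - \<alpha>"
  have p: "p > 0" using dimn by (simp add: p_def)
  have [measurable]: "f \<in> borel_measurable borel" using f by (auto intro: borel_measurable_continuous_onI)
  obtain D where D: "D \<ge> 0"
    "\<And>z w. \<bar>f (z - w) - f z\<bar> \<le> (e / 2 + D * norm w powr (dimn - \<alpha>)) * (norm x0 + norm z + 1) powr (\<alpha> - dimn)"
    using compactly_supported_modulus[OF f, of "e / 2" x0] e by auto
  define m where "m = (\<integral>\<^sup>+ y. ennreal (norm y powr p) * (g y / G) \<partial>lborel)"
  have "m = (\<integral>\<^sup>+ y. ennreal (norm y powr p) * g y \<partial>lborel) / G"
    unfolding m_def by (subst nn_integral_divide[symmetric]) (auto simp: ennreal_times_divide)
  also have "\<dots> < \<infinity>" using g_moment G by (simp add: p_def dimn_def less_top[symmetric] ennreal_divide_eq_top_iff)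
  finally obtain m' where m': "m = ennreal m'" "m' \<ge> 0" by (cases m) auto
  \<comment> \<open>Makes \<open>D * r powr p * m'\<close> at most \<open>e / 2\<close>, the other
    half of \<open>e\<close> being spent on uniform continuity; \<open>m'\<close> is the moment of
    the normalized gap and the 1 avoids division by zero.\<close>
  define r where "r = (e / (2 * (D * m' + 1))) powr (1 / p)"
  have pos: "D * m' + 1 > 0" using D m' by (simp add: add_nonneg_pos)
  have r: "r > 0" using e pos by (simp add: r_def)
  have rp: "r powr p = e / (2 * (D * m' + 1))" using e pos p by (simp add: r_def powr_powr)
  have small: "e / 2 + D * r powr p * m' \<le> e"
  proof -
    have "D * r powr p * m' = (D * m') / (D * m' + 1) * (e / 2)" by (simp add: rp mult_ac)
    also have "\<dots> \<le> 1 * (e / 2)" using D m' pos e by (intro mult_right_mono) (auto simp: field_simps)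
    finally show ?thesis by simp
  qed
  define k where "k = (\<lambda>z::'a. ennreal ((norm x0 + norm z + 1) powr (- p)))"
  have kK: "k z \<le> K (x0 - z)" for z
  proof (cases "x0 = z")
    case False
    then show ?thesis using p norm_triangle_ineq4[of x0 z]
      by (auto simp: k_def K_def riesz_eq dimn_def[symmetric] p_def intro!: ennreal_leI powr_mono2')
  qed (simp add: K_def riesz_eq)
  define E where "E = (\<lambda>y::'a. ennreal (e / 2 + D * r powr p * norm y powr p))"
  have E_int: "(\<integral>\<^sup>+ y. E y * (g y / G) \<partial>lborel) \<le> ennreal e"
  proof -
    have "E y = ennreal (e / 2) + ennreal (D * r powr p) * ennreal (norm y powr p)" for y
      using e D by (simp add: E_def ennreal_mult[symmetric])
    then have "(\<integral>\<^sup>+ y. E y * (g y / G) \<partial>lborel) = ennreal (e / 2) * (\<integral>\<^sup>+ y. g y / G \<partial>lborel) + ennreal (D * r powr p) * m"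
      unfolding m_def by (simp add: distrib_right nn_integral_add nn_integral_cmult mult.assoc)
    also have "\<dots> = ennreal (e / 2 + D * r powr p * m')"
      using e D m' by (simp add: gG_mass ennreal_mult[symmetric])
    also have "\<dots> \<le> ennreal e" using small by (rule ennreal_leI)
    finally show ?thesis .
  qed
  have diff: "\<bar>f (z - r *\<^sub>R y) - f z\<bar> \<le> (e / 2 + D * r powr p * norm y powr p) * (norm x0 + norm z + 1) powr (- p)" for z y
    using D(2)[of z "r *\<^sub>R y"] r by (simp add: p_def powr_mult mult_ac)
  have nn2: "0 \<le> e / 2 + D * r powr p * norm y powr p" for y :: 'a
    using e D by (intro add_nonneg_nonneg mult_nonneg_nonneg) auto
  have up: "ennreal (f (z - r *\<^sub>R y)) \<le> ennreal (f z) + E y * k z" for z y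
  proof -
    have "f (z - r *\<^sub>R y) \<le> f z + (e / 2 + D * r powr p * norm y powr p) * (norm x0 + norm z + 1) powr (- p)"
      using diff[of z y] by linarith
    then show ?thesis using nn nn2[of y] by (simp add: E_def k_def ennreal_mult[symmetric] ennreal_plus[symmetric] ennreal_leI del: ennreal_plus)
  qed
  have low: "ennreal (f z) \<le> ennreal (f (z - r *\<^sub>R y)) + E y * k z" for z y
  proof -
    have "f z \<le> f (z - r *\<^sub>R y) + (e / 2 + D * r powr p * norm y powr p) * (norm x0 + norm z + 1) powr (- p)"
      using diff[of z y] by linarith
    then show ?thesis using nn nn2[of y] by (simp add: E_def k_def ennreal_mult[symmetric] ennreal_plus[symmetric] ennreal_leI del: ennreal_plus)
  qed
  have Em[measurable]: "E \<in> borel_measurable borel" unfolding E_def by measurable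
  have cg: "conv (gap_density r) (\<lambda>x. ennreal (f x)) z = (\<integral>\<^sup>+ y. ennreal (f (z - r *\<^sub>R y)) * (g y / G) \<partial>lborel)" for z
    unfolding gap_density_def by (rule conv_dilate[OF _ _ r]) auto
  have Ek: "(\<integral>\<^sup>+ y. E y * k z * (g y / G) \<partial>lborel) \<le> ennreal e * K (x0 - z)" for z
  proof -
    have "(\<integral>\<^sup>+ y. E y * k z * (g y / G) \<partial>lborel) = (\<integral>\<^sup>+ y. k z * (E y * (g y / G)) \<partial>lborel)"
      by (simp add: mult_ac)
    also have "\<dots> = k z * (\<integral>\<^sup>+ y. E y * (g y / G) \<partial>lborel)" by (rule nn_integral_cmult) measurable
    also have "\<dots> \<le> K (x0 - z) * ennreal e" by (intro mult_mono kK E_int) auto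
    finally show ?thesis by (simp add: mult.commute)
  qed
  show ?thesis
  proof (rule that[OF r])
    fix z
    have "conv (gap_density r) (\<lambda>x. ennreal (f x)) z \<le> (\<integral>\<^sup>+ y. (ennreal (f z) + E y * k z) * (g y / G) \<partial>lborel)"
      unfolding cg by (intro nn_integral_mono mult_right_mono up) auto
    also have "\<dots> = ennreal (f z) + (\<integral>\<^sup>+ y. E y * k z * (g y / G) \<partial>lborel)"
      by (simp add: distrib_right nn_integral_add nn_integral_cmult gG_mass)
    also have "\<dots> \<le> ennreal (f z) + ennreal e * K (x0 - z)" by (intro add_left_mono Ek)
    finally show "conv (gap_density r) (\<lambda>x. ennreal (f x)) z \<le> ennreal (f z) + ennreal e * K (x0 - z)" .
    have "ennreal (f z) = (\<integral>\<^sup>+ y. ennreal (f z) * (g y / G) \<partial>lborel)"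
      by (simp add: nn_integral_cmult gG_mass)
    also have "\<dots> \<le> (\<integral>\<^sup>+ y. (ennreal (f (z - r *\<^sub>R y)) + E y * k z) * (g y / G) \<partial>lborel)"
      by (intro nn_integral_mono mult_right_mono low) auto
    also have "\<dots> = conv (gap_density r) (\<lambda>x. ennreal (f x)) z + (\<integral>\<^sup>+ y. E y * k z * (g y / G) \<partial>lborel)"
      unfolding cg by (simp add: distrib_right nn_integral_add)
    also have "\<dots> \<le> conv (gap_density r) (\<lambda>x. ennreal (f x)) z + ennreal e * K (x0 - z)" by (intro add_left_mono Ek)
    finally show "ennreal (f z) \<le> conv (gap_density r) (\<lambda>x. ennreal (f x)) z + ennreal e * K (x0 - z)" .
  qed
qed


text \<open>Integrating \<open>K_split\<close> against \<open>L\<close> and \<open>F\<close>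
  recovers the integral of a smoothed function with respect to \<open>L\<close> from potentials
  alone. This is how convergence of potentials becomes convergence of measures.\<close>

lemma potential_split_dual:
  assumes L: "radon_pos L" and [measurable]: "F \<in> borel_measurable borel" and fin: "\<And>x. F x \<noteq> \<infinity>" and r: "r > 0"
  shows "(\<integral>\<^sup>+ x. F x * conv_measure K L x \<partial>lborel) =
    gap_mass r * (\<integral>\<^sup>+ x. conv (gap_density r) F x \<partial>L) + (\<integral>\<^sup>+ x. conv (sweep r) F x * conv_measure K L x \<partial>lborel)"
    "(\<integral>\<^sup>+ x. conv (sweep r) F x * conv_measure K L x \<partial>lborel) = (\<integral>\<^sup>+ x. F x * conv (sweep r) (conv_measure K L) x \<partial>lborel)"
proof -
  note sf = radon_pos_sigma_finite[OF L] and sL[measurable_cong] = radon_pos_sets[OF L]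
  have [measurable]: "conv_measure K L \<in> borel_measurable borel" by (rule potential_measurable[OF L])
  have gm[measurable]: "conv_measure (gap_density r) L \<in> borel_measurable borel"
    using sf sL by (intro measurable_conv_measure) auto
  have U: "conv_measure K L x = gap_mass r * conv_measure (gap_density r) L x + conv (sweep r) (conv_measure K L) x" for x
  proof -
    have "conv_measure K L x = (\<integral>\<^sup>+ y. gap_mass r * gap_density r (x - y) + conv K (sweep r) (x - y) \<partial>L)"
      unfolding conv_measure_def by (intro nn_integral_cong K_split[OF r])
    also have "\<dots> = gap_mass r * conv_measure (gap_density r) L x + conv_measure (conv K (sweep r)) L x"
      unfolding conv_measure_def by (simp add: nn_integral_add nn_integral_cmult)
    finally show ?thesis using sf sL by (simp add: conv_conv_measure conv_commute[of "sweep r"])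
  qed
  define \<nu> where "\<nu> = density lborel F"
  have nsf: "sigma_finite_measure \<nu>" unfolding \<nu>_def using fin
    by (subst sigma_finite_measure.sigma_finite_iff_density_finite[OF sigma_finite_lborel]) auto
  have sn: "sets \<nu> = sets borel" by (simp add: \<nu>_def)
  show 2: "(\<integral>\<^sup>+ x. conv (sweep r) F x * conv_measure K L x \<partial>lborel) = (\<integral>\<^sup>+ x. F x * conv (sweep r) (conv_measure K L) x \<partial>lborel)"
  proof -
    have "(\<integral>\<^sup>+ x. F x * conv (sweep r) (conv_measure K L) x \<partial>lborel) = (\<integral>\<^sup>+ x. conv (sweep r) (conv_measure K L) x \<partial>\<nu>)"
      unfolding \<nu>_def by (subst nn_integral_density) auto
    also have "\<dots> = (\<integral>\<^sup>+ x. conv_measure (sweep r) \<nu> x * conv_measure K L x \<partial>lborel)"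
      by (rule nn_integral_conv_dual) (auto simp: sweep_even nsf sn)
    also have "conv_measure (sweep r) \<nu> = conv (sweep r) F" by (simp add: \<nu>_def conv_eq_conv_measure)
    finally show ?thesis by simp
  qed
  have "(\<integral>\<^sup>+ x. F x * conv_measure K L x \<partial>lborel) =
     (\<integral>\<^sup>+ x. gap_mass r * (conv_measure (gap_density r) L x * F x) + F x * conv (sweep r) (conv_measure K L) x \<partial>lborel)"
    by (subst U) (simp add: distrib_left mult_ac)
  also have "\<dots> = gap_mass r * (\<integral>\<^sup>+ x. conv_measure (gap_density r) L x * F x \<partial>lborel) + (\<integral>\<^sup>+ x. F x * conv (sweep r) (conv_measure K L) x \<partial>lborel)"
    by (simp add: nn_integral_add nn_integral_cmult)
  also have "(\<integral>\<^sup>+ x. conv_measure (gap_density r) L x * F x \<partial>lborel) = (\<integral>\<^sup>+ x. conv (gap_density r) F x \<partial>L)"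
    by (rule nn_integral_conv_dual[symmetric]) (auto simp: gap_density_even sf sL)
  finally show "(\<integral>\<^sup>+ x. F x * conv_measure K L x \<partial>lborel) =
    gap_mass r * (\<integral>\<^sup>+ x. conv (gap_density r) F x \<partial>L) + (\<integral>\<^sup>+ x. conv (sweep r) F x * conv_measure K L x \<partial>lborel)"
    by (simp add: 2)
qed

text \<open>On a bounded set a compactly supported function lies below a multiple of the sweeping
  density centred at \<open>x0\<close>, and the swept potential at \<open>x0\<close> is
  finite.\<close>

lemma compactly_supported_potential_finite:
  fixes f :: "'a \<Rightarrow> real"
  assumes f: "compactly_supported f" and L: "radon_pos L" and x0: "conv_measure K L x0 < \<infinity>"
  shows "(\<integral>\<^sup>+ x. ennreal (f x) * conv_measure K L x \<partial>lborel) < \<infinity>"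
proof -
  have [measurable]: "conv_measure K L \<in> borel_measurable borel" by (rule potential_measurable[OF L])
  obtain C where C: "C \<ge> 0" "\<And>x. \<bar>f x\<bar> \<le> C" using compactly_supported_bounded[OF f] by blast
  obtain R where R: "R \<ge> 1" "\<And>x. norm x \<ge> R \<Longrightarrow> f x = 0" using compactly_supported_ball[OF f] by blast
  obtain e where e: "e > 0" "\<And>x. norm x \<le> norm x0 + R \<Longrightarrow> ennreal e \<le> \<rho> x" using rho_pos[of "norm x0 + R"] by auto
  have le: "ennreal (f x) \<le> ennreal (C / e) * sweep 1 (x0 - x)" for x
  proof (cases "norm x \<le> R")
    case True
    have "norm (x0 - x) \<le> norm x0 + R" using norm_triangle_ineq4[of x0 x] True by linarith
    then have "ennreal e \<le> sweep 1 (x0 - x)" using e by (simp add: sweep_def dilate_def)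
    have "ennreal (f x) \<le> ennreal C" using C(2)[of x] by (intro ennreal_leI) auto
    also have "\<dots> = ennreal (C / e) * ennreal e" using C e by (simp add: ennreal_mult[symmetric])
    also have "\<dots> \<le> ennreal (C / e) * sweep 1 (x0 - x)" by (intro mult_left_mono) (fact, simp)
    finally show ?thesis .
  next
    case False then show ?thesis using R(2)[of x] by simp
  qed
  have "(\<integral>\<^sup>+ x. ennreal (f x) * conv_measure K L x \<partial>lborel) \<le> (\<integral>\<^sup>+ x. ennreal (C / e) * (sweep 1 (x0 - x) * conv_measure K L x) \<partial>lborel)"
    unfolding mult.assoc[symmetric] by (intro nn_integral_mono mult_right_mono le) auto
  also have "\<dots> = ennreal (C / e) * conv (sweep 1) (conv_measure K L) x0"
    by (simp add: nn_integral_cmult conv_def)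
  also have "\<dots> \<le> ennreal (C / e) * conv_measure K L x0"
    by (intro mult_left_mono conv_sweep_potential_le radon_pos_sigma_finite radon_pos_sets L) auto
  also have "\<dots> < \<infinity>" using x0 by (simp add: ennreal_mult_less_top)
  finally show ?thesis .
qed

text \<open>For a fixed scale, the integrals of the smoothed function converge by monotone
  convergence of potentials. Replacing it by \<open>f\<close> costs an error bounded by the
  potential at \<open>x0\<close>, hence uniform in \<open>k\<close>.\<close>

lemma vague_convergence_nonneg:
  fixes f :: "'a \<Rightarrow> real"
  assumes rad: "\<And>k. radon_pos (\<mu> k)" and inc: "\<And>x. incseq (\<lambda>k. conv_measure K (\<mu> k) x)"
    and A: "radon_pos MA" and sup: "\<And>x. conv_measure K MA x = (SUP k. conv_measure K (\<mu> k) x)"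
    and x0: "conv_measure K MA x0 < \<infinity>"
    and f: "compactly_supported f" and nn: "\<And>x. f x \<ge> 0"
  shows "(\<lambda>k. integral\<^sup>L (\<mu> k) f) \<longlonglongrightarrow> integral\<^sup>L MA f"
proof -
  note sf = radon_pos_sigma_finite and st = radon_pos_sets
  note sMu[measurable_cong] = st[OF rad] and sA[measurable_cong] = st[OF A]
  define F where "F = (\<lambda>x. ennreal (f x))"
  have fm[measurable]: "f \<in> borel_measurable borel" using f by (auto intro: borel_measurable_continuous_onI)
  have Fm[measurable]: "F \<in> borel_measurable borel" by (simp add: F_def)
  have Ffin: "F x \<noteq> \<infinity>" for x by (simp add: F_def)
  define U where "U = conv_measure K MA"
  have [measurable]: "conv_measure K (\<mu> k) \<in> borel_measurable borel" "U \<in> borel_measurable borel" for k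
    unfolding U_def by (intro potential_measurable rad A)+
  obtain u0 where u0: "U x0 = ennreal u0" "u0 \<ge> 0" using x0 by (cases "U x0") (auto simp: U_def)
  have le0: "conv_measure K (\<mu> k) x \<le> U x" for k x unfolding U_def sup by (rule SUP_upper) simp
  have FU: "(\<integral>\<^sup>+ x. F x * U x \<partial>lborel) < \<infinity>"
    unfolding F_def U_def by (rule compactly_supported_potential_finite[OF f A x0])
  have mono: "(\<lambda>k. \<integral>\<^sup>+ x. H x * conv_measure K (\<mu> k) x \<partial>lborel) \<longlonglongrightarrow> (\<integral>\<^sup>+ x. H x * U x \<partial>lborel)"
    if [measurable]: "H \<in> borel_measurable borel" for H
  proof -
    have i: "incseq (\<lambda>k x. H x * conv_measure K (\<mu> k) x)"
      by (intro incseq_SucI le_funI mult_left_mono incseq_SucD[OF inc]) auto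
    have "(\<integral>\<^sup>+ x. H x * U x \<partial>lborel) = (SUP k. \<integral>\<^sup>+ x. H x * conv_measure K (\<mu> k) x \<partial>lborel)"
      unfolding U_def sup SUP_mult_left_ennreal by (rule nn_integral_monotone_convergence_SUP[OF i]) simp
    moreover have "incseq (\<lambda>k. \<integral>\<^sup>+ x. H x * conv_measure K (\<mu> k) x \<partial>lborel)"
      using i by (intro incseq_SucI nn_integral_mono le_funD[OF incseq_SucD[OF i]])
    ultimately show ?thesis using LIMSEQ_SUP by metis
  qed
  define a where "a = (\<lambda>L. \<integral>\<^sup>+ x. F x \<partial>(L :: 'a measure))"
  have a_eq: "a L = ennreal (integral\<^sup>L L f)" "0 \<le> integral\<^sup>L L f" if "radon_pos L" for L
    using compactly_supported_nn_integral[OF f nn that] nn by (auto simp: a_def F_def intro: integral_nonneg)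
  show ?thesis
  proof (rule LIMSEQ_I)
    fix \<epsilon> :: real assume eps: "\<epsilon> > 0"
    \<comment> \<open>The approximation error \<open>e * u0\<close> occurs twice, for
      \<open>\<mu> k\<close> and for \<open>MA\<close>; both together stay below
      \<open>\<epsilon>\<close>.\<close>
    define e where "e = \<epsilon> / (4 * (u0 + 1))"
    have e: "e > 0" using eps u0 by (simp add: e_def)
    have eu: "2 * (e * u0) < \<epsilon>"
    proof -
      have "2 * (e * u0) \<le> 2 * (e * (u0 + 1))" using e by simp
      also have "\<dots> = \<epsilon> / 2" unfolding e_def using u0 by (simp add: divide_simps)
      also have "\<dots> < \<epsilon>" using eps by simp
      finally show ?thesis .
    qed
    obtain r where r: "r > 0" and
      up: "\<And>z. conv (gap_density r) (\<lambda>x. ennreal (f x)) z \<le> ennreal (f z) + ennreal e * K (x0 - z)" and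
      low: "\<And>z. ennreal (f z) \<le> conv (gap_density r) (\<lambda>x. ennreal (f x)) z + ennreal e * K (x0 - z)"
      by (rule gap_density_approximation[OF f nn e, of x0]) (rule that)
    define b where "b = (\<lambda>L. \<integral>\<^sup>+ x. conv (gap_density r) F x \<partial>(L :: 'a measure))"
    have ab: "a L \<le> b L + ennreal (e * u0)" "b L \<le> a L + ennreal (e * u0)"
      if L: "radon_pos L" and le: "conv_measure K L x0 \<le> U x0" for L
    proof -
      note sL[measurable_cong] = st[OF L]
      have eL: "ennreal e * conv_measure K L x0 \<le> ennreal (e * u0)"
        using mult_left_mono[OF le, of "ennreal e"] u0 e by (simp add: ennreal_mult)
      have "a L \<le> (\<integral>\<^sup>+ z. conv (gap_density r) F z + ennreal e * K (x0 - z) \<partial>L)"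
        unfolding a_def F_def by (intro nn_integral_mono low)
      also have "\<dots> = b L + ennreal e * conv_measure K L x0"
        by (simp add: b_def conv_measure_def nn_integral_add nn_integral_cmult)
      also have "\<dots> \<le> b L + ennreal (e * u0)" by (intro add_left_mono eL)
      finally show "a L \<le> b L + ennreal (e * u0)" .
      have "b L \<le> (\<integral>\<^sup>+ z. F z + ennreal e * K (x0 - z) \<partial>L)"
        unfolding b_def F_def by (intro nn_integral_mono up)
      also have "\<dots> = a L + ennreal e * conv_measure K L x0"
        by (simp add: a_def conv_measure_def nn_integral_add nn_integral_cmult)
      also have "\<dots> \<le> a L + ennreal (e * u0)" by (intro add_left_mono eL)
      finally show "b L \<le> a L + ennreal (e * u0)" .
    qed
    define X where "X = (\<lambda>V. \<integral>\<^sup>+ x. F x * V x \<partial>lborel)"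
    define Y where "Y = (\<lambda>V. \<integral>\<^sup>+ x. conv (sweep r) F x * V x \<partial>lborel)"
    have split: "X (conv_measure K L) = gap_mass r * b L + Y (conv_measure K L)" if "radon_pos L" for L
      unfolding X_def Y_def b_def using potential_split_dual(1)[OF that Fm Ffin r] .
    have YU: "Y U \<le> X U"
      unfolding U_def split[OF A] by simp
    have Yle: "Y (conv_measure K (\<mu> k)) \<le> Y U" for k unfolding Y_def by (intro nn_integral_mono mult_left_mono le0) auto
    have XU: "X U < \<infinity>" using FU by (simp add: X_def)
    have cb: "gap_mass r * b L = X (conv_measure K L) - Y (conv_measure K L)" if "radon_pos L" "Y (conv_measure K L) \<noteq> \<infinity>" for L
      using split[OF that(1)] that(2) by simp
    have Yfin: "Y (conv_measure K (\<mu> k)) \<noteq> \<infinity>" "Y U \<noteq> \<infinity>" for k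
      using Yle[of k] YU XU by (auto simp: top_unique)
    \<comment> \<open>A difference of two increasing limits; it is legitimate because the integral
      of \<open>F\<close> against the limit potential is finite.\<close>
    have "(\<lambda>k. X (conv_measure K (\<mu> k)) - Y (conv_measure K (\<mu> k))) \<longlonglongrightarrow> X U - Y U"
      using XU Yfin unfolding X_def Y_def by (intro tendsto_diff_ennreal mono) auto
    then have "(\<lambda>k. gap_mass r * b (\<mu> k)) \<longlonglongrightarrow> gap_mass r * b MA"
      using cb[OF rad Yfin(1)] cb[OF A] Yfin(2) by (simp add: U_def)
    then have "(\<lambda>k. inverse (gap_mass r) * (gap_mass r * b (\<mu> k))) \<longlonglongrightarrow> inverse (gap_mass r) * (gap_mass r * b MA)"
      by (rule ennreal_tendsto_cmult[rotated]) (use gap_mass(1)[OF r] in \<open>simp add: less_top[symmetric]\<close>)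
    moreover have "inverse (gap_mass r) * (gap_mass r * t) = t" for t
    proof -
      have "t * gap_mass r / gap_mass r = t" using gap_mass[of r] r by (simp add: ennreal_mult_divide_eq)
      then show ?thesis by (simp add: divide_ennreal_def mult_ac)
    qed
    ultimately have bl: "(\<lambda>k. b (\<mu> k)) \<longlonglongrightarrow> b MA" by simp
    have bfin: "b L < \<infinity>" if "radon_pos L" "conv_measure K L x0 \<le> U x0" for L
      using ab(2)[OF that] a_eq(1)[OF that(1)] by (simp add: le_less_trans)
    define b' where "b' = (\<lambda>L. enn2real (b L))"
    have b': "b L = ennreal (b' L)" "b' L \<ge> 0" if "radon_pos L" "conv_measure K L x0 \<le> U x0" for L
      using bfin[OF that] by (auto simp: b'_def)
    have "(\<lambda>k. b' (\<mu> k)) \<longlonglongrightarrow> b' MA"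
      unfolding b'_def using bl bfin[OF A] bfin[OF rad le0] by (intro tendsto_enn2real) (auto simp: U_def less_top)
    then obtain k0 where k0: "\<And>k. k \<ge> k0 \<Longrightarrow> norm (b' (\<mu> k) - b' MA) < \<epsilon> - 2 * (e * u0)"
      using LIMSEQ_D[of "\<lambda>k. b' (\<mu> k)" "b' MA" "\<epsilon> - 2 * (e * u0)"] eu by auto
    have close: "\<bar>integral\<^sup>L L f - b' L\<bar> \<le> e * u0" if L: "radon_pos L" "conv_measure K L x0 \<le> U x0" for L
    proof -
      have "ennreal (integral\<^sup>L L f) \<le> ennreal (b' L + e * u0)" "ennreal (b' L) \<le> ennreal (integral\<^sup>L L f + e * u0)"
        using ab[OF L] b'[OF L] a_eq[OF L(1)] e u0 by auto
      then show ?thesis using b'[OF L] a_eq[OF L(1)] e u0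
        by (subst (asm) (1 2) ennreal_le_iff) (auto simp: abs_le_iff)
    qed
    show "\<exists>k0. \<forall>k\<ge>k0. norm (integral\<^sup>L (\<mu> k) f - integral\<^sup>L MA f) < \<epsilon>"
    proof (intro exI[of _ k0] allI impI)
      fix k assume "k \<ge> k0"
      then show "norm (integral\<^sup>L (\<mu> k) f - integral\<^sup>L MA f) < \<epsilon>"
        using k0[of k] close[OF rad le0, of k] close[OF A] by (simp add: U_def abs_le_iff abs_less_iff)
    qed
  qed
qed

lemma vague_convergence:
  assumes rad: "\<And>k. radon_pos (\<mu> k)" and inc: "\<And>x. incseq (\<lambda>k. conv_measure K (\<mu> k) x)"
    and A: "radon_pos MA" and sup: "\<And>x. conv_measure K MA x = (SUP k. conv_measure K (\<mu> k) x)"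
    and x0: "conv_measure K MA x0 < \<infinity>"
  shows "vague_conv \<mu> MA"
  unfolding vague_conv_def
proof (intro allI impI)
  fix f :: "'a \<Rightarrow> real" assume f: "compactly_supported f"
  \<comment> \<open>The values 1 and -1 of \<open>c\<close> give the positive and the negative part
    of \<open>f\<close>.\<close>
  have cs: "compactly_supported (\<lambda>x. max (c * f x) 0)" for c
  proof
    show "continuous_on UNIV (\<lambda>x. max (c * f x) 0)" using f by (auto intro!: continuous_intros)
    have "{x. max (c * f x) 0 \<noteq> 0} \<subseteq> {x. f x \<noteq> 0}" by auto
    then have "closure {x. max (c * f x) 0 \<noteq> 0} \<subseteq> closure {x. f x \<noteq> 0}" by (rule closure_mono)
    then show "compact (closure {x. max (c * f x) 0 \<noteq> 0})" using f compact_Int_closed[of _ "closure {x. max (c * f x) 0 \<noteq> 0}"]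
      by (metis Int_absorb1 closed_closure)
  qed
  have i: "integral\<^sup>L L f = integral\<^sup>L L (\<lambda>x. max (1 * f x) 0) - integral\<^sup>L L (\<lambda>x. max (-1 * f x) 0)" if "radon_pos L" for L
  proof -
    have "integral\<^sup>L L f = integral\<^sup>L L (\<lambda>x. max (1 * f x) 0 - max (-1 * f x) 0)"
      by (intro Bochner_Integration.integral_cong) (auto simp: max_def)
    also have "\<dots> = integral\<^sup>L L (\<lambda>x. max (1 * f x) 0) - integral\<^sup>L L (\<lambda>x. max (-1 * f x) 0)"
      by (intro Bochner_Integration.integral_diff compactly_supported_nn_integral(2) cs that) auto
    finally show ?thesis .
  qed
  show "(\<lambda>k. integral\<^sup>L (\<mu> k) f) \<longlonglongrightarrow> integral\<^sup>L MA f"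
    unfolding i[OF rad] i[OF A] by (intro tendsto_diff vague_convergence_nonneg[OF rad inc A sup x0 cs]) auto
qed

end

section \<open>Comparison principles that follow directly from the definition of balayage\<close>

lemma nearly_everywhere_on_subset:
  assumes "nearly_everywhere_on \<alpha> B P" "A \<subseteq> B" shows "nearly_everywhere_on \<alpha> A P"
proof -
  obtain N where N: "inner_cap \<alpha> N = 0" "\<forall>x\<in>B - N. P x" using assms unfolding nearly_everywhere_on_def by blast
  have "inner_cap \<alpha> (N \<inter> A) = 0" by (rule inner_cap_zero_mono[OF N(1)]) simp
  then show ?thesis using N assms(2) unfolding nearly_everywhere_on_def by (intro exI[of _ "N \<inter> A"]) auto
qed

lemma nearly_everywhere_on_always:
  assumes "\<And>x. P x" shows "nearly_everywhere_on \<alpha> (A :: 'a::euclidean_space set) P"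
proof -
  have "inner_cap \<alpha> ({} :: 'a set) = 0"
    unfolding inner_cap_zero_iff by (auto simp: concentrated_on_def null_sets_def dest!: top_le)
  then show ?thesis unfolding nearly_everywhere_on_def using assms by (intro exI[of _ "{}"]) auto
qed

lemma is_balayage_le:
  assumes "is_balayage \<alpha> \<mu> A \<nu>" "\<eta> \<in> Mplus \<alpha>"
    "nearly_everywhere_on \<alpha> A (\<lambda>y. potential \<alpha> \<eta> y \<ge> potential \<alpha> \<mu> y)"
  shows "potential \<alpha> \<nu> x \<le> potential \<alpha> \<eta> x"
  using assms unfolding is_balayage_def by (auto intro!: INF_lower2[of \<eta>])

text \<open>Enlarging the set shrinks the family of competitors, hence raises the infimum.\<close>

lemma is_balayage_mono:
  assumes "is_balayage \<alpha> \<mu> A \<nu>" "is_balayage \<alpha> \<mu> B \<nu>'" "A \<subseteq> B"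
  shows "potential \<alpha> \<nu> x \<le> potential \<alpha> \<nu>' x"
proof -
  have "potential \<alpha> \<nu>' x = (INF \<eta>\<in>{\<eta> \<in> Mplus \<alpha>. nearly_everywhere_on \<alpha> B (\<lambda>y. potential \<alpha> \<eta> y \<ge> potential \<alpha> \<mu> y)}. potential \<alpha> \<eta> x)"
    using assms(2) by (simp add: is_balayage_def)
  also have "\<dots> \<ge> potential \<alpha> \<nu> x"
    using is_balayage_le[OF assms(1)] nearly_everywhere_on_subset[OF _ assms(3)] by (intro INF_greatest) auto
  finally show ?thesis .
qed

section \<open>Energies and strong convergence\<close>

context sweeping
begin

lemma mutual_energy_eq: "mutual_energy \<alpha> \<nu> \<eta> = (\<integral>\<^sup>+ x. conv_measure K \<eta> x \<partial>\<nu>)" for \<nu> \<eta> :: "'a measure"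
  by (simp add: mutual_energy_def riesz_kernel_eq_riesz conv_measure_def K_def)

lemma mutual_energy_commute:
  "radon_pos \<nu> \<Longrightarrow> radon_pos \<eta> \<Longrightarrow> mutual_energy \<alpha> \<nu> \<eta> = mutual_energy \<alpha> \<eta> \<nu>" for \<nu> \<eta> :: "'a measure"
  unfolding mutual_energy_eq
  by (intro nn_integral_conv_measure_commute) (auto simp: K_even radon_pos_sigma_finite radon_pos_sets)

text \<open>By symmetry of mutual energy, a comparison of potentials can be used in one slot after
  the other.\<close>

lemma energy_le_of_potential_le:
  fixes \<nu> \<mu> :: "'a measure"
  assumes "radon_pos \<nu>" "radon_pos \<mu>" "\<And>x. conv_measure K \<nu> x \<le> conv_measure K \<mu> x"
  shows "energy \<alpha> \<nu> \<le> mutual_energy \<alpha> \<nu> \<mu>" "mutual_energy \<alpha> \<nu> \<mu> \<le> energy \<alpha> \<mu>"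
proof -
  show "energy \<alpha> \<nu> \<le> mutual_energy \<alpha> \<nu> \<mu>"
    unfolding energy_def mutual_energy_eq by (intro nn_integral_mono assms)
  have "mutual_energy \<alpha> \<nu> \<mu> = mutual_energy \<alpha> \<mu> \<nu>" by (rule mutual_energy_commute[OF assms(1,2)])
  also have "\<dots> \<le> energy \<alpha> \<mu>" unfolding energy_def mutual_energy_eq by (intro nn_integral_mono assms)
  finally show "mutual_energy \<alpha> \<nu> \<mu> \<le> energy \<alpha> \<mu>" .
qed

text \<open>The energies and the mutual energies with \<open>MA\<close> tend to the same finite
  limit, so the three terms of the squared distance cancel.\<close>

lemma energy_dist_tendsto_0:
  fixes \<mu> :: "nat \<Rightarrow> 'a measure"
  assumes rad: "\<And>k. radon_pos (\<mu> k)" and inc: "\<And>x. incseq (\<lambda>k. conv_measure K (\<mu> k) x)"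
    and A: "radon_pos MA" and sup: "\<And>x. conv_measure K MA x = (SUP k. conv_measure K (\<mu> k) x)"
    and fin: "energy \<alpha> MA < \<infinity>"
  shows "(\<lambda>k. energy_dist \<alpha> (\<mu> k) MA) \<longlonglongrightarrow> 0"
proof -
  define e where "e = energy \<alpha> MA"
  note sA[measurable_cong] = radon_pos_sets[OF A] and sMu[measurable_cong] = radon_pos_sets[OF rad]
  have [measurable]: "conv_measure K (\<mu> k) \<in> borel_measurable borel" for k by (rule potential_measurable[OF rad])
  have le: "conv_measure K (\<mu> k) x \<le> conv_measure K MA x" for k x unfolding sup by (rule SUP_upper) simp
  have SUP_int: "(SUP k. \<integral>\<^sup>+ x. conv_measure K (\<mu> k) x \<partial>\<nu>) = (\<integral>\<^sup>+ x. conv_measure K MA x \<partial>\<nu>)"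
    if [measurable_cong]: "sets \<nu> = sets borel" for \<nu> :: "'a measure"
    unfolding sup
    by (rule nn_integral_monotone_convergence_SUP[symmetric]) (use inc in \<open>auto simp: incseq_def le_fun_def\<close>)
  have mi: "incseq (\<lambda>k. \<integral>\<^sup>+ x. conv_measure K (\<mu> k) x \<partial>\<nu>)" for \<nu> :: "'a measure"
    by (intro incseq_SucI nn_integral_mono incseq_SucD[OF inc])
  have m: "(\<lambda>k. mutual_energy \<alpha> (\<mu> k) MA) \<longlonglongrightarrow> e"
    unfolding mutual_energy_commute[OF rad A] unfolding mutual_energy_eq e_def energy_def
    using LIMSEQ_SUP[OF mi[of MA]] SUP_int[OF sA] by simp
  have jk: "mutual_energy \<alpha> (\<mu> j) (\<mu> k) \<le> energy \<alpha> (\<mu> k)" if "j \<le> k" for j k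
    by (rule energy_le_of_potential_le(2)[OF rad rad incseqD[OF inc that]])
  have ei: "incseq (\<lambda>k. energy \<alpha> (\<mu> k))"
    unfolding incseq_def
  proof (intro allI impI)
    fix j k :: nat assume "j \<le> k"
    show "energy \<alpha> (\<mu> j) \<le> energy \<alpha> (\<mu> k)"
      using energy_le_of_potential_le[OF rad rad incseqD[OF inc \<open>j \<le> k\<close>]] by (rule order_trans)
  qed
  have "(SUP k. energy \<alpha> (\<mu> k)) = e"
  proof (rule antisym)
    show "(SUP k. energy \<alpha> (\<mu> k)) \<le> e"
      unfolding e_def using energy_le_of_potential_le[OF rad A le] by (intro SUP_least) (meson order_trans)
    \<comment> \<open>The first measure is kept fixed while the second potential increases to its
      limit; increasing the index of the first measure afterwards reaches the diagonal.\<close>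
    have "mutual_energy \<alpha> (\<mu> j) MA \<le> (SUP k. energy \<alpha> (\<mu> k))" for j
    proof -
      have "mutual_energy \<alpha> (\<mu> j) MA = (SUP k. mutual_energy \<alpha> (\<mu> j) (\<mu> k))"
        unfolding mutual_energy_eq using SUP_int[OF sMu] by simp
      also have "\<dots> \<le> (SUP k. energy \<alpha> (\<mu> k))"
      proof (rule SUP_least)
        fix k
        have "mutual_energy \<alpha> (\<mu> j) (\<mu> k) \<le> mutual_energy \<alpha> (\<mu> j) (\<mu> (max j k))"
          unfolding mutual_energy_eq by (intro nn_integral_mono incseqD[OF inc]) simp
        also have "\<dots> \<le> energy \<alpha> (\<mu> (max j k))" by (rule jk) simp
        also have "\<dots> \<le> (SUP k. energy \<alpha> (\<mu> k))" by (rule SUP_upper) simp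
        finally show "mutual_energy \<alpha> (\<mu> j) (\<mu> k) \<le> (SUP k. energy \<alpha> (\<mu> k))" .
      qed
      finally show ?thesis .
    qed
    then show "e \<le> (SUP k. energy \<alpha> (\<mu> k))" using m by (intro LIMSEQ_le_const2[OF m]) auto
  qed
  then have el: "(\<lambda>k. energy \<alpha> (\<mu> k)) \<longlonglongrightarrow> e" using LIMSEQ_SUP[OF ei] by simp
  have efin: "e < \<top>" using fin by (simp add: e_def)
  have ekfin: "mutual_energy \<alpha> (\<mu> k) MA < \<top>" "energy \<alpha> (\<mu> k) < \<top>" for k
    using energy_le_of_potential_le[OF rad A le, of k] efin by (auto simp: e_def)
  have r1: "(\<lambda>k. enn2real (energy \<alpha> (\<mu> k))) \<longlonglongrightarrow> enn2real e"
    using el efin ekfin by (intro tendsto_enn2real) auto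
  have r2: "(\<lambda>k. enn2real (mutual_energy \<alpha> (\<mu> k) MA)) \<longlonglongrightarrow> enn2real e"
    using m efin ekfin by (intro tendsto_enn2real) auto
  have "(\<lambda>k. energy_dist \<alpha> (\<mu> k) MA) \<longlonglongrightarrow> sqrt (enn2real e + enn2real e - 2 * enn2real e)"
    unfolding energy_dist_def e_def[symmetric] by (intro tendsto_intros r1 r2)
  then show ?thesis by simp
qed

end

theorem mainTheorem19:
  fixes \<alpha> :: real and A :: "'a::euclidean_space set" and U :: "nat \<Rightarrow> 'a set"
    and \<mu> \<mu>A :: "'a measure" and \<mu>Ak :: "nat \<Rightarrow> 'a measure"
  assumes "DIM('a) \<ge> 3" and "0 < \<alpha>" and "\<alpha> \<le> 2"
    and "\<And>k. universally_measurable (U k)" and "incseq U" and "(\<Union>k. U k) = UNIV"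
    and "\<mu> \<in> Mplus \<alpha>"
    and "is_balayage \<alpha> \<mu> A \<mu>A"
    and "\<And>k. is_balayage \<alpha> \<mu> (A \<inter> U k) (\<mu>Ak k)"
  shows "vague_conv \<mu>Ak \<mu>A
    \<and> (\<forall>x. incseq (\<lambda>k. potential \<alpha> (\<mu>Ak k) x)
           \<and> (\<lambda>k. potential \<alpha> (\<mu>Ak k) x) \<longlonglongrightarrow> potential \<alpha> \<mu>A x)
    \<and> (energy \<alpha> \<mu> < \<infinity> \<longrightarrow>
         energy \<alpha> \<mu>A < \<infinity> \<and> (\<forall>k. energy \<alpha> (\<mu>Ak k) < \<infinity>)
         \<and> (\<lambda>k. energy_dist \<alpha> (\<mu>Ak k) \<mu>A) \<longlonglongrightarrow> 0)"
proof -
  obtain \<rho> g :: "'a \<Rightarrow> ennreal" and B where "sweeping \<alpha> \<rho> g B"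
    using sweeping_exists[OF assms(1-3)] .
  then interpret sweeping \<alpha> \<rho> g B .
  note bA = assms(8) and bk = assms(9) and mu = assms(7)
  have MA: "\<mu>A \<in> Mplus \<alpha>" and Mk: "\<And>k. \<mu>Ak k \<in> Mplus \<alpha>"
    using bA bk by (auto simp: is_balayage_def)
  note radA = Mplus_radon[OF MA] and radk = Mplus_radon[OF Mk] and radm = Mplus_radon[OF mu]
  have self: "nearly_everywhere_on \<alpha> C (\<lambda>y. potential \<alpha> \<mu> y \<ge> potential \<alpha> \<mu> y)" for C
    by (rule nearly_everywhere_on_always) simp
  have inc: "incseq (\<lambda>k. potential \<alpha> (\<mu>Ak k) x)" for x
    by (intro incseq_SucI is_balayage_mono[OF bk bk]) (use incseq_SucD[OF assms(5)] in auto)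
  have leA: "potential \<alpha> (\<mu>Ak k) x \<le> potential \<alpha> \<mu>A x" for k x
    by (rule is_balayage_mono[OF bk bA]) auto
  obtain x0 where x0: "potential \<alpha> \<mu>A x0 < \<infinity>" using MA by (auto simp: Mplus_def less_top)
  \<comment> \<open>The potential of the balayage on \<open>A\<close> serves as the majorant that
    prevents loss of mass at infinity.\<close>
  obtain M where radM: "radon_pos M" and "\<And>x. conv_measure K M x = (SUP k. conv_measure K (\<mu>Ak k) x)"
    by (rule increasing_potentials_limit[OF radk inc[unfolded potential_eq] radA leA[unfolded potential_eq] x0[unfolded potential_eq]])
      (rule that)
  then have pM: "potential \<alpha> M x = (SUP k. potential \<alpha> (\<mu>Ak k) x)" for x by (simp add: potential_eq)
  have sup: "potential \<alpha> \<mu>A x = (SUP k. potential \<alpha> (\<mu>Ak k) x)" for x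
  proof (rule antisym)
    have "potential \<alpha> M x0 \<le> potential \<alpha> \<mu>A x0" unfolding pM by (intro SUP_least leA)
    then have "M \<in> Mplus \<alpha>" using x0 radM by (auto simp: Mplus_def intro!: exI[of _ x0])
    \<comment> \<open>This makes \<open>M\<close> a competitor for \<open>A\<close>. On each
      \<open>U k\<close> its exceptional points are exceptional for the balayage on
      \<open>A \<inter> U k\<close>, and universal measurability of the \<open>U k\<close> allows
      these sets to be glued.\<close>
    moreover have "nearly_everywhere_on \<alpha> A (\<lambda>y. potential \<alpha> M y \<ge> potential \<alpha> \<mu> y)"
      unfolding nearly_everywhere_on_def
    proof (intro exI[of _ "{x \<in> A. potential \<alpha> M x < potential \<alpha> \<mu> x}"] conjI)
      show "inner_cap \<alpha> {x \<in> A. potential \<alpha> M x < potential \<alpha> \<mu> x} = 0"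
      proof (rule inner_cap_zero_UN[of U])
        show "universally_measurable (U k)" for k by fact
        show "{x \<in> A. potential \<alpha> M x < potential \<alpha> \<mu> x} \<subseteq> (\<Union>k. U k)" using assms(6) by simp
        fix k
        have "potential \<alpha> (\<mu>Ak k) x \<le> potential \<alpha> M x" for x unfolding pM by (rule SUP_upper) simp
        then show "inner_cap \<alpha> ({x \<in> A. potential \<alpha> M x < potential \<alpha> \<mu> x} \<inter> U k) = 0"
          by (intro inner_cap_zero_mono[OF balayage_ge_nearly_everywhere[OF mu bk[of k]]]) (auto intro: le_less_trans)
      qed
    qed (auto simp: not_less)
    ultimately show "potential \<alpha> \<mu>A x \<le> (SUP k. potential \<alpha> (\<mu>Ak k) x)"
      unfolding pM[symmetric] by (rule is_balayage_le[OF bA])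
    show "(SUP k. potential \<alpha> (\<mu>Ak k) x) \<le> potential \<alpha> \<mu>A x" by (intro SUP_least leA)
  qed
  note facts = radk inc[unfolded potential_eq] radA sup[unfolded potential_eq]
  have "vague_conv \<mu>Ak \<mu>A" by (rule vague_convergence[OF facts x0[unfolded potential_eq]])
  moreover have "(\<lambda>k. potential \<alpha> (\<mu>Ak k) x) \<longlonglongrightarrow> potential \<alpha> \<mu>A x" for x
    unfolding sup by (rule LIMSEQ_SUP[OF inc])
  moreover have "energy \<alpha> \<mu>A < \<infinity> \<and> (\<forall>k. energy \<alpha> (\<mu>Ak k) < \<infinity>) \<and> (\<lambda>k. energy_dist \<alpha> (\<mu>Ak k) \<mu>A) \<longlonglongrightarrow> 0"
    if fin: "energy \<alpha> \<mu> < \<infinity>"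
  proof -
    \<comment> \<open>\<open>\<mu>\<close> is itself a competitor on every set, so each balayage
      potential is at most that of \<open>\<mu>\<close>, and finite energy is inherited.\<close>
    have en: "energy \<alpha> \<nu> < \<infinity>" if "radon_pos \<nu>" "\<And>x. potential \<alpha> \<nu> x \<le> potential \<alpha> \<mu> x" for \<nu>
      using energy_le_of_potential_le[OF that(1) radm that(2)[unfolded potential_eq]] fin by auto
    have eA: "energy \<alpha> \<mu>A < \<infinity>" by (rule en[OF radA is_balayage_le[OF bA mu self]])
    moreover have "energy \<alpha> (\<mu>Ak k) < \<infinity>" for k by (rule en[OF radk is_balayage_le[OF bk mu self]])
    ultimately show ?thesis using energy_dist_tendsto_0[OF facts eA] by auto
  qed
  ultimately show ?thesis using inc by auto
qed

end
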